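(* Let $k$ be an algebraically closed field of characteristic zero, $n=2m$ with $m>1$ odd, $D_n=\langle a,b\mid a^n=b^2=(ba)^2=1\rangle$ the dihedral group of order $2n$, $\chi\in\hat{D_n}$ the character with $\chi(a)=-1$, $\chi(b)=1$, and $H=kD_n(\chi,a^m,0)$. Let $G_0(kD_n)[Y]$ be the polynomial ring over $G_0(kD_n)$ in the set of variables $Y=\{y_\beta\mid\beta\in k^{\times}\}$, and let $(U)$ be the ideal generated by $$U=\{\chi y_\beta-y_\beta,\ y_\alpha y_\beta-2y_{\alpha+\beta},\ y_\beta y_{-\beta}-2(1+\chi)\mid\alpha,\beta\in k^{\times}\text{ with }\alpha\neq-\beta\},$$ where $\chi$ denotes the class $[V_\chi]\in G_0(kD_n)$. Then the Grothendieck ring $G_0(H)$ is isomorphic to the factor ring $G_0(kD_n)[Y]/(U)$.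
   Context: $k^{\times}=k\setminus\{0\}$; $\hat{D_n}$ is the group of linear characters $D_n\to k^{\times}$. For $\lambda\in\hat{D_n}$, $V_\lambda$ is the corresponding one-dimensional $kD_n$-module. $H=kD_n(\chi,a^m,0)$ is the Hopf algebra generated as an algebra by $D_n$ and an element $\xi$ with relations $\xi g=\chi(g)g\xi$ ($g\in D_n$) in addition to those of $kD_n$ (note $\chi^{-1}=\chi$); it has $k$-basis $\{g\xi^i\mid g\in D_n,i\ge0\}$, and $\Delta(\xi)=\xi\otimes a^m+1\otimes\xi$, $\varepsilon(\xi)=0$, $S(\xi)=-\xi a^{-m}$, $\Delta(g)=g\otimes g$, $\varepsilon(g)=1$, $S(g)=g^{-1}$. The Grothendieck ring $G_0(A)$ of a Hopf algebra $A$ is the abelian group generated by isomorphism classes $[V]$ of finite dimensional $A$-modules modulo $[V]=[U]+[W]$ for every short exact sequence $0\to U\to V\to W\to0$, with multiplication $[U][V]=[U\otimes V]$ (tensor product over $k$, action through $\Delta$). *)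

theory Defs
  imports
    "HOL-Computational_Algebra.Polynomial"
    "HOL-Library.Poly_Mapping"
    "HOL-Library.FuncSet"
    "HOL-Algebra.QuotRing"
    "HOL-Algebra.Generated_Groups"
    "HOL-Algebra.Indexed_Polynomials"
    "Jordan_Normal_Form.Matrix"
begin

section \<open>Free modules and algebras given by structure constants\<close>

text \<open>The free module over a commutative ring on a set \<open>B\<close> is realised by the finitely supported
  functions whose support is contained in \<open>B\<close>.\<close>

abbreviation bas :: "'b \<Rightarrow> 'b \<Rightarrow>\<^sub>0 'r::zero_neq_one" where
  "bas x \<equiv> Poly_Mapping.single x 1"

definition scl :: "'r::comm_ring_1 \<Rightarrow> ('b \<Rightarrow>\<^sub>0 'r) \<Rightarrow> ('b \<Rightarrow>\<^sub>0 'r)" where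
  "scl c f = Poly_Mapping.map (\<lambda>v. c * v) f"

definition lin :: "('b \<Rightarrow> ('c \<Rightarrow>\<^sub>0 'r)) \<Rightarrow> ('b \<Rightarrow>\<^sub>0 'r::comm_ring_1) \<Rightarrow> ('c \<Rightarrow>\<^sub>0 'r)" where
  "lin \<phi> f = (\<Sum>x\<in>Poly_Mapping.keys f. scl (Poly_Mapping.lookup f x) (\<phi> x))"

definition bilin ::
    "('b \<Rightarrow> 'c \<Rightarrow> ('d \<Rightarrow>\<^sub>0 'r)) \<Rightarrow> ('b \<Rightarrow>\<^sub>0 'r::comm_ring_1) \<Rightarrow> ('c \<Rightarrow>\<^sub>0 'r) \<Rightarrow> ('d \<Rightarrow>\<^sub>0 'r)" where
  "bilin \<mu> f g = lin (\<lambda>x. lin (\<mu> x) g) f"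

lemma lookup_scl: "Poly_Mapping.lookup (scl c f) x = c * Poly_Mapping.lookup f x"
  by (simp add: scl_def Poly_Mapping.map.rep_eq when_def)

lemma scl_simps:
  "scl c 0 = 0" "scl 1 f = f" "scl c (Poly_Mapping.single x d) = Poly_Mapping.single x (c * d)"
  by (rule poly_mapping_eqI, simp add: lookup_scl lookup_single when_def)+

lemma scl_add: "scl (c + d) f = scl c f + scl d f"
  by (rule poly_mapping_eqI) (simp add: lookup_scl lookup_add algebra_simps)

lemma lin_single: "lin \<phi> (Poly_Mapping.single x c) = scl c (\<phi> x)"
  by (cases "c = 0") (auto simp: lin_def intro!: poly_mapping_eqI simp: lookup_scl)

lemma bilin_single:
  "bilin \<mu> (Poly_Mapping.single x c) (Poly_Mapping.single y d) = scl c (scl d (\<mu> x y))"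
  by (simp add: bilin_def lin_single)

lemma lin_add: "lin \<phi> (f + g) = lin \<phi> f + lin \<phi> g"
proof -
  let ?B = "Poly_Mapping.keys f \<union> Poly_Mapping.keys g"
  have lin_eq: "lin \<phi> h = (\<Sum>x\<in>?B. scl (Poly_Mapping.lookup h x) (\<phi> x))"
    if "Poly_Mapping.keys h \<subseteq> ?B" for h
    unfolding lin_def using that
    by (intro sum.mono_neutral_left)
      (auto simp: in_keys_iff lookup_scl intro!: poly_mapping_eqI)
  show ?thesis
    by (simp add: lin_eq keys_add lookup_add scl_add sum.distrib)
qed

text \<open>The tensor product of free modules on \<open>B\<close> and \<open>C\<close> is the free module on \<open>B \<times> C\<close>.\<close>

definition tens :: "('b \<Rightarrow>\<^sub>0 'r::comm_ring_1) \<Rightarrow> ('c \<Rightarrow>\<^sub>0 'r) \<Rightarrow> ('b \<times> 'c \<Rightarrow>\<^sub>0 'r)" where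
  "tens = bilin (\<lambda>x y. bas (x, y))"

definition based_algebra ::
    "'b set \<Rightarrow> ('b \<Rightarrow> 'b \<Rightarrow> ('b \<Rightarrow>\<^sub>0 'r)) \<Rightarrow> ('b \<Rightarrow>\<^sub>0 'r) \<Rightarrow> ('r::comm_ring_1, 'b \<Rightarrow>\<^sub>0 'r) module" where
  "based_algebra B \<mu> e =
    \<lparr>carrier = {f. Poly_Mapping.keys f \<subseteq> B}, monoid.mult = bilin \<mu>, one = e, zero = 0, add = (+), smult = scl\<rparr>"

text \<open>\<open>(x \<otimes> y) (x' \<otimes> y') = x x' \<otimes> y y'\<close>\<close>

definition tensor_square_algebra ::
    "'b set \<Rightarrow> ('b \<Rightarrow> 'b \<Rightarrow> ('b \<Rightarrow>\<^sub>0 'r)) \<Rightarrow> ('b \<Rightarrow>\<^sub>0 'r) \<Rightarrow> ('r::comm_ring_1, 'b \<times> 'b \<Rightarrow>\<^sub>0 'r) module" where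
  "tensor_square_algebra B \<mu> e =
    based_algebra (B \<times> B) (\<lambda>(x, y) (x', y'). tens (\<mu> x x') (\<mu> y y')) (tens e e)"

text \<open>A Hopf algebra \<open>A\<close> with a chosen basis, so that \<open>A \<otimes> A\<close> has the pairs of basis elements
  as its basis. The record carries the structure maps only.\<close>

record (overloaded) ('k::zero, 'b) hopf_algebra = "('k, 'b \<Rightarrow>\<^sub>0 'k) module" +
  comult :: "('b \<Rightarrow>\<^sub>0 'k) \<Rightarrow> ('b \<times> 'b \<Rightarrow>\<^sub>0 'k)"
  counit :: "('b \<Rightarrow>\<^sub>0 'k) \<Rightarrow> 'k"
  antipode :: "('b \<Rightarrow>\<^sub>0 'k) \<Rightarrow> ('b \<Rightarrow>\<^sub>0 'k)"


section \<open>Group algebras and Hopf-Ore extensions\<close>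

text \<open>By von Dyck's theorem, a group of order \<open>2 n\<close> generated by elements \<open>a\<close>, \<open>b\<close> that satisfy
  the relations is presented by them.\<close>

definition dihedral :: "('g, 'z) monoid_scheme \<Rightarrow> nat \<Rightarrow> 'g \<Rightarrow> 'g \<Rightarrow> bool" where
  "dihedral D n a b \<longleftrightarrow>
    group D \<and> a \<in> carrier D \<and> b \<in> carrier D \<and> generate D {a, b} = carrier D \<and>
    a [^]\<^bsub>D\<^esub> n = \<one>\<^bsub>D\<^esub> \<and> b [^]\<^bsub>D\<^esub> (2::nat) = \<one>\<^bsub>D\<^esub> \<and> (b \<otimes>\<^bsub>D\<^esub> a) [^]\<^bsub>D\<^esub> (2::nat) = \<one>\<^bsub>D\<^esub> \<and>
    order D = 2 * n"

definition linear_characters :: "('g, 'z) monoid_scheme \<Rightarrow> ('g \<Rightarrow> 'k::field) set" where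
  "linear_characters G = hom G \<lparr>carrier = {c::'k. c \<noteq> 0}, monoid.mult = (*), one = 1\<rparr>"

definition group_algebra :: "('g, 'z) monoid_scheme \<Rightarrow> ('k::field, 'g) hopf_algebra" where
  "group_algebra G =
    module.extend (based_algebra (carrier G) (\<lambda>g h. bas (g \<otimes>\<^bsub>G\<^esub> h)) (bas \<one>\<^bsub>G\<^esub>))
      \<lparr>comult = lin (\<lambda>g. bas (g, g)),
       counit = (\<lambda>f. \<Sum>g\<in>Poly_Mapping.keys f. Poly_Mapping.lookup f g),
       antipode = lin (\<lambda>g. bas (inv\<^bsub>G\<^esub> g))\<rparr>"

text \<open>The Hopf algebra \<open>kG(\<chi>, c, 0)\<close>, with the pair \<open>(g, i)\<close> standing for the basis element
  \<open>g \<xi>\<^sup>i\<close>. The relation \<open>\<xi> g = \<chi>(g) g \<xi>\<close> gives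
  \<open>(g \<xi>\<^sup>i) (h \<xi>\<^sup>j) = \<chi>(h)\<^sup>i g h \<xi>\<^sup>i\<^sup>+\<^sup>j\<close>. The general convention has \<open>\<chi>\<inverse>(g)\<close>
  in that relation, so the definition below is meant for characters with \<open>\<chi>\<inverse> = \<chi>\<close>.\<close>

definition ore_mult ::
    "('g, 'z) monoid_scheme \<Rightarrow> ('g \<Rightarrow> 'k::field) \<Rightarrow> 'g \<times> nat \<Rightarrow> 'g \<times> nat \<Rightarrow> ('g \<times> nat \<Rightarrow>\<^sub>0 'k)" where
  "ore_mult G \<chi> = (\<lambda>(g, i) (h, j). Poly_Mapping.single (g \<otimes>\<^bsub>G\<^esub> h, i + j) (\<chi> h ^ i))"

definition ore_algebra ::
    "('g, 'z) monoid_scheme \<Rightarrow> ('g \<Rightarrow> 'k::field) \<Rightarrow> ('k, 'g \<times> nat \<Rightarrow>\<^sub>0 'k) module" where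
  "ore_algebra G \<chi> = based_algebra (carrier G \<times> UNIV) (ore_mult G \<chi>) (bas (\<one>\<^bsub>G\<^esub>, 0))"

definition ore_tensor_square ::
    "('g, 'z) monoid_scheme \<Rightarrow> ('g \<Rightarrow> 'k::field) \<Rightarrow>
      ('k, ('g \<times> nat) \<times> ('g \<times> nat) \<Rightarrow>\<^sub>0 'k) module" where
  "ore_tensor_square G \<chi> =
    tensor_square_algebra (carrier G \<times> UNIV) (ore_mult G \<chi>) (bas (\<one>\<^bsub>G\<^esub>, 0))"

text \<open>The structure maps are the multiplicative (for the antipode: antimultiplicative) extensions
  of the prescribed values on the generators, e.g.
  \<open>\<Delta>(g \<xi>\<^sup>i) = (g \<otimes> g) (\<xi> \<otimes> c + 1 \<otimes> \<xi>)\<^sup>i\<close> and \<open>S(g \<xi>\<^sup>i) = (- \<xi> c\<inverse>)\<^sup>i g\<inverse>\<close>.\<close>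

definition hopf_ore ::
    "('g, 'z) monoid_scheme \<Rightarrow> ('g \<Rightarrow> 'k::field) \<Rightarrow> 'g \<Rightarrow> ('k, 'g \<times> nat) hopf_algebra" where
  "hopf_ore G \<chi> c =
    (let H = ore_algebra G \<chi>; HH = ore_tensor_square G \<chi>;
         gr = (\<lambda>g. bas (g, 0)); \<xi> = bas (\<one>\<^bsub>G\<^esub>, 1);
         \<Delta>\<xi> = tens \<xi> (gr c) + tens (gr \<one>\<^bsub>G\<^esub>) \<xi>;
         S\<xi> = - (\<xi> \<otimes>\<^bsub>H\<^esub> gr (inv\<^bsub>G\<^esub> c))
     in module.extend H
          \<lparr>comult = lin (\<lambda>(g, i). tens (gr g) (gr g) \<otimes>\<^bsub>HH\<^esub> (\<Delta>\<xi> [^]\<^bsub>HH\<^esub> i)),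
           counit = (\<lambda>f. \<Sum>(g, i)\<in>Poly_Mapping.keys f. Poly_Mapping.lookup f (g, i) * 0 ^ i),
           antipode = lin (\<lambda>(g, i). (S\<xi> [^]\<^bsub>H\<^esub> i) \<otimes>\<^bsub>H\<^esub> gr (inv\<^bsub>G\<^esub> g))\<rparr>)"

text \<open>The generators of \<open>kG(\<chi>, c, 0)\<close> satisfy the prescribed relation, the products
  \<open>g \<xi>\<^sup>i\<close> are the basis, and the structure maps have the prescribed values on the generators.\<close>

lemma character_one:
  assumes "group G" and "\<chi> \<in> linear_characters G"
  shows "\<chi> \<one>\<^bsub>G\<^esub> = 1"
proof -
  interpret group G by fact
  show ?thesis
    using assms(2) unfolding linear_characters_def hom_def
    by (auto dest!: bspec[of _ _ "\<one>\<^bsub>G\<^esub>"] simp: Pi_iff)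
qed

lemma hopf_ore_generators:
  fixes G :: "('g, 'z) monoid_scheme" and \<chi> :: "'g \<Rightarrow> 'k::field"
  assumes "group G" and "\<chi> \<in> linear_characters G" and "c \<in> carrier G" and "g \<in> carrier G"
  defines "H \<equiv> hopf_ore G \<chi> c" and "gr \<equiv> \<lambda>h. bas (h, 0)" and "\<xi> \<equiv> bas (\<one>\<^bsub>G\<^esub>, 1)"
  shows "\<xi> \<otimes>\<^bsub>H\<^esub> gr g = \<chi> g \<odot>\<^bsub>H\<^esub> (gr g \<otimes>\<^bsub>H\<^esub> \<xi>)"
    and "gr g \<otimes>\<^bsub>H\<^esub> (\<xi> [^]\<^bsub>H\<^esub> (i::nat)) = bas (g, i)"
    and "comult H (gr g) = tens (gr g) (gr g)"
    and "comult H \<xi> = tens \<xi> (gr c) + tens \<one>\<^bsub>H\<^esub> \<xi>"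
    and "counit H (gr g) = 1"
    and "counit H \<xi> = 0"
    and "antipode H (gr g) = gr (inv\<^bsub>G\<^esub> g)"
    and "antipode H \<xi> = - (\<xi> \<otimes>\<^bsub>H\<^esub> gr (inv\<^bsub>G\<^esub> c))"
proof -
  interpret group G by fact
  note defs = H_def gr_def \<xi>_def hopf_ore_def Let_def module.defs ore_algebra_def
    ore_tensor_square_def tensor_square_algebra_def based_algebra_def tens_def ore_mult_def
  note eval = scl_simps lin_single bilin_single character_one[OF assms(1,2)] assms(3,4)
  have pow: "\<xi> [^]\<^bsub>H\<^esub> i = bas (\<one>\<^bsub>G\<^esub>, i)" for i :: nat
    by (induction i) (simp_all add: defs eval nat_pow_def)
  show "\<xi> \<otimes>\<^bsub>H\<^esub> gr g = \<chi> g \<odot>\<^bsub>H\<^esub> (gr g \<otimes>\<^bsub>H\<^esub> \<xi>)"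
    by (simp add: defs eval)
  show "gr g \<otimes>\<^bsub>H\<^esub> (\<xi> [^]\<^bsub>H\<^esub> i) = bas (g, i)"
    unfolding pow by (simp add: defs eval)
  show "comult H (gr g) = tens (gr g) (gr g)"
    by (simp add: defs eval)
  show "comult H \<xi> = tens \<xi> (gr c) + tens \<one>\<^bsub>H\<^esub> \<xi>"
    by (simp add: defs eval nat_pow_def) (simp add: eval bilin_def lin_add)
  show "counit H (gr g) = 1" and "counit H \<xi> = 0"
    by (simp_all add: defs)
  show "antipode H (gr g) = gr (inv\<^bsub>G\<^esub> g)"
    by (simp add: defs eval)
  show "antipode H \<xi> = - (\<xi> \<otimes>\<^bsub>H\<^esub> gr (inv\<^bsub>G\<^esub> c))"
    by (simp add: defs eval nat_pow_def flip: single_uminus)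
qed


section \<open>Finite dimensional modules\<close>

text \<open>Since isomorphism classes of finite dimensional modules are represented by modules with
  underlying vector space \<open>k\<^sup>d\<close>, a left module is a pair \<open>(d, \<rho>)\<close> of a natural number and a
  \<open>k\<close>-algebra homomorphism \<open>\<rho>\<close> from the algebra to the \<open>d \<times> d\<close> matrices (\<open>d = 0\<close> is allowed).\<close>

type_synonym ('k, 'b) matrix_module = "nat \<times> (('b \<Rightarrow>\<^sub>0 'k) \<Rightarrow> 'k mat)"

definition fd_modules :: "('k::field, 'b) hopf_algebra \<Rightarrow> ('k, 'b) matrix_module set" where
  "fd_modules A = {(d, \<rho>).
    \<rho> \<in> carrier A \<rightarrow>\<^sub>E carrier_mat d d \<and>
    (\<forall>x\<in>carrier A. \<forall>y\<in>carrier A. \<rho> (x \<oplus>\<^bsub>A\<^esub> y) = \<rho> x + \<rho> y) \<and>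
    (\<forall>c. \<forall>x\<in>carrier A. \<rho> (c \<odot>\<^bsub>A\<^esub> x) = c \<cdot>\<^sub>m \<rho> x) \<and>
    (\<forall>x\<in>carrier A. \<forall>y\<in>carrier A. \<rho> (x \<otimes>\<^bsub>A\<^esub> y) = \<rho> x * \<rho> y) \<and>
    \<rho> \<one>\<^bsub>A\<^esub> = 1\<^sub>m d}"

definition module_homs ::
    "('k::field, 'b) hopf_algebra \<Rightarrow> ('k, 'b) matrix_module \<Rightarrow> ('k, 'b) matrix_module \<Rightarrow> 'k mat set" where
  "module_homs A V W = {T \<in> carrier_mat (fst W) (fst V). \<forall>x\<in>carrier A. T * snd V x = snd W x * T}"

definition isomorphic_modules ::
    "('k::field, 'b) hopf_algebra \<Rightarrow> ('k, 'b) matrix_module \<Rightarrow> ('k, 'b) matrix_module \<Rightarrow> bool" where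
  "isomorphic_modules A V W \<longleftrightarrow>
    (\<exists>T\<in>module_homs A V W. bij_betw (\<lambda>v. T *\<^sub>v v) (carrier_vec (fst V)) (carrier_vec (fst W)))"

definition short_exact ::
    "('k::field, 'b) hopf_algebra \<Rightarrow> ('k, 'b) matrix_module \<Rightarrow> ('k, 'b) matrix_module \<Rightarrow>
      ('k, 'b) matrix_module \<Rightarrow> bool" where
  "short_exact A U V W \<longleftrightarrow>
    (\<exists>S\<in>module_homs A U V. \<exists>T\<in>module_homs A V W.
      inj_on (\<lambda>u. S *\<^sub>v u) (carrier_vec (fst U)) \<and>
      (\<lambda>u. S *\<^sub>v u) ` carrier_vec (fst U) = {v \<in> carrier_vec (fst V). T *\<^sub>v v = 0\<^sub>v (fst W)} \<and>
      (\<lambda>v. T *\<^sub>v v) ` carrier_vec (fst V) = carrier_vec (fst W))"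

definition kron :: "'k::times mat \<Rightarrow> 'k mat \<Rightarrow> 'k mat" where
  "kron P Q = mat (dim_row P * dim_row Q) (dim_col P * dim_col Q)
    (\<lambda>(i, j). P $$ (i div dim_row Q, j div dim_col Q) * Q $$ (i mod dim_row Q, j mod dim_col Q))"

text \<open>If \<open>\<Delta>(x) = \<Sum> x\<^sub>1 \<otimes> x\<^sub>2\<close>, then \<open>x\<close> acts on the tensor product of two modules as
  \<open>\<Sum> \<rho>(x\<^sub>1) \<otimes> \<sigma>(x\<^sub>2)\<close>. The sum is written entrywise because matrices of all sizes share one
  type and have no common zero.\<close>

definition tensor_module ::
    "('k::field, 'b) hopf_algebra \<Rightarrow> ('k, 'b) matrix_module \<Rightarrow> ('k, 'b) matrix_module \<Rightarrow>
      ('k, 'b) matrix_module" where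
  "tensor_module A V W =
    (fst V * fst W,
     \<lambda>x\<in>carrier A. mat (fst V * fst W) (fst V * fst W) (\<lambda>ij.
       \<Sum>(p, q)\<in>Poly_Mapping.keys (comult A x).
         Poly_Mapping.lookup (comult A x) (p, q) * kron (snd V (bas p)) (snd W (bas q)) $$ ij))"

definition trivial_module :: "('k::field, 'b) hopf_algebra \<Rightarrow> ('k, 'b) matrix_module" where
  "trivial_module A = (1, \<lambda>x\<in>carrier A. mat 1 1 (\<lambda>_. counit A x))"

definition character_module ::
    "('g, 'z) monoid_scheme \<Rightarrow> ('g \<Rightarrow> 'k::field) \<Rightarrow> ('k, 'g) matrix_module" where
  "character_module G \<eta> =
    (1, \<lambda>x\<in>carrier (group_algebra G :: ('k, 'g) hopf_algebra).
          mat 1 1 (\<lambda>_. \<Sum>g\<in>Poly_Mapping.keys x. Poly_Mapping.lookup x g * \<eta> g))"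


section \<open>Grothendieck rings\<close>

text \<open>The free abelian group on the finite dimensional modules, multiplied through the tensor
  product.\<close>

definition free_module_ring ::
    "('k::field, 'b) hopf_algebra \<Rightarrow> (('k, 'b) matrix_module \<Rightarrow>\<^sub>0 int) ring" where
  "free_module_ring A =
    \<lparr>carrier = {f. Poly_Mapping.keys f \<subseteq> fd_modules A},
     monoid.mult = bilin (\<lambda>V W. bas (tensor_module A V W)),
     one = bas (trivial_module A), zero = 0, add = (+)\<rparr>"

text \<open>The first set of relations identifies isomorphic modules, so that dividing by it gives the
  free abelian group on isomorphism classes.\<close>

definition grothendieck_relations ::
    "('k::field, 'b) hopf_algebra \<Rightarrow> (('k, 'b) matrix_module \<Rightarrow>\<^sub>0 int) set" where
  "grothendieck_relations A =
    {bas V - bas W |V W. V \<in> fd_modules A \<and> W \<in> fd_modules A \<and> isomorphic_modules A V W} \<union>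
    {bas V - (bas U + bas W) |U V W.
      U \<in> fd_modules A \<and> V \<in> fd_modules A \<and> W \<in> fd_modules A \<and> short_exact A U V W}"

text \<open>The subgroup spanned by the relations is an ideal because tensoring over a field is exact,
  so the quotient ring construction applies to it.\<close>

definition relation_subgroup ::
    "('k::field, 'b) hopf_algebra \<Rightarrow> (('k, 'b) matrix_module \<Rightarrow>\<^sub>0 int) set" where
  "relation_subgroup A = generate (add_monoid (free_module_ring A)) (grothendieck_relations A)"

definition G0 ::
    "('k::field, 'b) hopf_algebra \<Rightarrow> (('k, 'b) matrix_module \<Rightarrow>\<^sub>0 int) set ring" where
  "G0 A = free_module_ring A Quot relation_subgroup A"

definition G0_class ::
    "('k::field, 'b) hopf_algebra \<Rightarrow> ('k, 'b) matrix_module \<Rightarrow> (('k, 'b) matrix_module \<Rightarrow>\<^sub>0 int) set" where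
  "G0_class A V = relation_subgroup A +>\<^bsub>free_module_ring A\<^esub> bas V"


section \<open>Polynomial rings in a set of variables\<close>

text \<open>The library provides the set of polynomials in variables indexed by \<open>I\<close>, as functions
  from monomials (multisets over \<open>I\<close>) to coefficients, but no product of two polynomials.\<close>

definition indexed_poly_ring :: "('r, 'z) ring_scheme \<Rightarrow> 'c set \<Rightarrow> ('c multiset \<Rightarrow> 'r) ring" where
  "indexed_poly_ring R I =
    \<lparr>carrier = ring.indexed_pset R I (carrier R),
     monoid.mult = (\<lambda>P Q w. \<Oplus>\<^bsub>R\<^esub>u\<in>{u. u \<subseteq># w}. P u \<otimes>\<^bsub>R\<^esub> Q (w - u)),
     one = ring.indexed_const R \<one>\<^bsub>R\<^esub>,
     zero = ring.indexed_const R \<zero>\<^bsub>R\<^esub>,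
     add = ring.indexed_padd R\<rparr>"

definition U_relations ::
    "('g, 'z) monoid_scheme \<Rightarrow> ('g \<Rightarrow> 'k::field) \<Rightarrow> ('k multiset \<Rightarrow> (('k, 'g) matrix_module \<Rightarrow>\<^sub>0 int) set) set"
  where
  "U_relations D \<chi> =
    (let A = group_algebra D; R = G0 A; P = indexed_poly_ring R {\<beta>::'k. \<beta> \<noteq> 0};
         y = ring.indexed_var R;
         x = ring.indexed_const R (G0_class A (character_module D \<chi>))
     in {x \<otimes>\<^bsub>P\<^esub> y \<beta> \<ominus>\<^bsub>P\<^esub> y \<beta> |\<beta>. \<beta> \<noteq> 0} \<union>
        {y \<alpha> \<otimes>\<^bsub>P\<^esub> y \<beta> \<ominus>\<^bsub>P\<^esub> [(2::nat)] \<cdot>\<^bsub>P\<^esub> y (\<alpha> + \<beta>) |\<alpha> \<beta>. \<alpha> \<noteq> 0 \<and> \<beta> \<noteq> 0 \<and> \<alpha> \<noteq> - \<beta>} \<union>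
        {y \<beta> \<otimes>\<^bsub>P\<^esub> y (- \<beta>) \<ominus>\<^bsub>P\<^esub> [(2::nat)] \<cdot>\<^bsub>P\<^esub> (\<one>\<^bsub>P\<^esub> \<oplus>\<^bsub>P\<^esub> x) |\<beta>. \<beta> \<noteq> 0})"

end

theory Submission
  imports Defs
    "HOL-Computational_Algebra.Formal_Power_Series"
    "Jordan_Normal_Form.Char_Poly"
begin

text \<open>Both rings are identified with the same ring of functions by means of characters. A class in
  \<open>G\<^sub>0(kD\<^sub>n)\<close> is determined by its character. The element \<open>\<xi>\<^sup>2\<close> of \<open>H\<close> is central, and it is
  primitive because \<open>\<chi>(a\<^sup>m) = - 1\<close>. Hence, for an \<open>H\<close>-module \<open>V\<close>, \<open>g \<mapsto> \<Sum>\<^sub>j tr(g \<xi>\<^sup>2\<^sup>j) t\<^sup>j / j!\<close>, a function on \<open>D\<^sub>n\<close> with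
  values in \<open>k[[t]]\<close>, is additive on exact sequences and multiplicative on tensor products. A module
  has a filtration by pieces on which either \<open>\<xi> = 0\<close> or \<open>\<xi>\<^sup>2 = \<beta> \<noteq> 0\<close>; on such a piece the function is
  \<open>tr(g) exp(\<beta> t)\<close>, and two pieces with the same \<open>\<beta>\<close> and the same traces have the same class, because
  averaging over the group yields a nonzero map between them. As the \<open>exp(\<beta> t)\<close> are linearly
  independent, the function determines the class of \<open>V\<close>. If \<open>\<beta> \<noteq> 0\<close>, then \<open>\<xi>\<close> exchanges the eigenspaces
  of \<open>a\<^sup>m\<close>, so that \<open>tr(g) = (1 + \<chi>(g)) tr(g | N)\<close> for one of them, \<open>N\<close>.

  The evaluation \<open>y\<^sub>\<beta> \<mapsto> (1 + \<chi>) exp(\<beta> t)\<close> of \<open>G\<^sub>0(kD\<^sub>n)[Y]\<close> therefore has the image of \<open>G\<^sub>0(H)\<close> as its image.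
  It kills \<open>U\<close>. Modulo \<open>U\<close> every polynomial is of the form \<open>r\<^sub>0 + \<Sum> r\<^sub>\<beta> y\<^sub>\<beta>\<close>, and if that is in the
  kernel, then \<open>r\<^sub>0 = 0\<close> and \<open>(1 + \<chi>) r\<^sub>\<beta> = 0\<close>, so that \<open>r\<^sub>\<beta>\<close> is a multiple of \<open>1 - \<chi>\<close> and \<open>r\<^sub>\<beta> y\<^sub>\<beta>\<close> is
  in \<open>(U)\<close>.\<close>


section \<open>Matrices\<close>

text \<open>Write \<open>c = a^m\<close>. Since \<open>\<xi> c = \<chi>(c) c \<xi>\<close> and
  \<open>\<chi>(c) = (-1)^m = -1\<close>, the mixed terms of \<open>\<Delta>(\<xi>)^2\<close>
  cancel, and \<open>c^2 = 1\<close> turns the rest into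
  \<open>\<xi>^2 \<otimes> 1 + 1 \<otimes> \<xi>^2\<close>; this is where the oddness of
  \<open>m\<close> enters. Odd powers of \<open>\<xi>\<close> carry no information: conjugation by
  \<open>c\<close> changes the sign of \<open>g \<xi>^j\<close> for odd \<open>j\<close>, so its
  trace vanishes.

  Two obstacles shape the details. Characters take values in \<open>k\<close>, where halving is
  harmless, but classes have integer coefficients; hence every halved trace has to be the trace of
  an actual module, here the fixed space of \<open>c\<close>. And modules are compared one nonzero
  map at a time: the image of a map between modules with equal traces cancels, which leaves a kernel
  and a cokernel with equal traces and smaller dimension. The factor 2 in \<open>U\<close> comes
  from \<open>(1 + \<chi>)^2 = 2 (1 + \<chi>)\<close>, a consequence of
  \<open>\<chi>^2 = 1\<close>.\<close>

lemma full_rank_factorization_fun: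
  fixes a :: "nat \<Rightarrow> nat \<Rightarrow> 'a::field"
  shows "\<exists>(r::nat) L L' T T'. (\<forall>i<m. \<forall>j<d. a i j = (\<Sum>k<r. L i k * T k j)) \<and>
    (\<forall>k<r. \<forall>l<r. (\<Sum>i<m. L' k i * L i l) = (if k = l then 1 else 0)) \<and>
    (\<forall>k<r. \<forall>l<r. (\<Sum>j<d. T k j * T' j l) = (if k = l then 1 else 0))"
proof (induction "card {i. i < m \<and> (\<exists>j<d. a i j \<noteq> 0)}" arbitrary: a rule: less_induct)
  case less
  show ?case
  proof (cases "\<forall>i<m. \<forall>j<d. a i j = 0")
    case True
    show ?thesis by (rule exI[of _ "0::nat"]) (use True in simp)
  next
    case False
    then obtain p q where pq: "p < m" "q < d" "a p q \<noteq> 0" by blast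
    \<comment> \<open>Elimination at the pivot \<open>(p, q)\<close>: subtracting the rank one
      matrix \<open>a i q * t j\<close> clears row \<open>p\<close> and column \<open>q\<close> at
      once, so the number of nonzero rows drops.\<close>
    define t where "t j = a p j / a p q" for j
    define a1 where "a1 i j = a i j - a i q * t j" for i j
    have a1p: "a1 p j = 0" and a1q: "a1 i q = 0" for i j
      using pq by (auto simp: a1_def t_def)
    have "{i. i < m \<and> (\<exists>j<d. a1 i j \<noteq> 0)} \<subset> {i. i < m \<and> (\<exists>j<d. a i j \<noteq> 0)}"
    proof
      show "{i. i < m \<and> (\<exists>j<d. a1 i j \<noteq> 0)} \<subseteq> {i. i < m \<and> (\<exists>j<d. a i j \<noteq> 0)}"
      proof clarify
        fix i j assume "i < m" "j < d" "a1 i j \<noteq> 0"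
        then have "a i j \<noteq> 0 \<or> a i q \<noteq> 0" by (auto simp: a1_def)
        with \<open>j < d\<close> pq show "\<exists>j<d. a i j \<noteq> 0" by blast
      qed
      show "{i. i < m \<and> (\<exists>j<d. a1 i j \<noteq> 0)} \<noteq> {i. i < m \<and> (\<exists>j<d. a i j \<noteq> 0)}"
        using pq a1p by blast
    qed
    then have "card {i. i < m \<and> (\<exists>j<d. a1 i j \<noteq> 0)} < card {i. i < m \<and> (\<exists>j<d. a i j \<noteq> 0)}"
      by (intro psubset_card_mono) auto
    from less[OF this] obtain r :: nat and L L' T T' where
      f: "\<forall>i<m. \<forall>j<d. a1 i j = (\<Sum>k<r. L i k * T k j)" and
      l: "\<forall>k<r. \<forall>l<r. (\<Sum>i<m. L' k i * L i l) = (if k = l then 1 else 0)" and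
      t: "\<forall>k<r. \<forall>l<r. (\<Sum>j<d. T k j * T' j l) = (if k = l then 1 else 0)"
      by (elim exE conjE) (rule that; assumption)
    \<comment> \<open>Row \<open>p\<close> of \<open>a1\<close> is zero and \<open>T\<close> has a
      right inverse, so row \<open>p\<close> of \<open>L\<close> is zero; dually for column
      \<open>q\<close> of \<open>T\<close>. The old factors therefore do not interfere with the
      pivot.\<close>
    have Lp: "L p l = 0" if "l < r" for l
    proof -
      have "(\<Sum>j<d. a1 p j * T' j l) = (\<Sum>j<d. \<Sum>k<r. L p k * (T k j * T' j l))"
        using pq by (simp add: f sum_distrib_right mult.assoc)
      also have "\<dots> = (\<Sum>k<r. L p k * (\<Sum>j<d. T k j * T' j l))"
        by (subst sum.swap) (simp add: sum_distrib_left)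
      also have "\<dots> = L p l" using that by (simp add: t if_distrib cong: if_cong)
      finally show ?thesis by (simp add: a1p)
    qed
    have Tq: "T k q = 0" if "k < r" for k
    proof -
      have "(\<Sum>i<m. L' k i * a1 i q) = (\<Sum>i<m. \<Sum>l<r. (L' k i * L i l) * T l q)"
        using pq by (simp add: f sum_distrib_left mult.assoc)
      also have "\<dots> = (\<Sum>l<r. (\<Sum>i<m. L' k i * L i l) * T l q)"
        by (subst sum.swap) (simp add: sum_distrib_right)
      also have "\<dots> = (\<Sum>l<r. if k = l then T l q else 0)"
        using that by (intro sum.cong) (auto simp: l)
      also have "\<dots> = T k q" using that by simp
      finally show ?thesis by (simp add: a1q)
    qed
    \<comment> \<open>The new column and row are prepended at index 0. \<open>u\<close> and
      \<open>w\<close> record how the old one-sided inverses pair with the new column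
      \<open>a i q\<close> and the new row \<open>t\<close>; subtracting them at the pivot position
      restores the two identities.\<close>
    define u where "u k = (\<Sum>i<m. L' k i * a i q)" for k
    define w where "w l = (\<Sum>j<d. t j * T' j l)" for l
    define M where "M i k = (case k of 0 \<Rightarrow> a i q | Suc k \<Rightarrow> L i k)" for i k
    define M' where "M' k i = (case k of 0 \<Rightarrow> if i = p then 1 / a p q else 0
       | Suc k \<Rightarrow> L' k i - (if i = p then u k / a p q else 0))" for k i
    define N where "N k j = (case k of 0 \<Rightarrow> t j | Suc k \<Rightarrow> T k j)" for k j
    define N' where "N' j k = (case k of 0 \<Rightarrow> if j = q then 1 else 0
       | Suc k \<Rightarrow> T' j k - (if j = q then w k else 0))" for k j
    have "\<forall>i<m. \<forall>j<d. a i j = (\<Sum>k<Suc r. M i k * N k j)"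
      by (simp add: sum.lessThan_Suc_shift M_def N_def f[rule_format, symmetric] a1_def del: sum.lessThan_Suc)
    moreover
    have delta: "(\<Sum>i<m. (if i = p then c else 0) * g i) = c * g p" for c :: 'a and g
      using pq(1) by (simp add: if_distrib[of "\<lambda>z. z * _"] cong: if_cong)
    have "(\<Sum>i<m. M' k i * M i l) = (if k = l then 1 else 0)"
      if "k < Suc r" "l < Suc r" for k l
      using that pq Lp
      by (cases k; cases l) (auto simp: M_def M'_def left_diff_distrib sum_subtractf delta l u_def)
    moreover
    have delta': "(\<Sum>j<d. g j * (if j = q then c else 0)) = g q * c" for c :: 'a and g
      using pq(2) by (simp add: if_distrib[of "\<lambda>z. _ * z"] cong: if_cong)
    have tq: "t q = 1" using pq by (simp add: t_def)
    have "(\<Sum>j<d. N k j * N' j l) = (if k = l then 1 else 0)"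
      if "k < Suc r" "l < Suc r" for k l
      using that pq Tq
      by (cases k; cases l) (auto simp: N_def N'_def right_diff_distrib sum_subtractf delta' tq t w_def)
    ultimately show ?thesis by blast
  qed
qed

text \<open>\<open>T\<close> maps onto the image and \<open>L\<close> embeds it. All kernels,
  images, cokernels and one-sided inverses below are drawn from such a factorization, so that
  submodules are handled by matrix identities instead of subspaces.\<close>

lemma full_rank_factorization:
  fixes A :: "'a::field mat"
  assumes "A \<in> carrier_mat m d"
  obtains r L L' T T' where "L \<in> carrier_mat m r" "L' \<in> carrier_mat r m"
    "T \<in> carrier_mat r d" "T' \<in> carrier_mat d r"
    "A = L * T" "L' * L = 1\<^sub>m r" "T * T' = 1\<^sub>m r"
proof -
  obtain r :: nat and L L' T T' where
    f: "\<forall>i<m. \<forall>j<d. A $$ (i, j) = (\<Sum>k<r. L i k * T k j)"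
      "\<forall>k<r. \<forall>l<r. (\<Sum>i<m. L' k i * L i l) = (if k = l then 1 else 0)"
      "\<forall>k<r. \<forall>l<r. (\<Sum>j<d. T k j * T' j l) = (if k = l then 1 else 0)"
    using full_rank_factorization_fun[of m d "\<lambda>i j. A $$ (i, j)"]
    by (elim exE conjE) (rule that; assumption)
  show thesis
    by (rule that[of "mat m r (\<lambda>(i,k). L i k)" r "mat r m (\<lambda>(i,k). L' i k)"
          "mat r d (\<lambda>(i,k). T i k)" "mat d r (\<lambda>(i,k). T' i k)"])
      (use f assms in \<open>auto simp: scalar_prod_def lessThan_atLeast0\<close>)
qed

section \<open>Traces and Kronecker products\<close>

definition mtr :: "'a::comm_ring_1 mat \<Rightarrow> 'a" where
  "mtr M = (\<Sum>i<dim_row M. M $$ (i, i))"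

lemma mtr_mult_comm:
  assumes "A \<in> carrier_mat m n" "B \<in> carrier_mat n m"
  shows "mtr (A * B) = mtr (B * A)"
proof -
  have "mtr (A * B) = (\<Sum>i<m. \<Sum>j<n. A $$ (i, j) * B $$ (j, i))"
    using assms by (simp add: mtr_def scalar_prod_def lessThan_atLeast0)
  also have "\<dots> = (\<Sum>j<n. \<Sum>i<m. B $$ (j, i) * A $$ (i, j))"
    by (subst sum.swap) (simp add: mult.commute)
  also have "\<dots> = mtr (B * A)"
    using assms by (simp add: mtr_def scalar_prod_def lessThan_atLeast0)
  finally show ?thesis .
qed

lemma mtr_add: "A \<in> carrier_mat n n \<Longrightarrow> B \<in> carrier_mat n n \<Longrightarrow> mtr (A + B) = mtr A + mtr B"
  by (simp add: mtr_def sum.distrib)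

lemma mtr_smult: "mtr (c \<cdot>\<^sub>m A) = c * mtr A" if "A \<in> carrier_mat n n"
  using that by (simp add: mtr_def sum_distrib_left)

lemma minus_zero_mat: "Q \<in> carrier_mat m n \<Longrightarrow> Q - 0\<^sub>m m n = (Q :: 'a::comm_ring_1 mat)"
  by (intro eq_matI) auto

lemma one_smult_mat: "1 \<cdot>\<^sub>m A = (A :: 'a::comm_ring_1 mat)"
  by (intro eq_matI) auto

lemma smult_smult_mat: "k \<cdot>\<^sub>m (l \<cdot>\<^sub>m A) = (k * l) \<cdot>\<^sub>m (A :: 'a::comm_ring_1 mat)"
  by (rule eq_matI) auto

lemma mtr_transpose: "A \<in> carrier_mat n n \<Longrightarrow> mtr (transpose_mat A) = mtr A"
  by (simp add: mtr_def)

lemma mtr_one: "mtr (1\<^sub>m n) = of_nat n"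
  by (simp add: mtr_def)

text \<open>The Kronecker product numbers pairs of indices by quotient and remainder; this passes
  from that numbering back to a double sum.\<close>

lemma sum_div_mod:
  fixes f :: "nat \<Rightarrow> nat \<Rightarrow> 'a::comm_monoid_add"
  shows "(\<Sum>i<a * b. f (i div b) (i mod b)) = (\<Sum>i<a. \<Sum>j<b. f i j)"
proof (induction a)
  case (Suc a)
  have "(\<Sum>i<Suc a * b. f (i div b) (i mod b)) =
      (\<Sum>i<a * b. f (i div b) (i mod b)) + (\<Sum>i=a * b..<a * b + b. f (i div b) (i mod b))"
    by (simp add: lessThan_atLeast0 sum.atLeastLessThan_concat add.commute)
  also have "(\<Sum>i=a * b..<a * b + b. f (i div b) (i mod b)) = (\<Sum>j<b. f a j)"
    by (subst sum.atLeastLessThan_shift_0) (simp add: lessThan_atLeast0)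
  finally show ?case using Suc by simp
qed simp

lemma div_mod_less: "i < a * b \<Longrightarrow> i div b < a \<and> i mod b < (b::nat)"
  by (cases "b = 0") (auto simp: less_mult_imp_div_less)

lemma kron_carrier: "A \<in> carrier_mat a b \<Longrightarrow> B \<in> carrier_mat c d \<Longrightarrow> kron A B \<in> carrier_mat (a * c) (b * d)"
  by (auto simp: kron_def)

lemma kron_dim [simp]: "dim_row (kron A B) = dim_row A * dim_row B" "dim_col (kron A B) = dim_col A * dim_col B"
  by (auto simp: kron_def)

lemma kron_index: "i < dim_row A * dim_row B \<Longrightarrow> j < dim_col A * dim_col B \<Longrightarrow>
   kron A B $$ (i, j) = A $$ (i div dim_row B, j div dim_col B) * B $$ (i mod dim_row B, j mod dim_col B)"
  by (simp add: kron_def)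

text \<open>Tensor products of maps compose factor by factor. The checks that tensor products of
  modules are again modules rest on this rule.\<close>

lemma kron_mult:
  fixes A :: "'a::comm_ring_1 mat"
  assumes "dim_col A = dim_row C" "dim_col B = dim_row D"
  shows "kron A B * kron C D = kron (A * C) (B * D)"
proof (rule eq_matI)
  fix i j assume "i < dim_row (kron (A * C) (B * D))" "j < dim_col (kron (A * C) (B * D))"
  then have ij: "i < dim_row A * dim_row B" "j < dim_col C * dim_col D" by auto
  note ij' = div_mod_less[OF ij(1)] div_mod_less[OF ij(2)]
  have "(kron A B * kron C D) $$ (i, j) =
    (\<Sum>k<dim_row C * dim_row D. (A $$ (i div dim_row B, k div dim_row D) * C $$ (k div dim_row D, j div dim_col D))
       * (B $$ (i mod dim_row B, k mod dim_row D) * D $$ (k mod dim_row D, j mod dim_col D)))"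
    using ij assms by (simp add: scalar_prod_def lessThan_atLeast0 kron_index algebra_simps)
  also have "\<dots> = kron (A * C) (B * D) $$ (i, j)"
    using ij ij' assms
    by (subst sum_div_mod) (simp add: scalar_prod_def lessThan_atLeast0 kron_index sum_product)
  finally show "(kron A B * kron C D) $$ (i, j) = kron (A * C) (B * D) $$ (i, j)" .
qed (use assms in auto)

lemma kron_one: "kron (1\<^sub>m a) (1\<^sub>m b :: 'a::comm_ring_1 mat) = 1\<^sub>m (a * b)"
proof (rule eq_matI)
  fix i j assume "i < dim_row (1\<^sub>m (a * b) :: 'a mat)" "j < dim_col (1\<^sub>m (a * b) :: 'a mat)"
  then have ij: "i < a * b" "j < a * b" by auto
  have "i = j \<longleftrightarrow> i div b = j div b \<and> i mod b = j mod b"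
    by (metis div_mult_mod_eq)
  then show "kron (1\<^sub>m a) (1\<^sub>m b) $$ (i, j) = (1\<^sub>m (a * b) :: 'a mat) $$ (i, j)"
    using ij div_mod_less[OF ij(1)] div_mod_less[OF ij(2)] by (auto simp: kron_index)
qed auto

lemma mtr_kron:
  assumes "A \<in> carrier_mat a a" "B \<in> carrier_mat b b"
  shows "mtr (kron A B) = mtr A * mtr B"
  using assms sum_div_mod[where f = "\<lambda>i j. A $$ (i, i) * B $$ (j, j)" and a = a and b = b]
  by (simp add: mtr_def kron_index sum_product)

lemma kron_smult_left: "kron (c \<cdot>\<^sub>m A) B = c \<cdot>\<^sub>m kron (A :: 'a::comm_ring_1 mat) B"
proof (rule eq_matI, goal_cases)
  case (1 i j)
  then show ?case
    using div_mod_less[of i "dim_row A" "dim_row B"] div_mod_less[of j "dim_col A" "dim_col B"]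
    by (simp add: kron_index algebra_simps)
qed auto

lemma kron_smult_right: "kron A (c \<cdot>\<^sub>m B) = c \<cdot>\<^sub>m kron (A :: 'a::comm_ring_1 mat) B"
proof (rule eq_matI, goal_cases)
  case (1 i j)
  then show ?case
    using div_mod_less[of i "dim_row A" "dim_row B"] div_mod_less[of j "dim_col A" "dim_col B"]
    by (simp add: kron_index algebra_simps)
qed auto

text \<open>\<open>S\<close> and \<open>T\<close> are the two maps of a short exact sequence of spaces of dimensions \<open>u\<close>, \<open>v\<close>,
  \<open>w\<close>, and \<open>S'\<close>, \<open>T'\<close> split it.\<close>

definition split_exact :: "nat \<Rightarrow> nat \<Rightarrow> nat \<Rightarrow> 'a::field mat \<Rightarrow> 'a mat \<Rightarrow> 'a mat \<Rightarrow> 'a mat \<Rightarrow> bool" where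
  "split_exact u v w S S' T T' \<longleftrightarrow>
    S \<in> carrier_mat v u \<and> S' \<in> carrier_mat u v \<and> T \<in> carrier_mat w v \<and> T' \<in> carrier_mat v w \<and>
    S' * S = 1\<^sub>m u \<and> T * T' = 1\<^sub>m w \<and> T * S = 0\<^sub>m w u \<and> S * S' + T' * T = 1\<^sub>m v"

lemma mat_eqI_mult_vec:
  fixes A :: "'a::comm_ring_1 mat"
  assumes "A \<in> carrier_mat m n" "B \<in> carrier_mat m n" "\<And>v. v \<in> carrier_vec n \<Longrightarrow> A *\<^sub>v v = B *\<^sub>v v"
  shows "A = B"
proof (rule eq_matI)
  fix i j assume "i < dim_row B" "j < dim_col B"
  then have ij: "i < m" "j < n" using assms(2) by auto
  have col: "(M *\<^sub>v unit_vec n j) $ i = M $$ (i, j)" if "M \<in> carrier_mat m n" for M :: "'a mat"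
    using that ij by (simp add: scalar_prod_def if_distrib cong: if_cong)
  show "A $$ (i, j) = B $$ (i, j)"
    using assms(3)[of "unit_vec n j"] col[OF assms(1)] col[OF assms(2)] by simp
qed (use assms in auto)

text \<open>Premises on dimensions can be read off from the factors, so long products are rearranged
  by rewriting to a right-associated form.\<close>

lemma mult_assoc_dim:
  fixes A :: "'a::comm_ring_1 mat"
  assumes "dim_col A = dim_row B" "dim_col B = dim_row C"
  shows "A * B * C = A * (B * C)"
  by (rule assoc_mult_mat[of _ "dim_row A" "dim_row B" _ "dim_row C" _ "dim_col C"])
    (use assms in auto)

lemma mult_cancel_dim:
  fixes A :: "'a::comm_ring_1 mat"
  assumes "A * B = D" "dim_col A = dim_row B" "dim_col B = dim_row C"
  shows "A * (B * C) = D * C"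
  using mult_assoc_dim[of A B C] assms by simp

lemma one_mult_dim:
  fixes A :: "'a::comm_ring_1 mat"
  shows "dim_row A = n \<Longrightarrow> 1\<^sub>m n * A = A" "dim_col A = m \<Longrightarrow> A * 1\<^sub>m m = A"
  by (rule left_mult_one_mat[of _ _ "dim_col A"], auto)

lemma add_mult_dim:
  fixes A :: "'a::comm_ring_1 mat"
  assumes "dim_row A = dim_row B" "dim_col A = dim_col B"
  shows "dim_col A = dim_row C \<Longrightarrow> (A + B) * C = A * C + B * C"
    and "dim_col D = dim_row A \<Longrightarrow> D * (A + B) = D * A + D * B"
  by (rule add_mult_distrib_mat[of _ "dim_row A" "dim_col A" _ _ "dim_col C"], use assms in auto)
    (rule mult_add_distrib_mat[of _ "dim_row D" "dim_row A" _ "dim_col A"], use assms in auto)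

lemma minus_mult_dim:
  fixes A :: "'a::comm_ring_1 mat"
  assumes "dim_row A = dim_row B" "dim_col A = dim_col B"
  shows "dim_col A = dim_row C \<Longrightarrow> (A - B) * C = A * C - B * C"
    and "dim_col D = dim_row A \<Longrightarrow> D * (A - B) = D * A - D * B"
  by (rule minus_mult_distrib_mat[of _ "dim_row A" "dim_col A" _ _ "dim_col C"], use assms in auto)
    (rule mult_minus_distrib_mat[of _ "dim_row D" "dim_row A" _ "dim_col A"], use assms in auto)

lemma smult_mult_dim:
  fixes A :: "'a::comm_ring_1 mat"
  assumes "dim_col A = dim_row B"
  shows "(c \<cdot>\<^sub>m A) * B = c \<cdot>\<^sub>m (A * B)" "A * (c \<cdot>\<^sub>m B) = c \<cdot>\<^sub>m (A * B)"
  by (rule eq_matI; use assms in auto)+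

text \<open>For \<open>S = L * T\<close> one has \<open>S * (T' * T) = S\<close>, and injectivity of
  \<open>S\<close> forces \<open>T' * T = 1\<close>. Then \<open>T' * L'\<close> is inverse to
  \<open>S\<close> from the left.\<close>

lemma inj_mat_left_inverse:
  fixes S :: "'a::field mat"
  assumes S: "S \<in> carrier_mat m n" and inj: "inj_on (\<lambda>u. S *\<^sub>v u) (carrier_vec n)"
  obtains S' where "S' \<in> carrier_mat n m" "S' * S = 1\<^sub>m n"
proof -
  obtain r L L' T T' where f: "L \<in> carrier_mat m r" "L' \<in> carrier_mat r m"
    "T \<in> carrier_mat r n" "T' \<in> carrier_mat n r" "S = L * T" "L' * L = 1\<^sub>m r" "T * T' = 1\<^sub>m r"
    by (rule full_rank_factorization[OF S])
  note d = f(1-4)[THEN carrier_matD(1)] f(1-4)[THEN carrier_matD(2)]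
  have ST: "S * (T' * T) = S"
    using f(7) by (simp add: f(5) d mult_assoc_dim mult_cancel_dim[OF f(7)] one_mult_dim)
  have "T' * T = 1\<^sub>m n"
  proof (rule mat_eqI_mult_vec)
    fix v :: "'a vec" assume v: "v \<in> carrier_vec n"
    have TT: "T' * T \<in> carrier_mat n n" using f by auto
    have "S *\<^sub>v ((T' * T) *\<^sub>v v) = S *\<^sub>v v"
      using assoc_mult_mat_vec[OF S TT v] ST by simp
    then have "(T' * T) *\<^sub>v v = v"
      using inj v TT by (meson inj_onD mult_mat_vec_carrier)
    then show "(T' * T) *\<^sub>v v = 1\<^sub>m n *\<^sub>v v" using v by simp
  qed (use f in auto)
  then have "(T' * L') * S = 1\<^sub>m n"
    by (simp add: f(5) d mult_assoc_dim mult_cancel_dim[OF f(6)] one_mult_dim)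
  moreover have "T' * L' \<in> carrier_mat n m" using f by auto
  ultimately show thesis by (rule that[rotated])
qed

text \<open>Dually, \<open>L * L'\<close> fixes every vector in the image of \<open>T\<close>, which
  is the whole space.\<close>

lemma surj_mat_right_inverse:
  fixes T :: "'a::field mat"
  assumes T: "T \<in> carrier_mat w v" and surj: "(\<lambda>u. T *\<^sub>v u) ` carrier_vec v = carrier_vec w"
  obtains T' where "T' \<in> carrier_mat v w" "T * T' = 1\<^sub>m w"
proof -
  obtain r L L' M M' where f: "L \<in> carrier_mat w r" "L' \<in> carrier_mat r w"
    "M \<in> carrier_mat r v" "M' \<in> carrier_mat v r" "T = L * M" "L' * L = 1\<^sub>m r" "M * M' = 1\<^sub>m r"
    by (rule full_rank_factorization[OF T])
  note d = f(1-4)[THEN carrier_matD(1)] f(1-4)[THEN carrier_matD(2)]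
  have LT: "(L * L') * T = T"
    by (simp add: f(5) d mult_assoc_dim mult_cancel_dim[OF f(6)] one_mult_dim)
  have "L * L' = 1\<^sub>m w"
  proof (rule mat_eqI_mult_vec)
    fix x :: "'a vec" assume x: "x \<in> carrier_vec w"
    then obtain u where u: "u \<in> carrier_vec v" "x = T *\<^sub>v u" using surj by blast
    have LL: "L * L' \<in> carrier_mat w w" using f by auto
    show "(L * L') *\<^sub>v x = 1\<^sub>m w *\<^sub>v x"
      using assoc_mult_mat_vec[OF LL T u(1)] LT u(2) x by simp
  qed (use f in auto)
  then have "T * (M' * L') = 1\<^sub>m w"
    by (simp add: f(5) d mult_assoc_dim mult_cancel_dim[OF f(7)] one_mult_dim)
  moreover have "M' * L' \<in> carrier_mat v w" using f by auto
  ultimately show thesis by (rule that[rotated])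
qed

lemma exact_imp_split_exact:
  fixes S T :: "'a::field mat"
  assumes S: "S \<in> carrier_mat v u" and T: "T \<in> carrier_mat w v"
    and inj: "inj_on (\<lambda>x. S *\<^sub>v x) (carrier_vec u)"
    and ker: "(\<lambda>x. S *\<^sub>v x) ` carrier_vec u = {x \<in> carrier_vec v. T *\<^sub>v x = 0\<^sub>v w}"
    and surj: "(\<lambda>x. T *\<^sub>v x) ` carrier_vec v = carrier_vec w"
  obtains S' T' where "split_exact u v w S S' T T'"
proof -
  obtain S0 where S0: "S0 \<in> carrier_mat u v" "S0 * S = 1\<^sub>m u"
    using inj_mat_left_inverse[OF S inj] by blast
  obtain T' where T': "T' \<in> carrier_mat v w" "T * T' = 1\<^sub>m w"
    using surj_mat_right_inverse[OF T surj] by blast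
  note d = S[THEN carrier_matD(1)] S[THEN carrier_matD(2)] T[THEN carrier_matD(1)] T[THEN carrier_matD(2)]
    S0(1)[THEN carrier_matD(1)] S0(1)[THEN carrier_matD(2)] T'(1)[THEN carrier_matD(1)] T'(1)[THEN carrier_matD(2)]
  have TS: "T * S = 0\<^sub>m w u"
  proof (rule mat_eqI_mult_vec)
    fix x :: "'a vec" assume x: "x \<in> carrier_vec u"
    then have "T *\<^sub>v (S *\<^sub>v x) = 0\<^sub>v w" using ker by blast
    then show "(T * S) *\<^sub>v x = 0\<^sub>m w u *\<^sub>v x"
      using S T x by (auto simp: assoc_mult_mat_vec[OF T S x])
  qed (use S T in auto)
  \<comment> \<open>\<open>Q\<close> projects onto the kernel of \<open>T\<close> along the image of
    \<open>T'\<close>. The left inverse \<open>S0\<close> is arbitrary and may be nonzero on the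
    image of \<open>T'\<close>; the corrected \<open>S0 * Q\<close> vanishes there, which yields
    \<open>S * S' + T' * T = 1\<close>.\<close>
  define Q where "Q = 1\<^sub>m v - T' * T"
  have Q: "Q \<in> carrier_mat v v"
    using mult_carrier_mat[OF T'(1) T] by (simp add: Q_def minus_carrier_mat)
  have TQ: "T * Q = 0\<^sub>m w v"
    using T by (simp add: Q_def d minus_mult_dim mult_cancel_dim[OF T'(2)] one_mult_dim)
  have QS: "Q * S = S"
  proof -
    have "Q * S = S - T' * 0\<^sub>m w u"
      by (simp add: Q_def d minus_mult_dim mult_assoc_dim TS one_mult_dim)
    also have "\<dots> = S" using S T'(1) by (intro eq_matI) auto
    finally show ?thesis .
  qed
  have SSQ: "S * (S0 * Q) = Q"
  proof (rule mat_eqI_mult_vec)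
    fix x :: "'a vec" assume x: "x \<in> carrier_vec v"
    have SS: "S * S0 \<in> carrier_mat v v" using S S0 by auto
    have Qx: "Q *\<^sub>v x \<in> carrier_vec v" using Q x by simp
    have "T *\<^sub>v (Q *\<^sub>v x) = 0\<^sub>v w"
      using assoc_mult_mat_vec[OF T Q x, symmetric] TQ x by auto
    then have "Q *\<^sub>v x \<in> (\<lambda>x. S *\<^sub>v x) ` carrier_vec u" unfolding ker using Qx by blast
    then obtain y where y: "y \<in> carrier_vec u" "Q *\<^sub>v x = S *\<^sub>v y" by blast
    have "(S * S0) *\<^sub>v (Q *\<^sub>v x) = ((S * S0) * S) *\<^sub>v y"
      unfolding y(2) using assoc_mult_mat_vec[OF SS S y(1)] by simp
    also have "(S * S0) * S = S"
      by (simp add: d mult_assoc_dim S0(2) one_mult_dim)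
    finally have "(S * S0) *\<^sub>v (Q *\<^sub>v x) = Q *\<^sub>v x" using y by simp
    moreover have "S * (S0 * Q) = (S * S0) * Q" using Q by (simp add: d mult_assoc_dim)
    ultimately show "(S * (S0 * Q)) *\<^sub>v x = Q *\<^sub>v x"
      using assoc_mult_mat_vec[OF SS Q x] by simp
  qed (use S S0 Q in auto)
  have "split_exact u v w S (S0 * Q) T T'"
    unfolding split_exact_def
  proof (intro conjI)
    show "(S0 * Q) * S = 1\<^sub>m u" using Q by (simp add: mult_assoc_dim QS S0(2) d)
    show "S * (S0 * Q) + T' * T = 1\<^sub>m v"
      unfolding SSQ using T T' by (auto simp: Q_def)
  qed (use S T S0 T' Q TS in auto)
  then show thesis by (rule that)
qed

lemma split_exact_imp_exact:
  fixes S T :: "'a::field mat"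
  assumes "split_exact u v w S S' T T'"
  shows "inj_on (\<lambda>x. S *\<^sub>v x) (carrier_vec u)"
    and "(\<lambda>x. S *\<^sub>v x) ` carrier_vec u = {x \<in> carrier_vec v. T *\<^sub>v x = 0\<^sub>v w}"
    and "(\<lambda>x. T *\<^sub>v x) ` carrier_vec v = carrier_vec w"
proof -
  note s = assms[unfolded split_exact_def]
  then have S: "S \<in> carrier_mat v u" and S': "S' \<in> carrier_mat u v"
    and T: "T \<in> carrier_mat w v" and T': "T' \<in> carrier_mat v w" by auto
  have SS: "S' *\<^sub>v (S *\<^sub>v x) = x" if "x \<in> carrier_vec u" for x
    using assoc_mult_mat_vec[OF S' S that] s that by simp
  show "inj_on (\<lambda>x. S *\<^sub>v x) (carrier_vec u)"
    by (rule inj_on_inverseI[of _ "\<lambda>x. S' *\<^sub>v x"]) (rule SS)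
  show "(\<lambda>x. S *\<^sub>v x) ` carrier_vec u = {x \<in> carrier_vec v. T *\<^sub>v x = 0\<^sub>v w}"
  proof (intro equalityI subsetI)
    fix y assume "y \<in> (\<lambda>x. S *\<^sub>v x) ` carrier_vec u"
    then obtain x where x: "x \<in> carrier_vec u" "y = S *\<^sub>v x" by blast
    then show "y \<in> {x \<in> carrier_vec v. T *\<^sub>v x = 0\<^sub>v w}"
      using assoc_mult_mat_vec[OF T S x(1), symmetric] s S by auto
  next
    fix y assume "y \<in> {x \<in> carrier_vec v. T *\<^sub>v x = 0\<^sub>v w}"
    then have y: "y \<in> carrier_vec v" "T *\<^sub>v y = 0\<^sub>v w" by auto
    have "y = (S * S' + T' * T) *\<^sub>v y" using s y by simp
    also have "\<dots> = (S * S') *\<^sub>v y + (T' * T) *\<^sub>v y"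
      by (rule add_mult_distrib_mat_vec[of _ v v]) (use S S' T T' y in auto)
    also have "(T' * T) *\<^sub>v y = 0\<^sub>v v"
      using assoc_mult_mat_vec[OF T' T y(1)] y(2) T' by auto
    also have "(S * S') *\<^sub>v y = S *\<^sub>v (S' *\<^sub>v y)"
      by (rule assoc_mult_mat_vec[OF S S' y(1)])
    finally have "y = S *\<^sub>v (S' *\<^sub>v y)" using S S' y by simp
    moreover have "S' *\<^sub>v y \<in> carrier_vec u" using S' y by simp
    ultimately show "y \<in> (\<lambda>x. S *\<^sub>v x) ` carrier_vec u" by blast
  qed
  show "(\<lambda>x. T *\<^sub>v x) ` carrier_vec v = carrier_vec w"
  proof (intro equalityI subsetI)
    fix y :: "'a vec" assume y: "y \<in> carrier_vec w"
    then have "y = T *\<^sub>v (T' *\<^sub>v y)"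
      using assoc_mult_mat_vec[OF T T' y] s by simp
    moreover have "T' *\<^sub>v y \<in> carrier_vec v" using T' y by simp
    ultimately show "y \<in> (\<lambda>x. T *\<^sub>v x) ` carrier_vec v" by blast
  qed (use T in auto)
qed

text \<open>Insert \<open>1 = S * S' + T' * T\<close> after \<open>Y\<close> and rotate both
  products under the trace: they become \<open>S' * S * P = P\<close> and
  \<open>Z * T * T' = Z\<close>.\<close>

lemma mtr_split_exact:
  fixes P Y Z :: "'a::field mat"
  assumes se: "split_exact u v w S S' T T'"
    and P: "P \<in> carrier_mat u u" and Y: "Y \<in> carrier_mat v v" and Z: "Z \<in> carrier_mat w w"
    and "S * P = Y * S" "T * Y = Z * T"
  shows "mtr Y = mtr P + mtr Z"
proof -
  note s = se[unfolded split_exact_def]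
  have c: "S \<in> carrier_mat v u" "S' \<in> carrier_mat u v" "T \<in> carrier_mat w v" "T' \<in> carrier_mat v w"
    using s by auto
  note d = c[THEN carrier_matD(1)] c[THEN carrier_matD(2)] P[THEN carrier_matD(1)] P[THEN carrier_matD(2)]
    Y[THEN carrier_matD(1)] Y[THEN carrier_matD(2)] Z[THEN carrier_matD(1)] Z[THEN carrier_matD(2)]
  have "Y = Y * (S * S' + T' * T)" using s Y by simp
  also have "\<dots> = (Y * S) * S' + (Y * T') * T"
    by (simp add: add_mult_dim d mult_assoc_dim)
  finally have "mtr Y = mtr ((Y * S) * S') + mtr ((Y * T') * T)"
    using mtr_add[of "(Y * S) * S'" v "(Y * T') * T"] c Y by simp
  also have "mtr ((Y * S) * S') = mtr (S' * (S * P))"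
    using mtr_mult_comm[of "Y * S" v u S'] c Y assms(5) by simp
  also have "S' * (S * P) = P"
    using s P by (simp add: d mult_cancel_dim[of S' S])
  also have "mtr ((Y * T') * T) = mtr (T * (Y * T'))"
    using mtr_mult_comm[of "Y * T'" v w T] c Y by simp
  also have "T * (Y * T') = Z"
    using s Z by (simp add: d mult_cancel_dim[OF assms(6)] mult_assoc_dim)
  finally show ?thesis .
qed

text \<open>The kernel of \<open>T\<close> is the image of the idempotent \<open>1 - T' * T\<close>;
  the two factors of this idempotent are the inclusion and a retraction.\<close>

lemma kernel_split_exact:
  fixes T :: "'a::field mat"
  assumes T: "T \<in> carrier_mat r d" and T': "T' \<in> carrier_mat d r" and TT: "T * T' = 1\<^sub>m r"
  obtains e S S' where "split_exact e d r S S' T T'"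
proof -
  define E where "E = 1\<^sub>m d - T' * T"
  have E: "E \<in> carrier_mat d d"
    using mult_carrier_mat[OF T' T] by (simp add: E_def minus_carrier_mat)
  note d = T[THEN carrier_matD(1)] T[THEN carrier_matD(2)] T'[THEN carrier_matD(1)] T'[THEN carrier_matD(2)]
  have TE: "T * E = 0\<^sub>m r d"
    using T by (simp add: E_def d minus_mult_dim mult_cancel_dim[OF TT] one_mult_dim)
  obtain e S M S' M' where f: "S \<in> carrier_mat d e" "M \<in> carrier_mat e d"
    "S' \<in> carrier_mat e d" "M' \<in> carrier_mat d e" "E = S * S'" "M * S = 1\<^sub>m e" "S' * M' = 1\<^sub>m e"
    by (rule full_rank_factorization[OF E])
  note d' = d f(1-4)[THEN carrier_matD(1)] f(1-4)[THEN carrier_matD(2)]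
  have TS: "T * S = 0\<^sub>m r e"
  proof -
    have "T * S = (T * E) * M'"
      using f by (simp add: d' mult_assoc_dim one_mult_dim)
    then show ?thesis using left_mult_zero_mat[OF f(4)] by (simp add: TE)
  qed
  have sum: "S * S' + T' * T = 1\<^sub>m d"
    using f(5)[symmetric] T T' by (auto simp: E_def)
  have "S' * S = M * ((S * S') * S)"
    using f by (simp add: d' mult_assoc_dim mult_cancel_dim[OF f(6)] one_mult_dim)
  also have "(S * S') * S = S"
  proof -
    have "E * S = S - T' * 0\<^sub>m r e"
      by (simp add: E_def d' minus_mult_dim mult_assoc_dim TS one_mult_dim)
    also have "\<dots> = S" using f(1) T' by (intro eq_matI) auto
    finally show ?thesis unfolding f(5) .
  qed
  finally have "S' * S = 1\<^sub>m e" using f by simp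
  then have "split_exact e d r S S' T T'"
    unfolding split_exact_def using f T T' TT TS sum by auto
  then show thesis by (rule that)
qed

text \<open>The dimension is the trace of the identity, and characteristic zero allows it to be
  recovered from the field.\<close>

lemma split_exact_dim:
  assumes "split_exact u v w S S' T (T' :: 'a::field_char_0 mat)"
  shows "v = u + w"
proof -
  have "mtr (1\<^sub>m v :: 'a mat) = mtr (1\<^sub>m u :: 'a mat) + mtr (1\<^sub>m w :: 'a mat)"
    by (rule mtr_split_exact[OF assms]) (use assms in \<open>auto simp: split_exact_def\<close>)
  then have "of_nat v = (of_nat (u + w) :: 'a)" by (simp add: mtr_one)
  then show ?thesis by (simp only: of_nat_eq_iff)
qed

section \<open>Linear extension\<close>

text \<open>Two instances occur: the identity of \<open>k\<close> extends matrix entries from a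
  basis to the algebra, and \<open>of_int\<close> extends characters from modules to virtual
  modules.\<close>

locale coefficient_hom =
  fixes h :: "'r::comm_ring_1 \<Rightarrow> 'a::comm_ring_1"
  assumes h_zero: "h 0 = 0" and h_one: "h 1 = 1"
    and h_add: "h (x + y) = h x + h y" and h_mult: "h (x * y) = h x * h y"
begin

definition ext :: "('b \<Rightarrow> 'a) \<Rightarrow> ('b \<Rightarrow>\<^sub>0 'r) \<Rightarrow> 'a" where
  "ext e f = (\<Sum>b\<in>Poly_Mapping.keys f. h (Poly_Mapping.lookup f b) * e b)"

lemma ext_superset:
  assumes "finite S" "Poly_Mapping.keys f \<subseteq> S"
  shows "ext e f = (\<Sum>b\<in>S. h (Poly_Mapping.lookup f b) * e b)"
  unfolding ext_def using assms by (intro sum.mono_neutral_left) (auto simp: in_keys_iff h_zero)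

lemma ext_zero [simp]: "ext e 0 = 0"
  by (simp add: ext_def)

lemma ext_add: "ext e (f + g) = ext e f + ext e g"
proof -
  let ?S = "Poly_Mapping.keys f \<union> Poly_Mapping.keys g"
  show ?thesis
    by (simp add: ext_superset[of ?S] keys_add lookup_add h_add distrib_right sum.distrib)
qed

lemma ext_uminus: "ext e (- f) = - ext e f"
  using ext_add[of e "- f" f] by (simp add: eq_neg_iff_add_eq_0)

lemma ext_diff: "ext e (f - g) = ext e f - ext e g"
  using ext_add[of e f "- g"] by (simp add: ext_uminus)

lemma ext_sum: "ext e (sum f S) = (\<Sum>i\<in>S. ext e (f i))"
  by (induction S rule: infinite_finite_induct) (auto simp: ext_add)

lemma ext_single [simp]: "ext e (Poly_Mapping.single b c) = h c * e b"
  by (cases "c = 0") (auto simp: ext_def h_zero)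

lemma ext_scl: "ext e (scl c f) = h c * ext e f"
proof -
  have "Poly_Mapping.keys (scl c f) \<subseteq> Poly_Mapping.keys f"
    by (auto simp: in_keys_iff lookup_scl)
  then show ?thesis
    by (simp add: ext_superset[of "Poly_Mapping.keys f"] lookup_scl h_mult sum_distrib_left mult.assoc)
qed

lemma ext_cong: "(\<And>b. b \<in> Poly_Mapping.keys f \<Longrightarrow> e b = e' b) \<Longrightarrow> ext e f = ext e' f"
  by (simp add: ext_def)

lemma ext_add_fun: "ext (\<lambda>b. e b + e' b) f = ext e f + ext e' f"
  by (simp add: ext_def distrib_left sum.distrib)

lemma ext_mult_fun: "ext (\<lambda>b. c * e b) f = c * ext e f" "ext (\<lambda>b. e b * c) f = ext e f * c"
  by (simp_all add: ext_def sum_distrib_left sum_distrib_right mult_ac)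

lemma ext_sum_fun: "ext (\<lambda>b. \<Sum>i\<in>S. e i b) f = (\<Sum>i\<in>S. ext (e i) f)"
  unfolding ext_def by (subst sum.swap) (simp add: sum_distrib_left)

lemma ext_lin: "ext e (lin \<phi> f) = ext (\<lambda>x. ext e (\<phi> x)) f"
  unfolding lin_def by (simp add: ext_sum ext_scl) (simp add: ext_def)

lemma ext_bilin: "ext e (bilin \<mu> f g) = ext (\<lambda>x. ext (\<lambda>y. ext e (\<mu> x y)) g) f"
  by (simp add: bilin_def ext_lin)

text \<open>In the instance \<open>iv\<close> this makes a character multiplicative on virtual
  modules once it is multiplicative on modules.\<close>

lemma ext_bilin_mult:
  assumes "\<And>x y. x \<in> Poly_Mapping.keys f \<Longrightarrow> y \<in> Poly_Mapping.keys g \<Longrightarrow> ext e (\<mu> x y) = e x * e' y"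
  shows "ext e (bilin \<mu> f g) = ext e f * ext e' g"
proof -
  have "ext e (bilin \<mu> f g) = ext (\<lambda>x. e x * ext e' g) f"
    unfolding ext_bilin ext_mult_fun[symmetric] by (intro ext_cong) (use assms in auto)
  then show ?thesis by (simp add: ext_mult_fun)
qed

end

interpretation ev: coefficient_hom "\<lambda>x :: 'k::comm_ring_1. x"
  by unfold_locales auto

interpretation iv: coefficient_hom "of_int :: int \<Rightarrow> 'a::comm_ring_1"
  by unfold_locales auto

lemma poly_mapping_induct_on [consumes 1, case_names zero single add]:
  assumes "Poly_Mapping.keys f \<subseteq> B"
    and zero: "P 0"
    and single: "\<And>b c. b \<in> B \<Longrightarrow> P (Poly_Mapping.single b c)"
    and add: "\<And>f g. Poly_Mapping.keys f \<subseteq> B \<Longrightarrow> Poly_Mapping.keys g \<subseteq> B \<Longrightarrow> P f \<Longrightarrow> P g \<Longrightarrow> P (f + g)"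
  shows "P (f :: 'b \<Rightarrow>\<^sub>0 'a::ab_group_add)"
proof -
  have "finite S \<Longrightarrow> S \<subseteq> B \<Longrightarrow> Poly_Mapping.keys f = S \<Longrightarrow> P f" for S f
  proof (induction S arbitrary: f rule: finite_induct)
    case empty
    then show ?case using zero by simp
  next
    case (insert x S)
    define g where "g = f - Poly_Mapping.single x (Poly_Mapping.lookup f x)"
    have "Poly_Mapping.keys g = S"
      using insert.prems insert.hyps by (auto simp: g_def in_keys_iff lookup_minus lookup_single when_def set_eq_iff split: if_splits)
    then have "P g" using insert by auto
    moreover have "f = g + Poly_Mapping.single x (Poly_Mapping.lookup f x)"
      by (simp add: g_def)
    moreover have "Poly_Mapping.keys g \<subseteq> B" using \<open>Poly_Mapping.keys g = S\<close> insert by auto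
    ultimately show ?case
      using add[of g "Poly_Mapping.single x (Poly_Mapping.lookup f x)"] single[of x] insert.prems
      by (simp add: keys_single)
  qed
  then show ?thesis using assms(1) finite_keys by blast
qed


lemma keys_lin: "Poly_Mapping.keys (lin \<phi> f) \<subseteq> (\<Union>x\<in>Poly_Mapping.keys f. Poly_Mapping.keys (\<phi> x))"
proof
  fix y assume "y \<in> Poly_Mapping.keys (lin \<phi> f)"
  then have "(\<Sum>x\<in>Poly_Mapping.keys f. Poly_Mapping.lookup f x * Poly_Mapping.lookup (\<phi> x) y) \<noteq> 0"
    by (simp add: lin_def in_keys_iff lookup_sum lookup_scl)
  then obtain x where "x \<in> Poly_Mapping.keys f" "Poly_Mapping.lookup f x * Poly_Mapping.lookup (\<phi> x) y \<noteq> 0"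
    by (meson sum.neutral)
  then show "y \<in> (\<Union>x\<in>Poly_Mapping.keys f. Poly_Mapping.keys (\<phi> x))"
    by (intro UN_I[of x]) (auto simp: in_keys_iff)
qed

lemma keys_bilin_single:
  assumes "\<And>x y. x \<in> B \<Longrightarrow> y \<in> B \<Longrightarrow> op x y \<in> B" "Poly_Mapping.keys f \<subseteq> B" "Poly_Mapping.keys g \<subseteq> B"
  shows "Poly_Mapping.keys (bilin (\<lambda>x y. Poly_Mapping.single (op x y) (s x y)) f g) \<subseteq> B"
  unfolding bilin_def using assms(2,3)
  by (intro order.trans[OF keys_lin] UN_least) (auto simp: keys_single subset_iff intro!: assms(1) split: if_splits)

section \<open>Modules over algebras with a monomial basis\<close>

text \<open>Group algebras and Hopf-Ore extensions have a basis in which the product of two basis elements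
  is a multiple of a basis element; this is all that the additive theory of modules uses.\<close>

definition extm :: "nat \<Rightarrow> ('b \<Rightarrow> 'k mat) \<Rightarrow> ('b \<Rightarrow>\<^sub>0 'k::field) \<Rightarrow> 'k mat" where
  "extm d E f = mat d d (\<lambda>ij. ev.ext (\<lambda>b. E b $$ ij) f)"

lemma extm_carrier [simp]: "extm d E f \<in> carrier_mat d d"
  by (simp add: extm_def)

lemma extm_dim [simp]: "dim_row (extm d E f) = d" "dim_col (extm d E f) = d"
  by (simp_all add: extm_def)

lemma extm_add: "extm d E (f + g) = extm d E f + extm d E g"
  by (rule eq_matI) (auto simp: extm_def ev.ext_add)

lemma extm_scl: "extm d E (scl c f) = c \<cdot>\<^sub>m extm d E f"
  by (rule eq_matI) (auto simp: extm_def ev.ext_scl)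

lemma extm_single: "E b \<in> carrier_mat d d \<Longrightarrow> extm d E (Poly_Mapping.single b c) = c \<cdot>\<^sub>m E b"
  by (rule eq_matI) (auto simp: extm_def)

text \<open>Both sides are bilinear, so multiplicativity is inherited from the basis. The argument
  is entrywise, since matrices of all sizes form one type without a common zero.\<close>

lemma extm_bilin:
  assumes E: "\<And>b. b \<in> B \<Longrightarrow> E b \<in> carrier_mat d d"
    and mult: "\<And>b c. b \<in> B \<Longrightarrow> c \<in> B \<Longrightarrow> E b * E c = extm d E (\<mu> b c)"
    and f: "Poly_Mapping.keys f \<subseteq> B" and g: "Poly_Mapping.keys g \<subseteq> B"
  shows "extm d E (bilin \<mu> f g) = extm d E f * extm d E g"
proof (rule eq_matI)
  fix i j assume "i < dim_row (extm d E f * extm d E g)" "j < dim_col (extm d E f * extm d E g)"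
  then have ij: "i < d" "j < d" by auto
  have "extm d E (bilin \<mu> f g) $$ (i, j) = ev.ext (\<lambda>x. ev.ext (\<lambda>y. ev.ext (\<lambda>b. E b $$ (i, j)) (\<mu> x y)) g) f"
    using ij by (simp add: extm_def ev.ext_bilin)
  also have "\<dots> = ev.ext (\<lambda>x. ev.ext (\<lambda>y. \<Sum>k<d. E x $$ (i, k) * E y $$ (k, j)) g) f"
  proof (intro ev.ext_cong)
    fix x y assume xy: "x \<in> Poly_Mapping.keys f" "y \<in> Poly_Mapping.keys g"
    have Exy: "E x \<in> carrier_mat d d" "E y \<in> carrier_mat d d"
      using E xy f g by blast+
    have "ev.ext (\<lambda>b. E b $$ (i, j)) (\<mu> x y) = (E x * E y) $$ (i, j)"
      using mult[of x y] xy f g ij by (simp add: extm_def subset_iff)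
    then show "ev.ext (\<lambda>b. E b $$ (i, j)) (\<mu> x y) = (\<Sum>k<d. E x $$ (i, k) * E y $$ (k, j))"
      using Exy[THEN carrier_matD(1)] Exy[THEN carrier_matD(2)] ij
      by (simp add: scalar_prod_def lessThan_atLeast0)
  qed
  also have "\<dots> = (\<Sum>k<d. ev.ext (\<lambda>x. E x $$ (i, k)) f * ev.ext (\<lambda>y. E y $$ (k, j)) g)"
    by (simp add: ev.ext_sum_fun ev.ext_mult_fun)
  also have "\<dots> = (extm d E f * extm d E g) $$ (i, j)"
    using ij by (simp add: extm_def scalar_prod_def lessThan_atLeast0)
  finally show "extm d E (bilin \<mu> f g) $$ (i, j) = (extm d E f * extm d E g) $$ (i, j)" .
qed auto

definition act :: "('k::field, 'b) matrix_module \<Rightarrow> 'b \<Rightarrow> 'k mat" where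
  "act V b = snd V (bas b)"

locale monomial_algebra =
  fixes A :: "('k::field, 'b) hopf_algebra" (structure)
    and B :: "'b set" and op :: "'b \<Rightarrow> 'b \<Rightarrow> 'b" and s :: "'b \<Rightarrow> 'b \<Rightarrow> 'k" and e0 :: 'b
  assumes carrier_A: "carrier A = {f. Poly_Mapping.keys f \<subseteq> B}"
    and mult_A: "monoid.mult A = bilin (\<lambda>x y. Poly_Mapping.single (op x y) (s x y))"
    and one_A: "one A = bas e0" and add_A: "add A = (+)" and smult_A: "smult A = scl"
    and op_closed: "x \<in> B \<Longrightarrow> y \<in> B \<Longrightarrow> op x y \<in> B" and e0: "e0 \<in> B"
begin

lemma bas_carrier [simp]: "b \<in> B \<Longrightarrow> bas b \<in> carrier A"
  by (simp add: carrier_A keys_single)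

lemma single_carrier [simp]: "b \<in> B \<Longrightarrow> Poly_Mapping.single b c \<in> carrier A"
  by (simp add: carrier_A keys_single)

lemma add_carrier: "f \<in> carrier A \<Longrightarrow> g \<in> carrier A \<Longrightarrow> f + g \<in> carrier A"
  using keys_add[of f g] by (auto simp: carrier_A)

lemma scl_carrier: "f \<in> carrier A \<Longrightarrow> scl c f \<in> carrier A"
  by (auto simp: carrier_A in_keys_iff lookup_scl)

lemma mult_carrier: "f \<in> carrier A \<Longrightarrow> g \<in> carrier A \<Longrightarrow> f \<otimes> g \<in> carrier A"
  unfolding mult_A carrier_A mem_Collect_eq by (rule keys_bilin_single[OF op_closed])

lemma fd_modulesI:
  assumes E: "\<And>b. b \<in> B \<Longrightarrow> E b \<in> carrier_mat d d"
    and mult: "\<And>b c. b \<in> B \<Longrightarrow> c \<in> B \<Longrightarrow> E b * E c = s b c \<cdot>\<^sub>m E (op b c)"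
    and one: "E e0 = 1\<^sub>m d"
  shows "(d, \<lambda>f\<in>carrier A. extm d E f) \<in> fd_modules A"
proof -
  have "extm d E (f \<otimes> g) = extm d E f * extm d E g" if "f \<in> carrier A" "g \<in> carrier A" for f g
    unfolding mult_A
    by (rule extm_bilin[where B = B]) (use that in \<open>auto simp: E mult carrier_A extm_single op_closed\<close>)
  then show ?thesis
    unfolding fd_modules_def
    by (auto simp: add_A smult_A extm_add extm_scl one_A extm_single E[OF e0] one e0 add_carrier scl_carrier mult_carrier)
qed

lemma fd_modulesD:
  assumes "V \<in> fd_modules A"
  shows "f \<in> carrier A \<Longrightarrow> snd V f \<in> carrier_mat (fst V) (fst V)"
    and "f \<in> carrier A \<Longrightarrow> g \<in> carrier A \<Longrightarrow> snd V (f + g) = snd V f + snd V g"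
    and "f \<in> carrier A \<Longrightarrow> snd V (scl c f) = c \<cdot>\<^sub>m snd V f"
    and "f \<in> carrier A \<Longrightarrow> g \<in> carrier A \<Longrightarrow> snd V (f \<otimes> g) = snd V f * snd V g"
    and "snd V (bas e0) = 1\<^sub>m (fst V)"
  using assms unfolding fd_modules_def by (auto simp: add_A smult_A one_A split: prod.splits)

text \<open>For modules cut out of given ones, where \<open>\<rho>\<close> is known on the whole
  algebra; \<open>fd_modulesI\<close> serves modules that are prescribed on the basis.\<close>

lemma fd_modulesI':
  assumes "\<And>f. f \<in> carrier A \<Longrightarrow> \<rho> f \<in> carrier_mat d d"
    and "\<And>f g. f \<in> carrier A \<Longrightarrow> g \<in> carrier A \<Longrightarrow> \<rho> (f + g) = \<rho> f + \<rho> g"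
    and "\<And>f c. f \<in> carrier A \<Longrightarrow> \<rho> (scl c f) = c \<cdot>\<^sub>m \<rho> f"
    and "\<And>f g. f \<in> carrier A \<Longrightarrow> g \<in> carrier A \<Longrightarrow> \<rho> (f \<otimes> g) = \<rho> f * \<rho> g"
    and "\<rho> (bas e0) = 1\<^sub>m d"
  shows "(d, \<lambda>f\<in>carrier A. \<rho> f) \<in> fd_modules A"
  unfolding fd_modules_def using assms
  by (auto simp: add_A smult_A one_A e0 add_carrier scl_carrier mult_carrier)

lemma act_carrier: "V \<in> fd_modules A \<Longrightarrow> b \<in> B \<Longrightarrow> act V b \<in> carrier_mat (fst V) (fst V)"
  by (simp add: act_def fd_modulesD)

lemma act_one: "V \<in> fd_modules A \<Longrightarrow> act V e0 = 1\<^sub>m (fst V)"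
  by (simp add: act_def fd_modulesD)

lemma act_dim: "V \<in> fd_modules A \<Longrightarrow> b \<in> B \<Longrightarrow> dim_row (act V b) = fst V"
    "V \<in> fd_modules A \<Longrightarrow> b \<in> B \<Longrightarrow> dim_col (act V b) = fst V"
  using act_carrier by blast+

lemma act_single:
  assumes "V \<in> fd_modules A" "b \<in> B"
  shows "snd V (Poly_Mapping.single b c) = c \<cdot>\<^sub>m act V b"
  using fd_modulesD(3)[OF assms(1), of "bas b" c] assms(2) by (simp add: scl_simps act_def)

lemma act_mult:
  assumes "V \<in> fd_modules A" "b \<in> B" "c \<in> B"
  shows "act V b * act V c = s b c \<cdot>\<^sub>m act V (op b c)"
  using fd_modulesD(4)[OF assms(1), of "bas b" "bas c"] assms
  by (simp add: mult_A bilin_single scl_simps act_single op_closed flip: act_def)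

lemma carrier_induct [consumes 1, case_names zero single add]:
  assumes "f \<in> carrier A" "P 0" "\<And>b c. b \<in> B \<Longrightarrow> P (Poly_Mapping.single b c)"
    "\<And>f g. f \<in> carrier A \<Longrightarrow> g \<in> carrier A \<Longrightarrow> P f \<Longrightarrow> P g \<Longrightarrow> P (f + g)"
  shows "P f"
  using assms by (auto simp: carrier_A intro: poly_mapping_induct_on)

lemma fd_modules_zero:
  assumes "V \<in> fd_modules A"
  shows "snd V 0 = 0\<^sub>m (fst V) (fst V)"
proof -
  have "snd V 0 = snd V (Poly_Mapping.single e0 0)" by simp
  also have "\<dots> = 0\<^sub>m (fst V) (fst V)"
    unfolding act_single[OF assms e0] act_one[OF assms] by (rule eq_matI) auto
  finally show ?thesis .
qed

lemma module_homs_iff: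
  assumes V: "V \<in> fd_modules A" and W: "W \<in> fd_modules A"
  shows "T \<in> module_homs A V W \<longleftrightarrow>
    T \<in> carrier_mat (fst W) (fst V) \<and> (\<forall>b\<in>B. T * act V b = act W b * T)"
proof (intro iffI conjI; (elim conjE)?)
  assume T: "T \<in> carrier_mat (fst W) (fst V)" and comm: "\<forall>b\<in>B. T * act V b = act W b * T"
  have "T * snd V f = snd W f * T" if "f \<in> carrier A" for f
    using that
  proof (induction f rule: carrier_induct)
    case zero
    show ?case using T by (simp add: fd_modules_zero[OF V] fd_modules_zero[OF W])
  next
    case (single b c)
    then show ?case using T comm
      by (simp add: act_single[OF V] act_single[OF W] smult_mult_dim act_dim[OF V] act_dim[OF W])
  next
    case (add f g)
    then show ?case using T fd_modulesD(1)[OF V add(1)] fd_modulesD(1)[OF V add(2)]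
        fd_modulesD(1)[OF W add(1)] fd_modulesD(1)[OF W add(2)]
      by (simp add: fd_modulesD(2)[OF V] fd_modulesD(2)[OF W] add_mult_dim)
  qed
  with T show "T \<in> module_homs A V W" by (simp add: module_homs_def)
qed (auto simp: module_homs_def act_def)

text \<open>The retractions \<open>S'\<close> and \<open>T'\<close> split the sequence of vector
  spaces only: they are not assumed to be module maps. With them, exactness is a set of matrix
  equations.\<close>

definition ses :: "('k, 'b) matrix_module \<Rightarrow> ('k, 'b) matrix_module \<Rightarrow> ('k, 'b) matrix_module \<Rightarrow> bool" where
  "ses U V W \<longleftrightarrow> (\<exists>S S' T T'. S \<in> module_homs A U V \<and> T \<in> module_homs A V W \<and>
     split_exact (fst U) (fst V) (fst W) S S' T T')"

lemma short_exact_iff_ses: "short_exact A U V W \<longleftrightarrow> ses U V W"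
proof
  assume "short_exact A U V W"
  then obtain S where S: "S \<in> module_homs A U V" and ex: "\<exists>T\<in>module_homs A V W.
      inj_on (\<lambda>u. S *\<^sub>v u) (carrier_vec (fst U)) \<and>
      (\<lambda>u. S *\<^sub>v u) ` carrier_vec (fst U) = {v \<in> carrier_vec (fst V). T *\<^sub>v v = 0\<^sub>v (fst W)} \<and>
      (\<lambda>v. T *\<^sub>v v) ` carrier_vec (fst V) = carrier_vec (fst W)"
    unfolding short_exact_def by (rule bexE)
  from ex obtain T where T: "T \<in> module_homs A V W" and exact:
      "inj_on (\<lambda>u. S *\<^sub>v u) (carrier_vec (fst U)) \<and>
      (\<lambda>u. S *\<^sub>v u) ` carrier_vec (fst U) = {v \<in> carrier_vec (fst V). T *\<^sub>v v = 0\<^sub>v (fst W)} \<and>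
      (\<lambda>v. T *\<^sub>v v) ` carrier_vec (fst V) = carrier_vec (fst W)" by (rule bexE)
  have "S \<in> carrier_mat (fst V) (fst U)" "T \<in> carrier_mat (fst W) (fst V)"
    using S T by (auto simp: module_homs_def)
  from exact_imp_split_exact[OF this exact[THEN conjunct1] exact[THEN conjunct2, THEN conjunct1]
      exact[THEN conjunct2, THEN conjunct2]]
  obtain S' T' where "split_exact (fst U) (fst V) (fst W) S S' T T'" .
  with S T show "ses U V W" unfolding ses_def by blast
next
  assume "ses U V W"
  then obtain S S' T T' where ST: "S \<in> module_homs A U V" "T \<in> module_homs A V W"
    "split_exact (fst U) (fst V) (fst W) S S' T T'" unfolding ses_def by blast
  then show "short_exact A U V W"
    unfolding short_exact_def using split_exact_imp_exact[OF ST(3)] by blast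
qed

lemma mtr_ses:
  assumes "ses U V W" "U \<in> fd_modules A" "V \<in> fd_modules A" "W \<in> fd_modules A" "f \<in> carrier A"
  shows "mtr (snd V f) = mtr (snd U f) + mtr (snd W f)"
proof -
  obtain S S' T T' where "S \<in> module_homs A U V" "T \<in> module_homs A V W"
    "split_exact (fst U) (fst V) (fst W) S S' T T'" using assms(1) unfolding ses_def by blast
  then show ?thesis
    using assms by (intro mtr_split_exact[of "fst U" "fst V" "fst W" S S' T T']) (auto simp: module_homs_def fd_modulesD)
qed

text \<open>A split submodule: the condition says that the image of \<open>S\<close>, which is the kernel of \<open>T\<close>, is
  invariant.\<close>

lemma sub_quotient_modules:
  assumes V: "V \<in> fd_modules A" and se: "split_exact u (fst V) w S S' T T'"
    and inv: "\<And>b. b \<in> B \<Longrightarrow> T * act V b * S = 0\<^sub>m w u"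
  defines "U \<equiv> (u, \<lambda>f\<in>carrier A. S' * snd V f * S)" and "W \<equiv> (w, \<lambda>f\<in>carrier A. T * snd V f * T')"
  shows "U \<in> fd_modules A" "W \<in> fd_modules A" "ses U V W"
proof -
  note s = se[unfolded split_exact_def]
  have c: "S \<in> carrier_mat (fst V) u" "S' \<in> carrier_mat u (fst V)"
    "T \<in> carrier_mat w (fst V)" "T' \<in> carrier_mat (fst V) w" using s by auto
  note d = c[THEN carrier_matD(1)] c[THEN carrier_matD(2)]
  have e: "S' * S = 1\<^sub>m u" "T * T' = 1\<^sub>m w" "S * S' + T' * T = 1\<^sub>m (fst V)" using s by auto
  have vd: "dim_row (snd V f) = fst V" "dim_col (snd V f) = fst V" if "f \<in> carrier A" for f
    using fd_modulesD(1)[OF V that] by auto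
  have zero: "T * (snd V f * S) = 0\<^sub>m w u" if "f \<in> carrier A" for f
    using that
  proof (induction f rule: carrier_induct)
    case zero
    show ?case using c by (simp add: fd_modules_zero[OF V])
  next
    case (single b k)
    have "T * (act V b * S) = 0\<^sub>m w u"
      using inv[OF single] by (simp add: d mult_assoc_dim act_dim[OF V single])
    then show ?case
      by (simp add: act_single[OF V single] smult_mult_dim d act_dim[OF V single])
  next
    case (add f g)
    then show ?case by (simp add: fd_modulesD(2)[OF V] add_mult_dim d vd)
  qed
  \<comment> \<open>\<open>S * S'\<close> and \<open>T' * T\<close> are complementary projections.
    On columns killed by \<open>T\<close>, the first one is the identity; this is how the invariance
    condition enters.\<close>
  have SS: "S * (S' * Q) = Q - T' * (T * Q)" if "Q \<in> carrier_mat (fst V) q" for Q q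
  proof -
    have "Q = (S * S' + T' * T) * Q" using e that by simp
    also have "\<dots> = S * (S' * Q) + T' * (T * Q)"
      using that by (simp add: d add_mult_dim mult_assoc_dim)
    finally have eq: "Q = S * (S' * Q) + T' * (T * Q)" .
    have "S * (S' * Q) = S * (S' * Q) + T' * (T * Q) - T' * (T * Q)"
      using that c by (intro eq_matI) auto
    then show ?thesis unfolding eq[symmetric] .
  qed
  have S_hom: "S * (S' * (snd V f * S)) = snd V f * S" if "f \<in> carrier A" for f
  proof -
    have Q: "snd V f * S \<in> carrier_mat (fst V) u" using fd_modulesD(1)[OF V that] c by simp
    have "S * (S' * (snd V f * S)) = snd V f * S - T' * 0\<^sub>m w u"
      by (simp only: SS[OF Q] zero[OF that])
    also have "\<dots> = snd V f * S"
      unfolding right_mult_zero_mat[OF c(4)] by (rule minus_zero_mat[OF Q])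
    finally show ?thesis .
  qed
  have T_hom: "T * (snd V f * (T' * T)) = T * snd V f" if "f \<in> carrier A" for f
  proof -
    have "T * snd V f = T * (snd V f * (S * S' + T' * T))"
      by (simp only: e(3) right_mult_one_mat[OF fd_modulesD(1)[OF V that]])
    also have "\<dots> = T * (snd V f * S) * S' + T * (snd V f * (T' * T))"
      by (simp add: d vd[OF that] add_mult_dim mult_assoc_dim)
    also have "\<dots> = T * (snd V f * (T' * T))"
      unfolding zero[OF that] left_mult_zero_mat[OF c(2)]
      by (rule left_add_zero_mat[of _ w "fst V"]) (use c fd_modulesD(1)[OF V that] in auto)
    finally show ?thesis ..
  qed
  have T_hom': "T * (snd V f * (T' * (T * Q))) = T * (snd V f * Q)"
    if "f \<in> carrier A" "dim_row Q = fst V" for f Q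
    using T_hom[OF that(1)] that(2) mult_assoc_dim[of T "snd V f * (T' * T)" Q] mult_assoc_dim[of T "snd V f" Q]
    by (simp add: d vd[OF that(1)] mult_assoc_dim)
  have S_hom': "S * (S' * (snd V f * (S * Q))) = snd V f * (S * Q)"
    if "f \<in> carrier A" "dim_row Q = u" for f Q
    using S_hom[OF that(1)] that(2) mult_assoc_dim[of S "S' * (snd V f * S)" Q] mult_assoc_dim[of "snd V f" S Q]
    by (simp add: d vd[OF that(1)] mult_assoc_dim)
  show U: "U \<in> fd_modules A"
    unfolding U_def
  proof (rule fd_modulesI')
    fix f g assume "f \<in> carrier A" "g \<in> carrier A"
    then show "S' * snd V (f \<otimes> g) * S = S' * snd V f * S * (S' * snd V g * S)"
      by (simp add: fd_modulesD(4)[OF V] d vd mult_assoc_dim S_hom)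
  next
    fix f assume f: "f \<in> carrier A"
    show "S' * snd V f * S \<in> carrier_mat u u"
      using c fd_modulesD(1)[OF V f] by simp
    show "S' * snd V (scl k f) * S = k \<cdot>\<^sub>m (S' * snd V f * S)" for k
      by (simp add: fd_modulesD(3)[OF V f] smult_mult_dim d vd[OF f])
  next
    fix f g assume f: "f \<in> carrier A" and g: "g \<in> carrier A"
    show "S' * snd V (f + g) * S = S' * snd V f * S + S' * snd V g * S"
      by (simp add: fd_modulesD(2)[OF V f g] add_mult_dim d vd[OF f] vd[OF g])
  next
    show "S' * snd V (bas e0) * S = 1\<^sub>m u"
      using c by (simp add: fd_modulesD(5)[OF V] right_mult_one_mat[OF c(2)] e(1))
  qed
  show W: "W \<in> fd_modules A"
    unfolding W_def
  proof (rule fd_modulesI')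
    fix f g assume "f \<in> carrier A" "g \<in> carrier A"
    then show "T * snd V (f \<otimes> g) * T' = T * snd V f * T' * (T * snd V g * T')"
      by (simp add: fd_modulesD(4)[OF V] d vd mult_assoc_dim T_hom')
  next
    fix f assume f: "f \<in> carrier A"
    show "T * snd V f * T' \<in> carrier_mat w w"
      using c fd_modulesD(1)[OF V f] by simp
    show "T * snd V (scl k f) * T' = k \<cdot>\<^sub>m (T * snd V f * T')" for k
      by (simp add: fd_modulesD(3)[OF V f] smult_mult_dim d vd[OF f])
  next
    fix f g assume f: "f \<in> carrier A" and g: "g \<in> carrier A"
    show "T * snd V (f + g) * T' = T * snd V f * T' + T * snd V g * T'"
      by (simp add: fd_modulesD(2)[OF V f g] add_mult_dim d vd[OF f] vd[OF g])
  next
    show "T * snd V (bas e0) * T' = 1\<^sub>m w"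
      using c by (simp add: fd_modulesD(5)[OF V] right_mult_one_mat[OF c(3)] e(2))
  qed
  have "S \<in> module_homs A U V"
    unfolding module_homs_def using c by (auto simp: U_def d vd mult_assoc_dim S_hom)
  moreover have "T \<in> module_homs A V W"
    unfolding module_homs_def using c by (auto simp: W_def d vd mult_assoc_dim T_hom)
  ultimately show "ses U V W"
    unfolding ses_def using se by (auto simp: U_def W_def)
qed

end

section \<open>The subgroup of relations and additive invariants\<close>

context monomial_algebra
begin

abbreviation "F \<equiv> free_module_ring A"
abbreviation "rel \<equiv> relation_subgroup A"

lemma F_simps: "carrier F = {f. Poly_Mapping.keys f \<subseteq> fd_modules A}" "add F = (+)" "zero F = 0"
    "monoid.mult F = bilin (\<lambda>V W. bas (tensor_module A V W))" "one F = bas (trivial_module A)"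
  by (simp_all add: free_module_ring_def)

lemma F_closed:
  "0 \<in> carrier F"
  "f \<in> carrier F \<Longrightarrow> g \<in> carrier F \<Longrightarrow> f + g \<in> carrier F"
  "f \<in> carrier F \<Longrightarrow> - f \<in> carrier F"
  "f \<in> carrier F \<Longrightarrow> g \<in> carrier F \<Longrightarrow> f - g \<in> carrier F"
  "V \<in> fd_modules A \<Longrightarrow> Poly_Mapping.single V c \<in> carrier F"
  using keys_add[of f g] keys_diff[of f g] by (auto simp: F_simps)

lemma group_F: "group (add_monoid F)"
proof (rule groupI)
  fix f assume "f \<in> carrier (add_monoid F)"
  then show "\<exists>g\<in>carrier (add_monoid F). g \<otimes>\<^bsub>add_monoid F\<^esub> f = \<one>\<^bsub>add_monoid F\<^esub>"
    using F_closed(3)[of f] by (intro bexI[of _ "- f"]) (auto simp: F_simps)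
next
  fix f g assume "f \<in> carrier (add_monoid F)" "g \<in> carrier (add_monoid F)"
  then show "f \<otimes>\<^bsub>add_monoid F\<^esub> g \<in> carrier (add_monoid F)"
    using F_closed(2)[of f g] by (simp add: F_simps)
qed (auto simp: F_simps add.assoc)

lemma relations_subset: "grothendieck_relations A \<subseteq> carrier F"
  unfolding grothendieck_relations_def using F_closed by auto

lemma rel_subset: "rel \<subseteq> carrier F"
  using group.generate_in_carrier[OF group_F] relations_subset
  unfolding relation_subgroup_def by auto

lemma rel_add: "f \<in> rel \<Longrightarrow> g \<in> rel \<Longrightarrow> f + g \<in> rel"
  using generate.eng[of f "add_monoid F" _ g] by (simp add: relation_subgroup_def F_simps)

lemma rel_zero: "0 \<in> rel"
  using generate.one[of "add_monoid F"] by (simp add: relation_subgroup_def F_simps)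

lemma rel_uminus:
  assumes "f \<in> rel"
  shows "- f \<in> rel"
proof -
  have f: "f \<in> carrier F" using assms rel_subset by blast
  have "inv\<^bsub>add_monoid F\<^esub> f = - f"
    by (rule group.inv_equality[OF group_F]) (use f F_closed(3) in \<open>auto simp: F_simps\<close>)
  then show ?thesis
    using group.generate_m_inv_closed[OF group_F, of "grothendieck_relations A" f] relations_subset assms
    by (simp add: relation_subgroup_def)
qed

lemma rel_diff: "f \<in> rel \<Longrightarrow> g \<in> rel \<Longrightarrow> f - g \<in> rel"
  using rel_add[of f "- g"] rel_uminus[of g] by simp

lemma rel_sum: "(\<And>i. i \<in> S \<Longrightarrow> f i \<in> rel) \<Longrightarrow> sum f S \<in> rel"
  by (induction S rule: infinite_finite_induct) (auto simp: rel_zero rel_add)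

lemma rel_trans: "f - g \<in> rel \<Longrightarrow> g - h \<in> rel \<Longrightarrow> f - h \<in> rel"
  using rel_add[of "f - g" "g - h"] by simp

lemma rel_ses:
  assumes "ses U V W" "U \<in> fd_modules A" "V \<in> fd_modules A" "W \<in> fd_modules A"
  shows "bas V - (bas U + bas W) \<in> rel"
  unfolding relation_subgroup_def grothendieck_relations_def short_exact_iff_ses
  by (rule generate.incl, rule UnI2) (use assms in blast)

definition zero_module :: "('k, 'b) matrix_module" where
  "zero_module = (0, \<lambda>f\<in>carrier A. 0\<^sub>m 0 0)"

lemma zero_module: "zero_module \<in> fd_modules A" "fst zero_module = 0"
  unfolding zero_module_def by (rule fd_modulesI', auto)

text \<open>Turns a relation of the first kind into one of the second with the zero module in front,
  so that an additive invariant only has to be tested on exact sequences and on the zero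
  module.\<close>

lemma isomorphic_imp_ses:
  assumes "isomorphic_modules A V W" "V \<in> fd_modules A" "W \<in> fd_modules A"
  shows "ses zero_module V W"
proof -
  obtain T where T: "T \<in> module_homs A V W"
    "bij_betw (\<lambda>v. T *\<^sub>v v) (carrier_vec (fst V)) (carrier_vec (fst W))"
    using assms(1) unfolding isomorphic_modules_def by blast
  have Tc: "T \<in> carrier_mat (fst W) (fst V)" using T(1) by (simp add: module_homs_def)
  define S :: "'k mat" where "S = 0\<^sub>m (fst V) 0"
  have Sc: "S \<in> carrier_mat (fst V) 0" by (simp add: S_def)
  have S: "S \<in> module_homs A zero_module V"
    unfolding module_homs_def
    by (auto simp: zero_module_def S_def right_mult_zero_mat[OF fd_modulesD(1)[OF assms(2)]])
  have vec0: "carrier_vec 0 = {0\<^sub>v 0 :: 'k vec}" by auto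
  have S0: "S *\<^sub>v 0\<^sub>v 0 = 0\<^sub>v (fst V)" by (auto simp: S_def)
  have T0: "T *\<^sub>v 0\<^sub>v (fst V) = 0\<^sub>v (fst W)" using Tc by auto
  have ker: "(\<lambda>x. S *\<^sub>v x) ` carrier_vec 0 = {x \<in> carrier_vec (fst V). T *\<^sub>v x = 0\<^sub>v (fst W)}"
  proof -
    have "x = 0\<^sub>v (fst V)" if "x \<in> carrier_vec (fst V)" "T *\<^sub>v x = 0\<^sub>v (fst W)" for x
      by (rule inj_onD[OF bij_betw_imp_inj_on[OF T(2)]]) (use that T0 in simp_all)
    then have "{x \<in> carrier_vec (fst V). T *\<^sub>v x = 0\<^sub>v (fst W)} = {0\<^sub>v (fst V)}"
      using T0 zero_carrier_vec by blast
    then show ?thesis by (simp only: vec0 image_insert image_empty S0)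
  qed
  obtain S' T' where "split_exact 0 (fst V) (fst W) S S' T T'"
  proof (rule exact_imp_split_exact[OF Sc Tc _ ker])
    show "inj_on (\<lambda>x. S *\<^sub>v x) (carrier_vec 0)" by (simp add: vec0)
  qed (rule bij_betw_imp_surj_on[OF T(2)])
  then show ?thesis unfolding ses_def using S T(1) zero_module(2) by auto
qed

text \<open>The universal property of the Grothendieck group: it is enough to treat the generating
  relations.\<close>

lemma ext_rel:
  fixes e :: "_ \<Rightarrow> 'a::comm_ring_1"
  assumes ses: "\<And>U V W. ses U V W \<Longrightarrow> U \<in> fd_modules A \<Longrightarrow> V \<in> fd_modules A \<Longrightarrow> W \<in> fd_modules A
      \<Longrightarrow> e V = e U + e W"
    and zero: "e zero_module = 0" and f: "f \<in> rel"
  shows "iv.ext e f = 0"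
proof -
  have gen: "iv.ext e g = 0" if "g \<in> grothendieck_relations A" for g
    using that unfolding grothendieck_relations_def
  proof (elim UnE; clarify)
    fix V W assume "V \<in> fd_modules A" "W \<in> fd_modules A" "isomorphic_modules A V W"
    then show "iv.ext e (bas V - bas W) = 0"
      using ses[OF isomorphic_imp_ses[of V W]] zero_module zero by (simp add: iv.ext_diff)
  next
    fix U V W assume "U \<in> fd_modules A" "V \<in> fd_modules A" "W \<in> fd_modules A" "short_exact A U V W"
    then show "iv.ext e (bas V - (bas U + bas W)) = 0"
      using ses[of U V W] by (simp add: short_exact_iff_ses iv.ext_diff iv.ext_add)
  qed
  have inv_F: "inv\<^bsub>add_monoid F\<^esub> g = - g" if "g \<in> carrier F" for g
    by (rule group.inv_equality[OF group_F]) (use that F_closed(3) in \<open>auto simp: F_simps\<close>)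
  show ?thesis
    using f unfolding relation_subgroup_def
  proof (induction f rule: generate.induct)
    case (inv g)
    then show ?case using gen relations_subset inv_F
      by (auto simp: iv.ext_uminus)
  qed (auto simp: gen F_simps iv.ext_add)
qed

text \<open>In dimension 0 the zero maps make \<open>V\<close>, \<open>V\<close>, \<open>V\<close> a
  short exact sequence, and its relation is \<open>bas V - (bas V + bas V)\<close>.\<close>

lemma rel_dim_zero:
  assumes V: "V \<in> fd_modules A" and "fst V = 0"
  shows "bas V \<in> rel"
proof -
  have "split_exact 0 0 0 (0\<^sub>m 0 0) (0\<^sub>m 0 0) (0\<^sub>m 0 0) (0\<^sub>m 0 0 :: 'k mat)"
    unfolding split_exact_def by auto
  moreover have "0\<^sub>m 0 0 \<in> module_homs A V V"
    unfolding module_homs_def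
    using assms(2) left_mult_zero_mat[OF fd_modulesD(1)[OF V]] right_mult_zero_mat[OF fd_modulesD(1)[OF V]]
    by auto
  ultimately have "ses V V V" unfolding ses_def using assms(2) by metis
  from rel_uminus[OF rel_ses[OF this V V V]] show ?thesis by simp
qed

lemma F_induct [consumes 1, case_names zero bas diff]:
  assumes f: "f \<in> carrier F" and zero: "P 0" and bas: "\<And>V. V \<in> fd_modules A \<Longrightarrow> P (bas V)"
    and diff: "\<And>f g. f \<in> carrier F \<Longrightarrow> g \<in> carrier F \<Longrightarrow> P f \<Longrightarrow> P g \<Longrightarrow> P (f - g)"
  shows "P f"
proof -
  have "Poly_Mapping.keys f \<subseteq> fd_modules A" using f by (simp add: F_simps)
  then show ?thesis
  proof (induction f rule: poly_mapping_induct_on)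
    case (single V c)
    show ?case
    proof (induction c rule: int_induct[of _ 0])
      case base
      show ?case using zero by simp
    next
      case (step1 i)
      have "P (0 - bas V)" by (rule diff[OF _ _ zero bas[OF single]]) (use single in \<open>auto simp: F_closed\<close>)
      from diff[OF _ _ step1(2) this] single
      have "P (Poly_Mapping.single V i - (0 - bas V))" by (simp add: F_closed)
      then show ?case by (simp add: single_add)
    next
      case (step2 i)
      from diff[OF _ _ step2(2) bas[OF single]] single
      show ?case by (simp add: F_closed single_diff)
    qed
  next
    case (add f g)
    then have fg: "f \<in> carrier F" "g \<in> carrier F" by (auto simp: F_simps)
    have "P (f - (0 - g))" by (intro diff zero) (use add fg in \<open>auto simp: F_closed\<close>)
    then show ?case by simp
  qed (rule zero)
qed

subsection \<open>Direct sums\<close>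

definition incl1 :: "nat \<Rightarrow> nat \<Rightarrow> 'k mat" where
  "incl1 d e = mat (d + e) d (\<lambda>(i, j). if i = j then 1 else 0)"
definition incl2 :: "nat \<Rightarrow> nat \<Rightarrow> 'k mat" where
  "incl2 d e = mat (d + e) e (\<lambda>(i, j). if i = d + j then 1 else 0)"

lemma split_exact_incl:
  "split_exact d (d + e) e (incl1 d e) (transpose_mat (incl1 d e)) (transpose_mat (incl2 d e)) (incl2 d e)"
  "transpose_mat (incl1 d e) * incl2 d e = 0\<^sub>m d e"
proof -
  have D: "(\<Sum>k<n. (if k = i then 1 else 0) * (if k = j then 1 else 0)) = (if i = j \<and> i < n then 1 else (0::'k))"
    for n i j :: nat by (simp add: if_distrib[of "\<lambda>z. z * _"] cong: if_cong)
  have D': "(\<Sum>k<n. (if i = k then 1 else 0) * (if j = k then 1 else 0)) = (if i = j \<and> i < n then 1 else (0::'k))"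
    for n i j :: nat using D[of i j n] by (simp add: eq_commute)
  have D'': "(\<Sum>k<n. (if i = d + k then 1 else 0) * (if j = d + k then 1 else 0)) =
      (if i = j \<and> d \<le> i \<and> i < d + n then 1 else (0::'k))" for n i j :: nat
  proof (cases "d \<le> i \<and> d \<le> j")
    case True
    then have "i = d + k \<longleftrightarrow> i - d = k" "j = d + k \<longleftrightarrow> j - d = k" for k by auto
    then show ?thesis using D'[of "i - d" "j - d" n] True by auto
  qed auto
  show "split_exact d (d + e) e (incl1 d e) (transpose_mat (incl1 d e)) (transpose_mat (incl2 d e)) (incl2 d e)"
    unfolding split_exact_def
    by (intro conjI; (rule eq_matI)?)
      (auto simp: incl1_def incl2_def scalar_prod_def D D' D'' simp flip: lessThan_atLeast0)
  show "transpose_mat (incl1 d e) * incl2 d e = 0\<^sub>m d e"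
    by (rule eq_matI) (auto simp: incl1_def incl2_def scalar_prod_def D simp flip: lessThan_atLeast0)
qed

text \<open>Direct sums gather the positive and the negative terms of a virtual module into one
  module each.\<close>

definition dsum :: "('k, 'b) matrix_module \<Rightarrow> ('k, 'b) matrix_module \<Rightarrow> ('k, 'b) matrix_module" where
  "dsum V W = (let d = fst V; e = fst W in (d + e, \<lambda>f\<in>carrier A.
     incl1 d e * snd V f * transpose_mat (incl1 d e) + incl2 d e * snd W f * transpose_mat (incl2 d e)))"

lemma dsum:
  assumes V: "V \<in> fd_modules A" and W: "W \<in> fd_modules A"
  shows "dsum V W \<in> fd_modules A" "ses V (dsum V W) W"
proof -
  define d e where "d = fst V" and "e = fst W"
  define S S' T' T where "S = incl1 d e" and "S' = transpose_mat S"
    and "T' = incl2 d e" and "T = transpose_mat T'"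
  have se: "split_exact d (d + e) e S S' T T'"
    unfolding S_def S'_def T_def T'_def by (rule split_exact_incl(1))
  note s = se[unfolded split_exact_def]
  have c: "S \<in> carrier_mat (d + e) d" "S' \<in> carrier_mat d (d + e)"
    "T \<in> carrier_mat e (d + e)" "T' \<in> carrier_mat (d + e) e" using s by auto
  note dm = c[THEN carrier_matD(1)] c[THEN carrier_matD(2)]
  have r: "S' * S = 1\<^sub>m d" "T * T' = 1\<^sub>m e" "T * S = 0\<^sub>m e d" "S * S' + T' * T = 1\<^sub>m (d + e)"
      "S' * T' = 0\<^sub>m d e"
    using s split_exact_incl(2)[of d e] unfolding S_def S'_def T_def T'_def by auto
  have vc: "snd V f \<in> carrier_mat d d" and wc: "snd W f \<in> carrier_mat e e" if "f \<in> carrier A" for f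
    using fd_modulesD(1)[OF V that] fd_modulesD(1)[OF W that] by (simp_all add: d_def e_def)
  have vd: "dim_row (snd V f) = d" "dim_col (snd V f) = d" "dim_row (snd W f) = e" "dim_col (snd W f) = e"
    if "f \<in> carrier A" for f
    using vc[OF that] wc[OF that] by auto
  have dsum: "dsum V W = (d + e, \<lambda>f\<in>carrier A. S * snd V f * S' + T' * snd W f * T)"
    by (simp add: dsum_def Let_def d_def e_def S_def S'_def T_def T'_def)
  have m0: "0\<^sub>m p q * Q = 0\<^sub>m p (dim_col Q)" if "dim_row Q = q" for p q and Q :: "'k mat"
    using that by (intro eq_matI) auto
  have mz: "Q * 0\<^sub>m p q = 0\<^sub>m (dim_row Q) q" if "dim_col Q = p" for p q and Q :: "'k mat"
    using that by (intro eq_matI) auto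
  show "dsum V W \<in> fd_modules A"
    unfolding dsum
  proof (rule fd_modulesI')
    fix f assume f: "f \<in> carrier A"
    show "S * snd V f * S' + T' * snd W f * T \<in> carrier_mat (d + e) (d + e)"
      using c vc[OF f] wc[OF f] by simp
    show "S * snd V (scl k f) * S' + T' * snd W (scl k f) * T = k \<cdot>\<^sub>m (S * snd V f * S' + T' * snd W f * T)" for k
      using add_smult_distrib_left_mat[of "S * snd V f * S'" "d + e" "d + e" "T' * snd W f * T" k] c vc[OF f] wc[OF f]
      by (simp add: fd_modulesD(3)[OF V f] fd_modulesD(3)[OF W f] smult_mult_dim dm vd[OF f])
  next
    fix f g assume f: "f \<in> carrier A" and g: "g \<in> carrier A"
    show "S * snd V (f + g) * S' + T' * snd W (f + g) * T =
        S * snd V f * S' + T' * snd W f * T + (S * snd V g * S' + T' * snd W g * T)"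
      unfolding fd_modulesD(2)[OF V f g] fd_modulesD(2)[OF W f g]
      by (rule eq_matI)
        (simp_all add: add_mult_dim dm vd[OF f] vd[OF g] index_add_mat(1) del: index_mult_mat(1))
    have "(S * snd V f * S' + T' * snd W f * T) * (S * snd V g * S' + T' * snd W g * T) =
        S * (snd V f * (snd V g * S')) + 0\<^sub>m (d + e) (d + e) + (0\<^sub>m (d + e) (d + e) + T' * (snd W f * (snd W g * T)))"
      by (simp add: add_mult_dim dm vd[OF f] vd[OF g] mult_assoc_dim mult_cancel_dim[OF r(1)] mult_cancel_dim[OF r(2)]
          mult_cancel_dim[OF r(3)] mult_cancel_dim[OF r(5)] one_mult_dim m0 mz)
    also have "\<dots> = S * snd V (f \<otimes> g) * S' + T' * snd W (f \<otimes> g) * T"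
      unfolding fd_modulesD(4)[OF V f g] fd_modulesD(4)[OF W f g]
      by (rule eq_matI) (simp_all add: dm vd[OF f] vd[OF g] mult_assoc_dim del: index_mult_mat(1))
    finally show "S * snd V (f \<otimes> g) * S' + T' * snd W (f \<otimes> g) * T =
      (S * snd V f * S' + T' * snd W f * T) * (S * snd V g * S' + T' * snd W g * T)" ..
  next
    show "S * snd V (bas e0) * S' + T' * snd W (bas e0) * T = 1\<^sub>m (d + e)"
      unfolding fd_modulesD(5)[OF V] fd_modulesD(5)[OF W] d_def[symmetric] e_def[symmetric]
        right_mult_one_mat[OF c(1)] right_mult_one_mat[OF c(4)] by (rule r(4))
  qed
  have "S \<in> module_homs A V (dsum V W)"
    unfolding module_homs_def
  proof (intro CollectI conjI ballI)
    fix f assume f: "f \<in> carrier A"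
    have "(S * snd V f * S' + T' * snd W f * T) * S = S * snd V f + 0\<^sub>m (d + e) d"
      by (simp add: add_mult_dim dm vd[OF f] mult_assoc_dim r one_mult_dim mz)
    also have "\<dots> = S * snd V f" by (rule right_add_zero_mat) (use c vc[OF f] in simp)
    finally show "S * snd V f = snd (dsum V W) f * S" using f by (simp add: dsum)
  qed (use c in \<open>simp add: dsum d_def\<close>)
  moreover have "T \<in> module_homs A (dsum V W) W"
    unfolding module_homs_def
  proof (intro CollectI conjI ballI)
    fix f assume f: "f \<in> carrier A"
    have "T * (S * snd V f * S' + T' * snd W f * T) = 0\<^sub>m e (d + e) + snd W f * T"
      by (simp add: add_mult_dim dm vd[OF f] mult_assoc_dim mult_cancel_dim[OF r(2)] mult_cancel_dim[OF r(3)] one_mult_dim m0)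
    also have "\<dots> = snd W f * T" by (rule left_add_zero_mat) (use c wc[OF f] in simp)
    finally show "T * snd (dsum V W) f = snd W f * T" using f by (simp add: dsum)
  qed (use c in \<open>simp add: dsum e_def\<close>)
  ultimately show "ses V (dsum V W) W"
    unfolding ses_def using se by (auto simp: dsum d_def e_def)
qed

lemma rel_dsum:
  assumes "V \<in> fd_modules A" "W \<in> fd_modules A"
  shows "bas (dsum V W) - (bas V + bas W) \<in> rel"
  using rel_ses dsum assms by blast

end

text \<open>Multiplying \<open>S * S' + T' * T = 1\<close> by \<open>S'\<close> on the left and
  \<open>T'\<close> on the right gives \<open>S' * T' = S' * T' + S' * T'\<close>, hence the missing
  relation \<open>S' * T' = 0\<close>. The swap turns the kernel of a retraction into a
  cokernel.\<close>

lemma split_exact_swap: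
  fixes S :: "'a::field mat"
  assumes "split_exact u v w S S' T T'"
  shows "split_exact w v u T' T S' S"
proof -
  note s = assms[unfolded split_exact_def]
  have c: "S \<in> carrier_mat v u" "S' \<in> carrier_mat u v" "T \<in> carrier_mat w v" "T' \<in> carrier_mat v w"
    using s by auto
  note d = c[THEN carrier_matD(1)] c[THEN carrier_matD(2)]
  have e: "S' * S = 1\<^sub>m u" "T * T' = 1\<^sub>m w" using s by auto
  have "S' * (S * S' + T' * T) * T' = S' * T' + S' * T'"
    by (simp add: add_mult_dim d mult_assoc_dim mult_cancel_dim[OF e(1)] e one_mult_dim)
  moreover have "S' * (S * S' + T' * T) * T' = S' * T'" using s c by simp
  ultimately have eq: "S' * T' = S' * T' + S' * T'" by simp
  have "S' * T' = 0\<^sub>m u w"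
  proof (rule eq_matI)
    fix i j assume "i < dim_row (0\<^sub>m u w :: 'a mat)" "j < dim_col (0\<^sub>m u w :: 'a mat)"
    then have ij: "i < u" "j < w" by auto
    have "(S' * T') $$ (i, j) = (S' * T') $$ (i, j) + (S' * T') $$ (i, j)"
      using arg_cong[OF eq, of "\<lambda>M. M $$ (i, j)"] ij d by (simp del: index_mult_mat(1))
    then have "(S' * T') $$ (i, j) = 0" unfolding add_cancel_right_right .
    then show "(S' * T') $$ (i, j) = 0\<^sub>m u w $$ (i, j)" using ij by simp
  qed (use d in auto)
  moreover have "T' * T + S * S' = 1\<^sub>m v"
    using s comm_add_mat[of "T' * T" v v "S * S'"] by auto
  ultimately show ?thesis using s unfolding split_exact_def by auto
qed

text \<open>Induction on the dimension. The image of a nonzero map is a quotient of \<open>V\<close>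
  and a submodule of \<open>W\<close>, so its class cancels and the kernel and cokernel remain,
  again with equal traces. \<open>P\<close> singles out a class of modules closed under submodules
  and quotients in which equal traces on \<open>B0\<close> provide such a map;
  \<open>e0 \<in> B0\<close> forces equal dimensions.\<close>

lemma equal_traces_rel:
  fixes A :: "('k::field_char_0, 'b) hopf_algebra"
  assumes "monomial_algebra A B op s e0"
    and sub: "\<And>U V W. P V \<Longrightarrow> monomial_algebra.ses A U V W \<Longrightarrow> U \<in> fd_modules A \<Longrightarrow> V \<in> fd_modules A
      \<Longrightarrow> W \<in> fd_modules A \<Longrightarrow> P U \<and> P W"
    and hom: "\<And>V W. V \<in> fd_modules A \<Longrightarrow> W \<in> fd_modules A \<Longrightarrow> P V \<Longrightarrow> P W \<Longrightarrow> fst V > 0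
      \<Longrightarrow> \<forall>b\<in>B0. mtr (act V b) = mtr (act W b) \<Longrightarrow> \<exists>T\<in>module_homs A V W. T \<noteq> 0\<^sub>m (fst W) (fst V)"
    and B0: "B0 \<subseteq> B" "e0 \<in> B0"
    and V: "V \<in> fd_modules A" "P V" and W: "W \<in> fd_modules A" "P W"
    and tr: "\<forall>b\<in>B0. mtr (act V b) = mtr (act W b)"
  shows "bas V - bas W \<in> relation_subgroup A"
  using V W tr
proof (induction "fst V" arbitrary: V W rule: less_induct)
  case less
  interpret monomial_algebra A B op s e0 by fact
  note V = less.prems(1,2) and W = less.prems(3,4) and tr = less.prems(5)
  have "of_nat (fst V) = (of_nat (fst W) :: 'k)"
    using tr B0(2) by (metis V(1) W(1) act_one mtr_one)
  then have dim: "fst V = fst W" by simp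
  show ?case
  proof (cases "fst V = 0")
    case True
    then show ?thesis using rel_diff rel_dim_zero V(1) W(1) dim by simp
  next
    case False
    then obtain T where T: "T \<in> module_homs A V W" "T \<noteq> 0\<^sub>m (fst W) (fst V)"
      using hom[OF V(1) W(1) V(2) W(2) _ tr] by auto
    have Tc: "T \<in> carrier_mat (fst W) (fst V)" using T(1) by (simp add: module_homs_def)
    have Th: "T * snd V f = snd W f * T" if "f \<in> carrier A" for f
      using T(1) that by (simp add: module_homs_def)
    obtain r L L' M M' where f: "L \<in> carrier_mat (fst W) r" "L' \<in> carrier_mat r (fst W)"
      "M \<in> carrier_mat r (fst V)" "M' \<in> carrier_mat (fst V) r"
      "T = L * M" "L' * L = 1\<^sub>m r" "M * M' = 1\<^sub>m r"
      by (rule full_rank_factorization[OF Tc])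
    have r: "r > 0"
    proof (rule ccontr)
      assume "\<not> r > 0"
      then have "T = 0\<^sub>m (fst W) (fst V)"
        unfolding f(5) using f(1,3) by (intro eq_matI) (auto simp: scalar_prod_def)
      with T(2) show False by simp
    qed
    note d = f(1-4)[THEN carrier_matD(1)] f(1-4)[THEN carrier_matD(2)]
    have vd: "dim_row (snd V g) = fst V" "dim_col (snd V g) = fst V"
      "dim_row (snd W g) = fst W" "dim_col (snd W g) = fst W" if "g \<in> carrier A" for g
      using fd_modulesD(1)[OF V(1) that] fd_modulesD(1)[OF W(1) that] by auto
    have MV: "M * snd V g = L' * (snd W g * T)" if "g \<in> carrier A" for g
    proof -
      have "M * snd V g = L' * ((L * M) * snd V g)"
        by (simp add: d vd[OF that] mult_assoc_dim mult_cancel_dim[OF f(6)] one_mult_dim)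
      then show ?thesis unfolding f(5)[symmetric] Th[OF that] .
    qed
    have WL: "snd W g * L = T * (snd V g * M')" if "g \<in> carrier A" for g
    proof -
      have "snd W g * L = (snd W g * (L * M)) * M'"
        by (simp add: d vd[OF that] mult_assoc_dim f(7) one_mult_dim)
      also have "\<dots> = (T * snd V g) * M'" unfolding f(5)[symmetric] Th[OF that] ..
      finally show ?thesis using Tc by (simp add: d vd[OF that] mult_assoc_dim)
    qed
    obtain e S S' where K: "split_exact e (fst V) r S S' M M'"
      by (rule kernel_split_exact[OF f(3,4,7)])
    have Sc: "S \<in> carrier_mat (fst V) e" and MS: "M * S = 0\<^sub>m r e"
      using K by (auto simp: split_exact_def)
    have K0: "M * act V b * S = 0\<^sub>m r e" if "b \<in> B" for b
    proof -
      have b: "bas b \<in> carrier A" using that by simp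
      have "M * act V b * S = L' * (snd W (bas b) * (L * (M * S)))"
        using Sc unfolding act_def MV[OF b] f(5) by (simp add: d vd[OF b] mult_assoc_dim)
      then show ?thesis
        unfolding MS right_mult_zero_mat[OF f(1)] right_mult_zero_mat[OF fd_modulesD(1)[OF W(1) b]]
          right_mult_zero_mat[OF f(2)] .
    qed
    \<comment> \<open>\<open>L'\<close> retracts \<open>W\<close> onto the image of
      \<open>T\<close>; splitting off its kernel and exchanging the roles of the two maps presents
      the cokernel of \<open>L\<close>, with projection \<open>R'\<close>.\<close>
    obtain e' R R' where "split_exact e' (fst W) r R R' L' L"
      by (rule kernel_split_exact[OF f(2,1,6)])
    then have C: "split_exact r (fst W) e' L L' R' R" by (rule split_exact_swap)
    have Rc: "R' \<in> carrier_mat e' (fst W)" and RL: "R' * L = 0\<^sub>m e' r"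
      using C by (auto simp: split_exact_def)
    have C0: "R' * act W b * L = 0\<^sub>m e' r" if "b \<in> B" for b
    proof -
      have b: "bas b \<in> carrier A" using that by simp
      have "R' * act W b * L = R' * (snd W (bas b) * L)"
        using Rc by (simp add: d vd[OF b] mult_assoc_dim act_def)
      also have "\<dots> = (R' * L) * (M * (snd V (bas b) * M'))"
        unfolding WL[OF b] f(5) using Rc by (simp add: d vd[OF b] mult_assoc_dim)
      also have "\<dots> = 0\<^sub>m e' r"
        unfolding RL by (rule left_mult_zero_mat) (use f fd_modulesD(1)[OF V(1) b] in simp)
      finally show ?thesis .
    qed
    define Km Im Cm where "Km = (e, \<lambda>g\<in>carrier A. S' * snd V g * S)"
      and "Im = (r, \<lambda>g\<in>carrier A. M * snd V g * M')" and "Cm = (e', \<lambda>g\<in>carrier A. R' * snd W g * R)"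
    note VK = sub_quotient_modules[OF V(1) K K0, folded Km_def Im_def]
    \<comment> \<open>As a quotient of \<open>V\<close> and as a submodule of \<open>W\<close> the
      image is literally the same matrix module, so the same basis element cancels below.\<close>
    have "(\<lambda>g\<in>carrier A. L' * snd W g * L) = (\<lambda>g\<in>carrier A. M * snd V g * M')"
    proof (rule restrict_ext)
      fix g assume g: "g \<in> carrier A"
      have "L' * snd W g * L = L' * (L * (M * (snd V g * M')))"
        using WL[OF g] unfolding f(5) by (simp add: d vd[OF g] mult_assoc_dim)
      also have "\<dots> = M * snd V g * M'"
        by (simp add: d vd[OF g] mult_assoc_dim mult_cancel_dim[OF f(6)] one_mult_dim)
      finally show "L' * snd W g * L = M * snd V g * M'" .
    qed
    then have Im': "Im = (r, \<lambda>g\<in>carrier A. L' * snd W g * L)" by (simp add: Im_def)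
    note WC = sub_quotient_modules[OF W(1) C C0, folded Cm_def Im']
    have tr': "mtr (act Km b) = mtr (act Cm b)" if "b \<in> B0" for b
    proof -
      have b: "bas b \<in> carrier A" using that B0(1) by auto
      have "mtr (act V b) = mtr (act Km b) + mtr (act Im b)"
        unfolding act_def by (rule mtr_ses[OF VK(3,1) V(1) VK(2) b])
      moreover have "mtr (act W b) = mtr (act Im b) + mtr (act Cm b)"
        unfolding act_def by (rule mtr_ses[OF WC(3,1) W(1) WC(2) b])
      ultimately show ?thesis using tr that by simp
    qed
    have "fst Km < fst V" using split_exact_dim[OF K] r by (simp add: Km_def)
    moreover have "P Km" "P Cm"
      using sub[OF V(2) VK(3,1) V(1) VK(2)] sub[OF W(2) WC(3,1) W(1) WC(2)] by auto
    ultimately have "bas Km - bas Cm \<in> rel"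
      using less.hyps VK(1) WC(2) tr' by blast
    from rel_add[OF rel_diff[OF rel_ses[OF VK(3,1) V(1) VK(2)] rel_ses[OF WC(3,1) W(1) WC(2)]] this]
    show ?thesis by (simp add: algebra_simps)
  qed
qed

section \<open>Representations of finite groups\<close>

lemma group_algebra_simps:
  "carrier (group_algebra G) = {f. Poly_Mapping.keys f \<subseteq> carrier G}"
  "monoid.mult (group_algebra G) = bilin (\<lambda>g h. bas (g \<otimes>\<^bsub>G\<^esub> h))"
  "one (group_algebra G) = bas \<one>\<^bsub>G\<^esub>"
  "add (group_algebra G) = (+)" "smult (group_algebra G) = scl"
  "comult (group_algebra G) = lin (\<lambda>g. bas (g, g))"
  "counit (group_algebra G) = (\<lambda>f. \<Sum>g\<in>Poly_Mapping.keys f. Poly_Mapping.lookup f g)"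
  by (simp_all add: group_algebra_def based_algebra_def module.defs)

lemma monomial_group_algebra:
  assumes "group G"
  shows "monomial_algebra (group_algebra G :: ('k::field, 'g) hopf_algebra) (carrier G) (monoid.mult G) (\<lambda>_ _. 1) \<one>\<^bsub>G\<^esub>"
proof -
  interpret group G by fact
  show ?thesis by unfold_locales (simp_all add: group_algebra_simps)
qed

lemma lin_sum: "lin \<phi> (sum f S) = (\<Sum>i\<in>S. lin \<phi> (f i))"
  by (induction S rule: infinite_finite_induct) (auto simp: lin_add, simp_all add: lin_def)

lemma sum_constant_scl: "finite S \<Longrightarrow> (\<Sum>i\<in>S. f) = scl (of_nat (card S)) f"
  by (induction S rule: finite_induct) (auto simp: scl_add scl_simps intro: poly_mapping_eqI simp: lookup_scl)

text \<open>The sum over the group acts on \<open>V \<otimes> V\<^sup>*\<close> as \<open>\<bar>G\<bar>\<close> times a projection, so its trace is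
  \<open>\<bar>G\<bar>\<close> times the rank of that projection, which is not zero.\<close>

lemma sum_trace_inv_nonzero:
  fixes G :: "('g, 'z) monoid_scheme" (structure) and V :: "('k::field_char_0, 'g) matrix_module"
  assumes G: "group G" "finite (carrier G)" and V: "V \<in> fd_modules (group_algebra G)" and pos: "fst V > 0"
  shows "(\<Sum>g\<in>carrier G. mtr (act V g) * mtr (act V (inv\<^bsub>G\<^esub> g))) \<noteq> 0"
proof -
  interpret group G by fact
  interpret monomial_algebra "group_algebra G :: ('k, 'g) hopf_algebra" "carrier G" "monoid.mult G" "\<lambda>_ _. 1" "\<one>\<^bsub>G\<^esub>"
    by (rule monomial_group_algebra) fact
  define d where "d = fst V"
  \<comment> \<open>Transposing the inverse gives the dual representation; \<open>N\<close> is the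
    action on the endomorphisms of \<open>V\<close>.\<close>
  define N where "N g = kron (act V g) (transpose_mat (act V (inv g)))" for g
  have Vc: "act V g \<in> carrier_mat d d" if "g \<in> carrier G" for g
    using act_carrier[OF V that] by (simp add: d_def)
  have Nc: "N g \<in> carrier_mat (d * d) (d * d)" if "g \<in> carrier G" for g
    unfolding N_def using Vc[OF that] Vc[of "inv g"] that by (intro kron_carrier) auto
  have Vm: "act V g * act V h = act V (g \<otimes> h)" if "g \<in> carrier G" "h \<in> carrier G" for g h
    unfolding act_mult[OF V that] by (rule one_smult_mat)
  have V1: "act V \<one> = 1\<^sub>m d" using act_one[OF V] by (simp add: d_def)
  define Nm where "Nm = (d * d, \<lambda>f\<in>carrier (group_algebra G). extm (d * d) N f)"
  have Nmod: "Nm \<in> fd_modules (group_algebra G)"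
    unfolding Nm_def
  proof (rule fd_modulesI)
    fix g h assume gh: "g \<in> carrier G" "h \<in> carrier G"
    have "N g * N h = kron (act V g * act V h) (transpose_mat (act V (inv g)) * transpose_mat (act V (inv h)))"
      unfolding N_def using gh by (intro kron_mult) (simp_all add: act_dim[OF V])
    also have "transpose_mat (act V (inv g)) * transpose_mat (act V (inv h)) =
        transpose_mat (act V (inv h) * act V (inv g))"
      using gh by (intro transpose_mult[OF Vc Vc, symmetric]) simp_all
    also have "act V (inv h) * act V (inv g) = act V (inv (g \<otimes> h))"
      using Vm[of "inv h" "inv g"] gh by (simp add: inv_mult_group)
    also have "act V g * act V h = act V (g \<otimes> h)" using Vm gh by simp
    also have "kron \<dots> (transpose_mat (act V (inv (g \<otimes> h)))) = 1 \<cdot>\<^sub>m N (g \<otimes> h)"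
      by (simp add: N_def one_smult_mat)
    finally show "N g * N h = 1 \<cdot>\<^sub>m N (g \<otimes> h)" .
  next
    show "N \<one> = 1\<^sub>m (d * d)" by (simp add: N_def V1 kron_one)
  qed (rule Nc)
  define e :: "'g \<Rightarrow>\<^sub>0 'k" where "e = (\<Sum>g\<in>carrier G. bas g)"
  define n :: 'k where "n = of_nat (card (carrier G))"
  have n0: "n \<noteq> 0" using G(2) one_closed by (auto simp: n_def card_eq_0_iff)
  have ec: "e \<in> carrier (group_algebra G)"
  proof -
    have "finite S \<Longrightarrow> S \<subseteq> carrier G \<Longrightarrow> (\<Sum>g\<in>S. bas g :: 'g \<Rightarrow>\<^sub>0 'k) \<in> carrier (group_algebra G)" for S
    proof (induction S rule: finite_induct)
      case empty
      then show ?case by (simp add: group_algebra_simps)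
    next
      case (insert x S)
      then show ?case using add_carrier[of "bas x" "sum bas S"] by simp
    qed
    then show ?thesis using G(2) by (simp add: e_def)
  qed
  have "monoid.mult (group_algebra G) e e = scl n e"
  proof -
    have "lin (\<lambda>h. bas (g \<otimes> h)) e = e" if "g \<in> carrier G" for g
    proof -
      have "lin (\<lambda>h. bas (g \<otimes> h)) e = (\<Sum>h\<in>carrier G. bas (g \<otimes> h) :: 'g \<Rightarrow>\<^sub>0 'k)"
        by (simp add: e_def lin_sum lin_single scl_simps)
      also have "\<dots> = e"
        unfolding e_def
        by (rule sum.reindex_bij_witness[of _ "\<lambda>h. inv g \<otimes> h" "\<lambda>h. g \<otimes> h"])
          (use that in \<open>simp_all add: m_assoc[symmetric]\<close>)
      finally show ?thesis .
    qed
    then have "monoid.mult (group_algebra G) e e = (\<Sum>g\<in>carrier G. e)"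
      unfolding group_algebra_simps bilin_def
      by (subst (2) e_def) (simp add: lin_sum lin_single scl_simps)
    also have "\<dots> = scl n e" by (simp add: n_def sum_constant_scl G(2))
    finally show ?thesis .
  qed
  define M where "M = snd Nm e"
  have Mc: "M \<in> carrier_mat (d * d) (d * d)"
    using fd_modulesD(1)[OF Nmod ec] by (simp add: M_def Nm_def)
  have MM: "M * M = n \<cdot>\<^sub>m M"
    using fd_modulesD(4)[OF Nmod ec ec] fd_modulesD(3)[OF Nmod ec, of n]
      \<open>monoid.mult (group_algebra G) e e = scl n e\<close> by (simp add: M_def)
  have Mi: "M $$ (i, j) = (\<Sum>g\<in>carrier G. N g $$ (i, j))" if "i < d * d" "j < d * d" for i j
    using that ec by (simp add: M_def Nm_def extm_def) (simp add: e_def ev.ext_sum)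
  obtain r L L' T T' where f: "L \<in> carrier_mat (d * d) r" "L' \<in> carrier_mat r (d * d)"
    "T \<in> carrier_mat r (d * d)" "T' \<in> carrier_mat (d * d) r"
    "M = L * T" "L' * L = 1\<^sub>m r" "T * T' = 1\<^sub>m r"
    by (rule full_rank_factorization[OF Mc])
  note dd = f(1-4)[THEN carrier_matD(1)] f(1-4)[THEN carrier_matD(2)]
  \<comment> \<open>From \<open>M = L * T\<close> and \<open>M * M = n M\<close> it follows that
    \<open>T * L\<close> is \<open>n\<close> times the identity of size \<open>r\<close>, so the
    trace of \<open>M\<close> is \<open>n r\<close>.\<close>
  have "T * L = L' * (M * M) * T'"
    by (simp add: f(5) dd mult_assoc_dim mult_cancel_dim[OF f(6)] f(7) one_mult_dim)
  also have "\<dots> = n \<cdot>\<^sub>m 1\<^sub>m r"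
    unfolding MM by (simp add: f(5) dd mult_assoc_dim mult_cancel_dim[OF f(6)] f(7) one_mult_dim smult_mult_dim)
  finally have "mtr M = n * of_nat r"
    unfolding f(5) mtr_mult_comm[OF f(1,3)] using mtr_smult[of "1\<^sub>m r" r n] by (simp add: mtr_one)
  moreover have "r \<noteq> 0"
  proof
    assume "r = 0"
    then have M0: "M $$ (i, j) = 0" if "i < d * d" "j < d * d" for i j
      unfolding f(5) using f(1,3) that by (simp add: scalar_prod_def)
    have less: "k * d + k < d * d" if "k < d" for k
    proof -
      have "k * d + k < (k + 1) * d" using that by simp
      also have "\<dots> \<le> d * d" using that by (intro mult_le_mono1) simp
      finally show ?thesis .
    qed
    \<comment> \<open>The positions \<open>k * d + k\<close> support the vector that represents the
      identity endomorphism, which is fixed by the group. Hence \<open>M\<close> multiplies it by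
      \<open>n\<close>, and its coordinate 0 becomes \<open>n\<close>, which is not 0.\<close>
    have "0 = (\<Sum>k<d. M $$ (0, k * d + k))" using M0 less pos by (simp add: d_def)
    also have "\<dots> = (\<Sum>k<d. \<Sum>g\<in>carrier G. act V g $$ (0, k) * act V (inv g) $$ (k, 0))"
    proof (rule sum.cong[OF refl])
      fix k assume "k \<in> {..<d}"
      then have k: "k < d" by simp
      have "M $$ (0, k * d + k) = (\<Sum>g\<in>carrier G. N g $$ (0, k * d + k))"
        using Mi[of 0 "k * d + k"] less[OF k] k by auto
      also have "\<dots> = (\<Sum>g\<in>carrier G. act V g $$ (0, k) * act V (inv g) $$ (k, 0))"
      proof (rule sum.cong[OF refl])
        fix g assume g: "g \<in> carrier G"
        then show "N g $$ (0, k * d + k) = act V g $$ (0, k) * act V (inv g) $$ (k, 0)"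
          using Vc[OF g] Vc[of "inv g"] k less[OF k] by (simp add: N_def kron_index)
      qed
      finally show "M $$ (0, k * d + k) = (\<Sum>g\<in>carrier G. act V g $$ (0, k) * act V (inv g) $$ (k, 0))" .
    qed
    also have "\<dots> = (\<Sum>g\<in>carrier G. \<Sum>k<d. act V g $$ (0, k) * act V (inv g) $$ (k, 0))"
      by (rule sum.swap)
    also have "\<dots> = (\<Sum>g\<in>carrier G. 1)"
    proof (rule sum.cong[OF refl])
      fix g assume g: "g \<in> carrier G"
      have "(act V g * act V (inv g)) $$ (0, 0) = 1"
        using Vm[of g "inv g"] g pos by (simp add: V1 d_def)
      then show "(\<Sum>k<d. act V g $$ (0, k) * act V (inv g) $$ (k, 0)) = 1"
        using Vc[OF g] Vc[of "inv g"] g pos by (simp add: scalar_prod_def lessThan_atLeast0 d_def)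
    qed
    finally show False using n0 by (simp add: n_def)
  qed
  moreover have "mtr M = (\<Sum>g\<in>carrier G. mtr (act V g) * mtr (act V (inv g)))"
  proof -
    have "mtr M = (\<Sum>g\<in>carrier G. mtr (N g))"
    proof -
      have "mtr M = (\<Sum>i<d * d. \<Sum>g\<in>carrier G. N g $$ (i, i))"
        using Mc by (simp add: mtr_def Mi)
      also have "\<dots> = (\<Sum>g\<in>carrier G. \<Sum>i<d * d. N g $$ (i, i))" by (rule sum.swap)
      also have "\<dots> = (\<Sum>g\<in>carrier G. mtr (N g))"
        by (intro sum.cong refl) (simp add: mtr_def carrier_matD[OF Nc])
      finally show ?thesis .
    qed
    then show ?thesis
      using Vc by (simp add: N_def mtr_kron[where a = d and b = d] mtr_transpose[OF Vc])
  qed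
  ultimately show ?thesis using n0 by simp
qed

text \<open>Equal traces turn the nonzero sum for \<open>V\<close> alone into the mixed sum for
  \<open>W\<close> and \<open>V\<close>. Expanding both traces, some product of diagonal matrix
  coefficients must have a nonzero sum over the group.\<close>

lemma nonzero_hom_of_equal_traces:
  fixes G :: "('g, 'z) monoid_scheme" (structure) and V W :: "('k::field_char_0, 'g) matrix_module"
  assumes G: "group G" "finite (carrier G)" and V: "V \<in> fd_modules (group_algebra G)"
    and W: "W \<in> fd_modules (group_algebra G)" and pos: "fst V > 0"
    and tr: "\<forall>g\<in>carrier G. mtr (act V g) = mtr (act W g)"
  shows "\<exists>T\<in>module_homs (group_algebra G) V W. T \<noteq> 0\<^sub>m (fst W) (fst V)"
proof -
  interpret group G by fact
  interpret monomial_algebra "group_algebra G :: ('k, 'g) hopf_algebra" "carrier G" "monoid.mult G" "\<lambda>_ _. 1" "\<one>\<^bsub>G\<^esub>"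
    by (rule monomial_group_algebra) fact
  note dv = act_dim[OF V] act_dim[OF W]
  have mult: "act U g * act U h = act U (g \<otimes> h)" if "U \<in> fd_modules (group_algebra G)" "g \<in> carrier G" "h \<in> carrier G"
    for U :: "('k, 'g) matrix_module" and g h
    unfolding act_mult[OF that] by (rule one_smult_mat)
  have "(\<Sum>g\<in>carrier G. mtr (act W g) * mtr (act V (inv g))) \<noteq> 0"
    using sum_trace_inv_nonzero[OF G V pos] tr by simp
  also have "(\<Sum>g\<in>carrier G. mtr (act W g) * mtr (act V (inv g))) =
     (\<Sum>i<fst W. \<Sum>j<fst V. \<Sum>g\<in>carrier G. act W g $$ (i, i) * act V (inv g) $$ (j, j))"
    unfolding mtr_def
    by (simp add: dv sum_product)
      (subst sum.swap, intro sum.cong refl, subst sum.swap, simp)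
  finally obtain i j where ij: "i < fst W" "j < fst V"
    and nz: "(\<Sum>g\<in>carrier G. act W g $$ (i, i) * act V (inv g) $$ (j, j)) \<noteq> 0"
    by (metis (no_types, lifting) lessThan_iff sum.neutral)
  \<comment> \<open>The sum of \<open>W(g) E V(g^-1)\<close> over the group, where \<open>E\<close>
    is the elementary matrix at \<open>(i, j)\<close>; its entry at \<open>(i, j)\<close> is the
    nonzero sum just found.\<close>
  define T where "T = mat (fst W) (fst V) (\<lambda>(p, q). \<Sum>g\<in>carrier G. act W g $$ (p, i) * act V (inv g) $$ (j, q))"
  have "T $$ (i, j) \<noteq> 0" using nz ij by (simp add: T_def)
  then have "T \<noteq> 0\<^sub>m (fst W) (fst V)" using ij by auto
  moreover have "T \<in> module_homs (group_algebra G) V W"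
    unfolding module_homs_iff[OF V W]
  proof (intro conjI ballI)
    show "T \<in> carrier_mat (fst W) (fst V)" by (simp add: T_def)
    fix h assume h: "h \<in> carrier G"
    show "T * act V h = act W h * T"
    proof (rule eq_matI)
      fix p q assume "p < dim_row (act W h * T)" "q < dim_col (act W h * T)"
      then have pq: "p < fst W" "q < fst V" using dv h by (auto simp: T_def)
      have "(act W h * T) $$ (p, q) = (\<Sum>l<fst W. \<Sum>g\<in>carrier G. act W h $$ (p, l) * act W g $$ (l, i) * act V (inv g) $$ (j, q))"
        using pq h by (simp add: dv T_def scalar_prod_def sum_distrib_left mult.assoc lessThan_atLeast0)
      also have "\<dots> = (\<Sum>g\<in>carrier G. (act W h * act W g) $$ (p, i) * act V (inv g) $$ (j, q))"
        by (subst sum.swap, intro sum.cong refl)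
          (use pq ij h in \<open>simp add: dv scalar_prod_def sum_distrib_right lessThan_atLeast0\<close>)
      also have "\<dots> = (\<Sum>g\<in>carrier G. act W (h \<otimes> g) $$ (p, i) * act V (inv g) $$ (j, q))"
        using mult[OF W h] by simp
      also have "\<dots> = (\<Sum>g\<in>carrier G. act W g $$ (p, i) * act V (inv g \<otimes> h) $$ (j, q))"
        by (rule sum.reindex_bij_witness[of _ "\<lambda>g. inv h \<otimes> g" "\<lambda>g. h \<otimes> g"])
          (use h in \<open>simp_all add: m_assoc[symmetric] inv_mult_group\<close>, simp add: m_assoc)
      also have "\<dots> = (\<Sum>g\<in>carrier G. act W g $$ (p, i) * (act V (inv g) * act V h) $$ (j, q))"
        using mult[OF V _ h] by simp
      also have "\<dots> = (\<Sum>g\<in>carrier G. \<Sum>l<fst V. act W g $$ (p, i) * act V (inv g) $$ (j, l) * act V h $$ (l, q))"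
        by (intro sum.cong refl)
          (use pq ij h in \<open>simp add: dv scalar_prod_def sum_distrib_left mult.assoc lessThan_atLeast0\<close>)
      also have "\<dots> = (T * act V h) $$ (p, q)"
        using pq h by (subst sum.swap) (simp add: dv T_def scalar_prod_def sum_distrib_right lessThan_atLeast0)
      finally show "(T * act V h) $$ (p, q) = (act W h * T) $$ (p, q)" ..
    qed (use h in \<open>auto simp: dv T_def\<close>)
  qed
  ultimately show ?thesis by blast
qed

section \<open>Polynomial rings\<close>

lemma finite_submultisets: "finite {u. u \<subseteq># w}"
proof (induction w)
  case (add a w)
  have "{u. u \<subseteq># add_mset a w} \<subseteq> {u. u \<subseteq># w} \<union> add_mset a ` {u. u \<subseteq># w}"
  proof
    fix u assume u: "u \<in> {u. u \<subseteq># add_mset a w}"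
    show "u \<in> {u. u \<subseteq># w} \<union> add_mset a ` {u. u \<subseteq># w}"
    proof (cases "a \<in># u")
      case True
      then obtain v where "u = add_mset a v" by (metis multi_member_split)
      then show ?thesis using u by auto
    next
      case False
      have "count u x \<le> count w x" for x
        using False mset_subset_eq_count[of u "add_mset a w" x] u by (cases "x = a") (auto simp: not_in_iff)
      then have "u \<subseteq># w" by (rule mset_subset_eqI)
      then show ?thesis by simp
    qed
  qed
  then show ?case using add by (meson finite_UnI finite_imageI finite_subset)
qed simp

context cring
begin

definition indexed_mult :: "('c multiset \<Rightarrow> 'a) \<Rightarrow> ('c multiset \<Rightarrow> 'a) \<Rightarrow> 'c multiset \<Rightarrow> 'a" where
  "indexed_mult p q = (\<lambda>w. \<Oplus>u\<in>{u. u \<subseteq># w}. p u \<otimes> q (w - u))"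

lemma indexed_poly_ring_simps:
  "carrier (indexed_poly_ring R I) = indexed_pset I (carrier R)"
  "monoid.mult (indexed_poly_ring R I) = indexed_mult"
  "one (indexed_poly_ring R I) = indexed_const \<one>"
  "zero (indexed_poly_ring R I) = indexed_const \<zero>"
  "add (indexed_poly_ring R I) = indexed_padd"
  by (simp_all add: indexed_poly_ring_def indexed_mult_def fun_eq_iff)

lemma coeff_closed: "p \<in> indexed_pset I (carrier R) \<Longrightarrow> p w \<in> carrier R"
  using indexed_pset_in_carrier[of "carrier R" p I] by (simp add: carrier_coeff_def)

lemma indexed_mult_coeff: "carrier_coeff p \<Longrightarrow> carrier_coeff q \<Longrightarrow> carrier_coeff (indexed_mult p q)"
  unfolding carrier_coeff_def indexed_mult_def by (intro allI finsum_closed) auto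

lemma indexed_mult_const:
  assumes "k \<in> carrier R" "carrier_coeff q"
  shows "indexed_mult (indexed_const k) q = (\<lambda>w. k \<otimes> q w)"
proof
  fix w
  have "indexed_mult (indexed_const k) q w = (\<Oplus>u\<in>{u. u \<subseteq># w}. if {#} = u then k \<otimes> q (w - u) else \<zero>)"
    unfolding indexed_mult_def using assms
    by (intro finsum_cong') (auto simp: indexed_const_def carrier_coeff_def)
  also have "\<dots> = k \<otimes> q (w - {#})"
    by (rule finsum_singleton) (use assms in \<open>auto simp: finite_submultisets carrier_coeff_def\<close>)
  finally show "indexed_mult (indexed_const k) q w = k \<otimes> q w" by simp
qed

lemma indexed_mult_padd:
  assumes "carrier_coeff p" "carrier_coeff p'" "carrier_coeff q"
  shows "indexed_mult (indexed_padd p p') q = indexed_padd (indexed_mult p q) (indexed_mult p' q)"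
proof
  fix w
  have "indexed_mult (indexed_padd p p') q w = (\<Oplus>u\<in>{u. u \<subseteq># w}. p u \<otimes> q (w - u) \<oplus> p' u \<otimes> q (w - u))"
    unfolding indexed_mult_def indexed_padd_def using assms
    by (intro finsum_cong') (auto simp: carrier_coeff_def l_distr)
  also have "\<dots> = indexed_padd (indexed_mult p q) (indexed_mult p' q) w"
    unfolding indexed_mult_def indexed_padd_def using assms
    by (intro finsum_addf) (auto simp: carrier_coeff_def)
  finally show "indexed_mult (indexed_padd p p') q w = indexed_padd (indexed_mult p q) (indexed_mult p' q) w" .
qed

text \<open>Submultisets of \<open>w\<close> that contain \<open>i\<close> correspond to
  submultisets of \<open>w - {#i#}\<close>; the others contribute zero. Together with the rules for
  constants and sums this computes products by recursion on the first factor, from which closure,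
  associativity and evaluation follow.\<close>

lemma indexed_mult_pmult:
  assumes p: "carrier_coeff p" and q: "carrier_coeff q"
  shows "indexed_mult (indexed_pmult p i) q = indexed_pmult (indexed_mult p q) i"
proof
  fix w
  have c: "(\<lambda>u. indexed_pmult p i u \<otimes> q (w - u)) \<in> A \<rightarrow> carrier R" for A
    using assms by (auto simp: carrier_coeff_def indexed_pmult_def)
  show "indexed_mult (indexed_pmult p i) q w = indexed_pmult (indexed_mult p q) i w"
  proof (cases "i \<in># w")
    case True
    have im: "{u. u \<subseteq># w \<and> i \<in># u} = add_mset i ` {u. u \<subseteq># w - {#i#}}"
    proof (intro equalityI subsetI)
      fix u assume "u \<in> {u. u \<subseteq># w \<and> i \<in># u}"
      then have "u = add_mset i (u - {#i#})" "u - {#i#} \<subseteq># w - {#i#}"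
        by (auto simp: subseteq_mset_def diff_le_mono)
      then show "u \<in> add_mset i ` {u. u \<subseteq># w - {#i#}}" by blast
    next
      fix u assume "u \<in> add_mset i ` {u. u \<subseteq># w - {#i#}}"
      then show "u \<in> {u. u \<subseteq># w \<and> i \<in># u}"
        using True by (auto simp: insert_subset_eq_iff)
    qed
    have "indexed_mult (indexed_pmult p i) q w = (\<Oplus>u\<in>{u. u \<subseteq># w \<and> i \<in># u}. indexed_pmult p i u \<otimes> q (w - u))"
      unfolding indexed_mult_def
      by (rule add.finprod_mono_neutral_cong_right[OF finite_submultisets])
        (use c q in \<open>auto simp: indexed_pmult_def carrier_coeff_def\<close>)
    also have "\<dots> = (\<Oplus>u\<in>{u. u \<subseteq># w - {#i#}}. indexed_pmult p i (add_mset i u) \<otimes> q (w - add_mset i u))"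
      unfolding im by (rule finsum_reindex[OF c]) (auto simp: inj_on_def)
    also have "\<dots> = indexed_mult p q (w - {#i#})"
      unfolding indexed_mult_def
      by (intro finsum_cong') (use p q in \<open>auto simp: indexed_pmult_def carrier_coeff_def\<close>)
    finally show ?thesis using True by (simp add: indexed_pmult_def)
  next
    case False
    then have "i \<notin># u" if "u \<subseteq># w" for u using that by (meson mset_subset_eqD)
    then have "indexed_mult (indexed_pmult p i) q w = (\<Oplus>u\<in>{u. u \<subseteq># w}. \<zero>)"
      unfolding indexed_mult_def
      by (intro finsum_cong') (use q in \<open>auto simp: indexed_pmult_def carrier_coeff_def\<close>)
    then show ?thesis using False by (simp add: indexed_pmult_def)
  qed
qed

text \<open>The reflection \<open>u \<mapsto> w - u\<close> permutes the submultisets of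
  \<open>w\<close> and exchanges the factors.\<close>

lemma indexed_mult_comm:
  fixes p q :: "'c multiset \<Rightarrow> 'a"
  assumes p: "carrier_coeff p" and q: "carrier_coeff q"
  shows "indexed_mult p q = indexed_mult q p"
proof
  fix w :: "'c multiset"
  have im: "{u. u \<subseteq># w} = (\<lambda>u. w - u) ` {u. u \<subseteq># w}"
  proof (intro equalityI subsetI)
    fix u assume "u \<in> {u. u \<subseteq># w}"
    then have "u = w - (w - u)" by (simp add: multiset_eq_iff subseteq_mset_def)
    then show "u \<in> (\<lambda>u. w - u) ` {u. u \<subseteq># w}" by (metis (mono_tags) diff_subset_eq_self image_eqI mem_Collect_eq)
  qed auto
  have inj: "inj_on (\<lambda>u. w - u) {u. u \<subseteq># w}"
    by (rule inj_on_inverseI[of _ "\<lambda>u. w - u"]) (simp add: multiset_eq_iff subseteq_mset_def)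
  have "indexed_mult q p w = (\<Oplus>u\<in>(\<lambda>u. w - u) ` {u. u \<subseteq># w}. q u \<otimes> p (w - u))"
    unfolding indexed_mult_def by (subst im) simp
  also have "\<dots> = (\<Oplus>u\<in>{u. u \<subseteq># w}. q (w - u) \<otimes> p (w - (w - u)))"
    by (rule finsum_reindex[OF _ inj]) (use p q in \<open>auto simp: carrier_coeff_def\<close>)
  also have "\<dots> = indexed_mult p q w"
    unfolding indexed_mult_def
  proof (intro finsum_cong')
    fix u assume "u \<in> {u. u \<subseteq># w}"
    then have "w - (w - u) = u" by (simp add: multiset_eq_iff subseteq_mset_def)
    then show "q (w - u) \<otimes> p (w - (w - u)) = p u \<otimes> q (w - u)"
      using p q by (simp add: carrier_coeff_def m_comm)
  qed (use p q in \<open>auto simp: carrier_coeff_def\<close>)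
  finally show "indexed_mult p q w = indexed_mult q p w" ..
qed

lemma scaled_closed:
  assumes k: "k \<in> carrier R" and p: "p \<in> indexed_pset I (carrier R)"
  shows "(\<lambda>w. k \<otimes> p w) \<in> indexed_pset I (carrier R)"
  using p
proof induction
  case (indexed_const l)
  have "(\<lambda>w. k \<otimes> indexed_const l w) = indexed_const (k \<otimes> l)"
    using k by (auto simp: indexed_const_def)
  then show ?case using k indexed_const by (metis indexed_pset.indexed_const m_closed)
next
  case (indexed_padd p q)
  have "(\<lambda>w. k \<otimes> indexed_padd p q w) = indexed_padd (\<lambda>w. k \<otimes> p w) (\<lambda>w. k \<otimes> q w)"
    using k indexed_padd by (auto simp: indexed_padd_def r_distr coeff_closed)
  then show ?case using indexed_padd indexed_pset.indexed_padd by metis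
next
  case (indexed_pmult p i)
  have "(\<lambda>w. k \<otimes> indexed_pmult p i w) = indexed_pmult (\<lambda>w. k \<otimes> p w) i"
    using k by (auto simp: indexed_pmult_def)
  then show ?case using indexed_pmult indexed_pset.indexed_pmult by metis
qed

lemma carrier_coeffI: "p \<in> indexed_pset I (carrier R) \<Longrightarrow> carrier_coeff p"
  using indexed_pset_in_carrier by blast

lemma carrier_coeff_const: "k \<in> carrier R \<Longrightarrow> carrier_coeff (indexed_const k)"
  by (auto simp: carrier_coeff_def indexed_const_def)

lemma indexed_mult_closed:
  assumes p: "p \<in> indexed_pset I (carrier R)" and q: "q \<in> indexed_pset I (carrier R)"
  shows "indexed_mult p q \<in> indexed_pset I (carrier R)"
  using p
proof induction
  case (indexed_const k)
  then show ?case using scaled_closed q by (simp add: indexed_mult_const carrier_coeffI)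
next
  case (indexed_padd p p')
  then show ?case
    using indexed_pset.indexed_padd[of "indexed_mult p q" I "carrier R" "indexed_mult p' q"] q
    by (simp add: indexed_mult_padd carrier_coeffI)
next
  case (indexed_pmult p i)
  then show ?case
    using indexed_pset.indexed_pmult[of "indexed_mult p q" I "carrier R" i] q
    by (simp add: indexed_mult_pmult carrier_coeffI)
qed

lemma indexed_mult_assoc:
  assumes p: "p \<in> indexed_pset I (carrier R)" and q: "q \<in> indexed_pset I (carrier R)"
    and s: "s \<in> indexed_pset I (carrier R)"
  shows "indexed_mult (indexed_mult p q) s = indexed_mult p (indexed_mult q s)"
  using p
proof induction
  case (indexed_const k)
  have "indexed_mult (\<lambda>w. k \<otimes> q w) s = (\<lambda>w. k \<otimes> indexed_mult q s w)"
  proof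
    fix w
    show "indexed_mult (\<lambda>w. k \<otimes> q w) s w = k \<otimes> indexed_mult q s w"
      unfolding indexed_mult_def using q s indexed_const
      by (subst finsum_rdistr) (auto intro!: finsum_cong' simp: coeff_closed m_assoc finite_submultisets)
  qed
  then show ?case
    using indexed_const q s by (simp add: indexed_mult_const carrier_coeffI indexed_mult_coeff)
qed (use q s in \<open>simp_all add: indexed_mult_padd indexed_mult_pmult indexed_mult_coeff carrier_coeffI[where I = I]\<close>)

lemma cring_indexed_poly_ring: "cring (indexed_poly_ring R I)"
proof (rule cringI)
  show "abelian_group (indexed_poly_ring R I)"
  proof (rule abelian_groupI, unfold indexed_poly_ring_simps)
    fix p assume p: "p \<in> indexed_pset I (carrier R)"
    show "indexed_padd (indexed_const \<zero>) p = p"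
      using p by (simp add: indexed_padd_zero carrier_coeffI)
    have "indexed_padd (\<lambda>w. \<ominus> \<one> \<otimes> p w) p = indexed_const \<zero>"
      using p by (auto simp: indexed_padd_def indexed_const_def coeff_closed l_minus l_neg)
    then show "\<exists>q\<in>indexed_pset I (carrier R). indexed_padd q p = indexed_const \<zero>"
      using scaled_closed[OF _ p, of "\<ominus> \<one>"] by auto
  next
    fix p q s
    assume p: "p \<in> indexed_pset I (carrier R)" and q: "q \<in> indexed_pset I (carrier R)"
      and s: "s \<in> indexed_pset I (carrier R)"
    show "indexed_padd (indexed_padd p q) s = indexed_padd p (indexed_padd q s)"
      using coeff_closed[OF p] coeff_closed[OF q] coeff_closed[OF s] by (auto simp: indexed_padd_def a_assoc)
    show "indexed_padd p q = indexed_padd q p"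
      using coeff_closed[OF p] coeff_closed[OF q] by (auto simp: indexed_padd_def a_comm)
  qed (auto intro: indexed_pset.intros)
  show "comm_monoid (indexed_poly_ring R I)"
  proof (rule comm_monoidI, unfold indexed_poly_ring_simps)
    fix p assume p: "p \<in> indexed_pset I (carrier R)"
    then show "indexed_mult (indexed_const \<one>) p = p"
      by (simp add: indexed_mult_const carrier_coeffI coeff_closed)
  qed (auto intro: indexed_pset.intros simp: indexed_mult_closed indexed_mult_assoc indexed_mult_comm[OF carrier_coeffI carrier_coeffI])
qed (simp add: indexed_poly_ring_simps indexed_mult_padd carrier_coeffI)

lemma finite_support: "p \<in> indexed_pset I (carrier R) \<Longrightarrow> finite {w. p w \<noteq> \<zero>}"
proof (induction rule: indexed_pset.induct)
  case (indexed_const k)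
  then show ?case by (rule_tac finite_subset[of _ "{{#}}"]) (auto simp: indexed_const_def)
next
  case (indexed_padd p q)
  then show ?case
    by (rule_tac finite_subset[of _ "{w. p w \<noteq> \<zero>} \<union> {w. q w \<noteq> \<zero>}"]) (auto simp: indexed_padd_def)
next
  case (indexed_pmult p i)
  have "{w. indexed_pmult p i w \<noteq> \<zero>} \<subseteq> add_mset i ` {w. p w \<noteq> \<zero>}"
    by (auto simp: indexed_pmult_def image_iff split: if_splits) (metis insert_DiffM)
  then show ?case using indexed_pmult.IH by (meson finite_imageI finite_subset)
qed

end

text \<open>The universal property of the polynomial ring. The values lie in a type of class
  \<open>comm_ring_1\<close>, which gives access to ordinary sums over the support and to products
  over multisets.\<close>

locale poly_evaluation = cring R for R (structure) +
  fixes h :: "'a \<Rightarrow> 'e::comm_ring_1" and y :: "'c \<Rightarrow> 'e"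
  assumes h0: "h \<zero> = 0" and h1: "h \<one> = 1"
    and h_add: "a \<in> carrier R \<Longrightarrow> b \<in> carrier R \<Longrightarrow> h (a \<oplus> b) = h a + h b"
    and h_mult: "a \<in> carrier R \<Longrightarrow> b \<in> carrier R \<Longrightarrow> h (a \<otimes> b) = h a * h b"
begin

definition evalp :: "('c multiset \<Rightarrow> 'a) \<Rightarrow> 'e" where
  "evalp p = (\<Sum>w | p w \<noteq> \<zero>. h (p w) * prod_mset (image_mset y w))"

lemma evalp_superset:
  assumes "finite S" "{w. p w \<noteq> \<zero>} \<subseteq> S"
  shows "evalp p = (\<Sum>w\<in>S. h (p w) * prod_mset (image_mset y w))"
  unfolding evalp_def using assms by (intro sum.mono_neutral_left) (auto simp: h0)

lemma evalp_const: "k \<in> carrier R \<Longrightarrow> evalp (indexed_const k) = h k"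
  by (subst evalp_superset[of "{{#}}"]) (auto simp: indexed_const_def)

lemma evalp_padd:
  assumes p: "p \<in> indexed_pset I (carrier R)" and q: "q \<in> indexed_pset I (carrier R)"
  shows "evalp (indexed_padd p q) = evalp p + evalp q"
proof -
  let ?S = "{w. p w \<noteq> \<zero>} \<union> {w. q w \<noteq> \<zero>}"
  have S: "finite ?S" using finite_support[OF p] finite_support[OF q] by simp
  have "{w. indexed_padd p q w \<noteq> \<zero>} \<subseteq> ?S" by (auto simp: indexed_padd_def)
  then have "evalp (indexed_padd p q) = (\<Sum>w\<in>?S. h (indexed_padd p q w) * prod_mset (image_mset y w))"
    by (rule evalp_superset[OF S])
  also have "\<dots> = evalp p + evalp q"
    using p q by (simp add: evalp_superset[OF S, of p] evalp_superset[OF S, of q] indexed_padd_def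
        h_add coeff_closed distrib_right sum.distrib)
  finally show ?thesis .
qed

lemma evalp_pmult:
  assumes p: "p \<in> indexed_pset I (carrier R)"
  shows "evalp (indexed_pmult p i) = y i * evalp p"
proof -
  have fin: "finite {w. p w \<noteq> \<zero>}" using finite_support p .
  have "{w. indexed_pmult p i w \<noteq> \<zero>} \<subseteq> add_mset i ` {w. p w \<noteq> \<zero>}"
    by (auto simp: indexed_pmult_def image_iff split: if_splits) (metis insert_DiffM)
  then have "evalp (indexed_pmult p i) =
      (\<Sum>w\<in>add_mset i ` {w. p w \<noteq> \<zero>}. h (indexed_pmult p i w) * prod_mset (image_mset y w))"
    using fin by (intro evalp_superset) auto
  also have "\<dots> = y i * evalp p"
    by (subst sum.reindex) (auto simp: inj_on_def indexed_pmult_def evalp_def sum_distrib_left mult_ac)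
  finally show ?thesis .
qed

lemma evalp_scaled:
  assumes p: "p \<in> indexed_pset I (carrier R)" and k: "k \<in> carrier R"
  shows "evalp (\<lambda>w. k \<otimes> p w) = h k * evalp p"
proof -
  have "{w. k \<otimes> p w \<noteq> \<zero>} \<subseteq> {w. p w \<noteq> \<zero>}" using k by auto
  then have "evalp (\<lambda>w. k \<otimes> p w) = (\<Sum>w | p w \<noteq> \<zero>. h (k \<otimes> p w) * prod_mset (image_mset y w))"
    using finite_support[OF p] by (intro evalp_superset)
  then show ?thesis
    using p k by (simp add: h_mult coeff_closed evalp_def sum_distrib_left mult_ac)
qed

lemma evalp_mult:
  assumes p: "p \<in> indexed_pset I (carrier R)" and q: "q \<in> indexed_pset I (carrier R)"
  shows "evalp (indexed_mult p q) = evalp p * evalp q"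
  using p
proof induction
  case (indexed_const k)
  then show ?case using q by (simp add: indexed_mult_const carrier_coeffI evalp_scaled evalp_const)
next
  case (indexed_padd p p')
  then show ?case
    using q by (simp add: indexed_mult_padd carrier_coeffI evalp_padd[where I = I] indexed_mult_closed distrib_right)
next
  case (indexed_pmult p i)
  then show ?case
    using q by (simp add: indexed_mult_pmult carrier_coeffI evalp_pmult[where I = I] indexed_mult_closed mult.assoc)
qed

end

section \<open>Grothendieck rings as rings of functions\<close>

text \<open>Functions are set to 0 off \<open>S\<close>, so that two elements are equal as soon as
  they agree on \<open>S\<close>.\<close>

definition function_ring :: "'g set \<Rightarrow> ('g \<Rightarrow> 'a::comm_ring_1) ring" where
  "function_ring S = \<lparr>carrier = {u. \<forall>g. g \<notin> S \<longrightarrow> u g = 0}, monoid.mult = (\<lambda>u v g. u g * v g),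
     one = (\<lambda>g. if g \<in> S then 1 else 0), zero = (\<lambda>g. 0), add = (\<lambda>u v g. u g + v g)\<rparr>"

lemma cring_function_ring: "cring (function_ring S :: ('g \<Rightarrow> 'a::comm_ring_1) ring)" (is "cring ?T")
proof (rule cringI)
  show "abelian_group ?T"
  proof (rule abelian_groupI)
    fix u :: "'g \<Rightarrow> 'a" assume "u \<in> carrier (function_ring S)"
    then show "\<exists>v\<in>carrier ?T. v \<oplus>\<^bsub>?T\<^esub> u = \<zero>\<^bsub>?T\<^esub>"
      by (intro bexI[of _ "\<lambda>g. - u g"]) (auto simp: function_ring_def)
  qed (auto simp: function_ring_def add_ac)
  show "comm_monoid ?T"
    by (rule comm_monoidI) (auto simp: function_ring_def mult_ac)
qed (auto simp: function_ring_def distrib_right)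

text \<open>Common frame for \<open>kG\<close> with traces and for \<open>H\<close> with power
  series. By \<open>ch_ses\<close> and \<open>separating\<close> the relation subgroup is exactly
  the common kernel of the characters; the quotient thereby receives its ring laws from pointwise
  operations on functions.\<close>

locale separating_characters = monomial_algebra A B op s e0
  for A :: "('k::field, 'b) hopf_algebra" (structure) and B op s e0 +
  fixes S :: "'g set" and ch :: "'g \<Rightarrow> ('k, 'b) matrix_module \<Rightarrow> 'c::comm_ring_1"
  assumes tensor_closed: "V \<in> fd_modules A \<Longrightarrow> W \<in> fd_modules A \<Longrightarrow> tensor_module A V W \<in> fd_modules A"
    and trivial_closed: "trivial_module A \<in> fd_modules A"
    and ch_tensor: "g \<in> S \<Longrightarrow> V \<in> fd_modules A \<Longrightarrow> W \<in> fd_modules A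
      \<Longrightarrow> ch g (tensor_module A V W) = ch g V * ch g W"
    and ch_trivial: "g \<in> S \<Longrightarrow> ch g (trivial_module A) = 1"
    and ch_zero: "g \<in> S \<Longrightarrow> ch g zero_module = 0"
    and ch_ses: "g \<in> S \<Longrightarrow> ses U V W \<Longrightarrow> U \<in> fd_modules A \<Longrightarrow> V \<in> fd_modules A \<Longrightarrow> W \<in> fd_modules A
      \<Longrightarrow> ch g V = ch g U + ch g W"
    and separating: "f \<in> carrier (free_module_ring A) \<Longrightarrow> (\<And>g. g \<in> S \<Longrightarrow> iv.ext (ch g) f = 0)
      \<Longrightarrow> f \<in> relation_subgroup A"
begin

definition char :: "(('k, 'b) matrix_module \<Rightarrow>\<^sub>0 int) \<Rightarrow> 'g \<Rightarrow> 'c" where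
  "char f = (\<lambda>g. if g \<in> S then iv.ext (ch g) f else 0)"

abbreviation "T \<equiv> function_ring S :: ('g \<Rightarrow> 'c) ring"

definition chars :: "('g \<Rightarrow> 'c) set" where
  "chars = char ` carrier F"

lemma F_mult_closed:
  assumes "f \<in> carrier F" "g \<in> carrier F"
  shows "f \<otimes>\<^bsub>F\<^esub> g \<in> carrier F"
proof -
  have sum: "sum u I \<in> carrier F" if "\<And>i. i \<in> I \<Longrightarrow> u i \<in> carrier F" for u :: "_ \<Rightarrow> _" and I
    using that by (induction I rule: infinite_finite_induct) (auto simp: F_closed)
  have scl: "scl c u \<in> carrier F" if "u \<in> carrier F" for c :: int and u
    using that by (auto simp: F_simps in_keys_iff lookup_scl)
  show ?thesis
    unfolding F_simps bilin_def lin_def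
    using assms by (intro sum[unfolded F_simps] scl[unfolded F_simps]) (auto simp: F_simps subset_iff intro!: tensor_closed)
qed

lemma char_add: "char (f + g) = char f \<oplus>\<^bsub>T\<^esub> char g"
  by (auto simp: char_def function_ring_def iv.ext_add)

lemma char_mult: "f \<in> carrier F \<Longrightarrow> g \<in> carrier F \<Longrightarrow> char (f \<otimes>\<^bsub>F\<^esub> g) = char f \<otimes>\<^bsub>T\<^esub> char g"
  by (rule ext) (auto simp: char_def function_ring_def F_simps intro!: iv.ext_bilin_mult simp: ch_tensor subset_iff)

lemma char_one: "char \<one>\<^bsub>F\<^esub> = \<one>\<^bsub>T\<^esub>"
  by (auto simp: char_def function_ring_def F_simps ch_trivial)

lemma one_closed: "\<one>\<^bsub>F\<^esub> \<in> carrier F"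
  by (simp add: F_simps trivial_closed keys_single)

lemma char_closed: "char f \<in> carrier T"
  by (auto simp: char_def function_ring_def)

lemma char_eq_iff:
  assumes "f \<in> carrier F" "g \<in> carrier F"
  shows "char f = char g \<longleftrightarrow> f - g \<in> rel"
proof
  assume "char f = char g"
  then have "iv.ext (ch x) (f - g) = 0" if "x \<in> S" for x
    using that by (auto simp: char_def iv.ext_diff dest: fun_cong[of _ _ x])
  then show "f - g \<in> rel" by (rule separating[OF F_closed(4)[OF assms]])
next
  assume "f - g \<in> rel"
  then have "iv.ext (ch x) (f - g) = 0" if "x \<in> S" for x
    using that by (intro ext_rel) (auto intro: ch_ses ch_zero)
  then show "char f = char g" by (auto simp: char_def iv.ext_diff)
qed

lemma coset_eq: "f \<in> carrier F \<Longrightarrow> rel +>\<^bsub>F\<^esub> f = {g \<in> carrier F. char g = char f}"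
proof (intro equalityI subsetI)
  fix g assume f: "f \<in> carrier F" and "g \<in> rel +>\<^bsub>F\<^esub> f"
  then obtain r where r: "r \<in> rel" "g = r + f" by (auto simp: a_r_coset_def r_coset_def F_simps)
  then have "g \<in> carrier F" using f rel_subset F_closed(2) by blast
  then show "g \<in> {g \<in> carrier F. char g = char f}" using r f char_eq_iff[of g f] by simp
next
  fix g assume f: "f \<in> carrier F" and "g \<in> {g \<in> carrier F. char g = char f}"
  then have "g - f \<in> rel" using char_eq_iff[of g f] by auto
  then show "g \<in> rel +>\<^bsub>F\<^esub> f"
    by (auto simp: a_r_coset_def r_coset_def F_simps intro!: bexI[of _ "g - f"])
qed

text \<open>Cosets of the relations are the fibres of \<open>char\<close>, so this is the inverse of
  the passage from classes to functions.\<close>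

definition fibre :: "('g \<Rightarrow> 'c) \<Rightarrow> (('k, 'b) matrix_module \<Rightarrow>\<^sub>0 int) set" where
  "fibre u = {f \<in> carrier F. char f = u}"

lemma fibre_char: "f \<in> carrier F \<Longrightarrow> fibre (char f) = rel +>\<^bsub>F\<^esub> f"
  by (simp add: coset_eq fibre_def)

lemma G0_simps:
  "carrier (G0 A) = (\<lambda>f. rel +>\<^bsub>F\<^esub> f) ` carrier F"
  "monoid.mult (G0 A) = rcoset_mult F rel" "one (G0 A) = rel +>\<^bsub>F\<^esub> \<one>\<^bsub>F\<^esub>"
  "zero (G0 A) = rel" "add (G0 A) = set_add F"
  by (auto simp: G0_def FactRing_def A_RCOSETS_def RCOSETS_def a_r_coset_def)

lemma fibre_iso: "fibre \<in> ring_iso (T\<lparr>carrier := chars\<rparr>) (G0 A)"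
proof (rule ring_iso_memI)
  fix u v assume "u \<in> carrier (T\<lparr>carrier := chars\<rparr>)" "v \<in> carrier (T\<lparr>carrier := chars\<rparr>)"
  then obtain f g where fg: "f \<in> carrier F" "g \<in> carrier F" "u = char f" "v = char g"
    by (auto simp: chars_def)
  show "fibre u \<in> carrier (G0 A)"
    using fg by (simp add: fibre_char G0_simps)
  \<comment> \<open>The product of two cosets is a union over pairs of representatives; by
    multiplicativity of \<open>char\<close> all its members are the same fibre, and the index sets
    are nonempty.\<close>
  have "fibre (char f) \<otimes>\<^bsub>G0 A\<^esub> fibre (char g) =
      (\<Union>a\<in>fibre (char f). \<Union>b\<in>fibre (char g). fibre (char f \<otimes>\<^bsub>T\<^esub> char g))"
    unfolding G0_simps rcoset_mult_def
    by (intro SUP_cong refl) (auto simp: fibre_def coset_eq F_mult_closed char_mult)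
  also have "\<dots> = fibre (char f \<otimes>\<^bsub>T\<^esub> char g)"
    using fg(1,2) by (auto simp: fibre_def)
  finally show "fibre (u \<otimes>\<^bsub>T\<lparr>carrier := chars\<rparr>\<^esub> v) = fibre u \<otimes>\<^bsub>G0 A\<^esub> fibre v" by (simp add: fg)
  have "fibre (char f) \<oplus>\<^bsub>G0 A\<^esub> fibre (char g) = fibre (char (f + g))"
  proof (intro equalityI subsetI)
    fix x assume "x \<in> fibre (char f) \<oplus>\<^bsub>G0 A\<^esub> fibre (char g)"
    then obtain a b where "a \<in> fibre (char f)" "b \<in> fibre (char g)" "x = a + b"
      by (auto simp: G0_simps set_add_def set_mult_def F_simps)
    then show "x \<in> fibre (char (f + g))" by (auto simp: fibre_def F_closed char_add)
  next
    fix x assume "x \<in> fibre (char (f + g))"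
    then have x: "x \<in> carrier F" "char x = char (f + g)" by (auto simp: fibre_def)
    then have "x - (f + g) \<in> rel" using char_eq_iff F_closed(2) fg by blast
    then have "(x - g) - f \<in> rel" by (simp add: algebra_simps)
    then have "x - g \<in> fibre (char f)" using char_eq_iff F_closed(4) x(1) fg by (simp add: fibre_def)
    moreover have "g \<in> fibre (char g)" using fg by (simp add: fibre_def)
    moreover have "x = (x - g) + g" by simp
    ultimately show "x \<in> fibre (char f) \<oplus>\<^bsub>G0 A\<^esub> fibre (char g)"
      unfolding G0_simps set_add_def set_mult_def by (simp add: F_simps, intro bexI[of _ "x - g"] bexI[of _ g]) auto
  qed
  then show "fibre (u \<oplus>\<^bsub>T\<lparr>carrier := chars\<rparr>\<^esub> v) = fibre u \<oplus>\<^bsub>G0 A\<^esub> fibre v"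
    by (simp add: fg char_add)
next
  show "fibre \<one>\<^bsub>T\<lparr>carrier := chars\<rparr>\<^esub> = \<one>\<^bsub>G0 A\<^esub>"
    using fibre_char[OF one_closed] by (simp add: char_one G0_simps)
  show "bij_betw fibre (carrier (T\<lparr>carrier := chars\<rparr>)) (carrier (G0 A))"
    unfolding bij_betw_def
  proof
    show "inj_on fibre (carrier (T\<lparr>carrier := chars\<rparr>))"
      by (rule inj_onI) (auto simp: chars_def fibre_def)
    show "fibre ` carrier (T\<lparr>carrier := chars\<rparr>) = carrier (G0 A)"
      by (auto simp: chars_def G0_simps fibre_char image_iff)
  qed
qed

lemma subcring_chars: "subcring chars T"
proof -
  interpret T: cring T by (rule cring_function_ring)
  have "subring chars T"
  proof (rule T.subringI)
    show "chars \<subseteq> carrier T" using char_closed by (auto simp: chars_def)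
    show "\<one>\<^bsub>T\<^esub> \<in> chars" unfolding chars_def char_one[symmetric] using one_closed by blast
  next
    fix u assume "u \<in> chars"
    then obtain f where f: "f \<in> carrier F" "u = char f" by (auto simp: chars_def)
    have "char (- f) \<oplus>\<^bsub>T\<^esub> char f = \<zero>\<^bsub>T\<^esub>"
      by (auto simp: char_def function_ring_def iv.ext_uminus)
    then have "\<ominus>\<^bsub>T\<^esub> u = char (- f)" using T.minus_equality char_closed f(2) by blast
    then show "\<ominus>\<^bsub>T\<^esub> u \<in> chars" using f F_closed(3) by (auto simp: chars_def)
  next
    fix u v assume "u \<in> chars" "v \<in> chars"
    then obtain f g where fg: "f \<in> carrier F" "g \<in> carrier F" "u = char f" "v = char g"
      by (auto simp: chars_def)
    show "u \<otimes>\<^bsub>T\<^esub> v \<in> chars" "u \<oplus>\<^bsub>T\<^esub> v \<in> chars"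
      unfolding fg char_mult[OF fg(1,2), symmetric] char_add[symmetric] chars_def
      using F_mult_closed[OF fg(1,2)] F_closed(2)[OF fg(1,2)] by auto
  qed
  then show ?thesis by (rule T.subcringI')
qed

lemma cring_chars: "cring (T\<lparr>carrier := chars\<rparr>)"
proof -
  interpret T: cring T by (rule cring_function_ring)
  show ?thesis using T.subcring_iff subcring_chars subcringE(1)[OF subcring_chars] by blast
qed

lemma char_zero_F: "char 0 = \<zero>\<^bsub>T\<^esub>"
  by (auto simp: char_def function_ring_def)

lemma cring_G0: "cring (G0 A)"
proof -
  \<comment> \<open>Transport along a bijection produces a ring whose zero is the image of zero; it
    has to be identified with the zero of the quotient.\<close>
  have "fibre \<zero>\<^bsub>T\<^esub> = \<zero>\<^bsub>G0 A\<^esub>"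
    unfolding char_zero_F[symmetric] fibre_char[OF F_closed(1)] G0_simps
    by (auto simp: a_r_coset_def r_coset_def F_simps)
  then have "G0 A\<lparr>zero := fibre \<zero>\<^bsub>T\<lparr>carrier := chars\<rparr>\<^esub>\<rparr> = G0 A" by simp
  then show ?thesis using cring.ring_iso_imp_img_cring[OF cring_chars fibre_iso] by simp
qed

definition class_char :: "(('k, 'b) matrix_module \<Rightarrow>\<^sub>0 int) set \<Rightarrow> 'g \<Rightarrow> 'c" where
  "class_char = inv_into chars fibre"

lemma class_char_iso: "class_char \<in> ring_iso (G0 A) (T\<lparr>carrier := chars\<rparr>)"
  using ring_iso_set_sym[OF cring.axioms(1)[OF cring_chars] fibre_iso] by (simp add: class_char_def)

lemma class_char_coset:
  assumes "f \<in> carrier F"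
  shows "class_char (rel +>\<^bsub>F\<^esub> f) = char f"
proof -
  have "inj_on fibre chars" by (auto simp: chars_def inj_on_def fibre_def)
  moreover have "char f \<in> chars" using assms by (simp add: chars_def)
  ultimately show ?thesis
    using inv_into_f_f[of fibre chars "char f"] by (simp add: class_char_def fibre_char[OF assms])
qed

lemma class_char_hom:
  "u \<in> carrier (G0 A) \<Longrightarrow> v \<in> carrier (G0 A) \<Longrightarrow> class_char (u \<otimes>\<^bsub>G0 A\<^esub> v) g = class_char u g * class_char v g"
  "u \<in> carrier (G0 A) \<Longrightarrow> v \<in> carrier (G0 A) \<Longrightarrow> class_char (u \<oplus>\<^bsub>G0 A\<^esub> v) g = class_char u g + class_char v g"
  "g \<in> S \<Longrightarrow> class_char \<one>\<^bsub>G0 A\<^esub> g = 1"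
  "class_char \<zero>\<^bsub>G0 A\<^esub> g = 0"
proof -
  interpret G: cring "G0 A" by (rule cring_G0)
  have h: "class_char \<in> Ring.ring_hom (G0 A) (T\<lparr>carrier := chars\<rparr>)"
    using class_char_iso by (simp add: ring_iso_def)
  show "class_char (u \<otimes>\<^bsub>G0 A\<^esub> v) g = class_char u g * class_char v g"
    if "u \<in> carrier (G0 A)" "v \<in> carrier (G0 A)"
    using ring_hom_mult[OF h that] by (simp add: function_ring_def)
  show add: "class_char (u \<oplus>\<^bsub>G0 A\<^esub> v) g = class_char u g + class_char v g"
    if "u \<in> carrier (G0 A)" "v \<in> carrier (G0 A)" for u v
    using ring_hom_add[OF h that] by (simp add: function_ring_def)
  show "class_char \<one>\<^bsub>G0 A\<^esub> g = 1" if "g \<in> S"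
    using ring_hom_one[OF h] that by (simp add: function_ring_def)
  show "class_char \<zero>\<^bsub>G0 A\<^esub> g = 0" using add[of "\<zero>\<^bsub>G0 A\<^esub>" "\<zero>\<^bsub>G0 A\<^esub>"] by simp
qed

lemma class_char_eqI:
  assumes "u \<in> carrier (G0 A)" "v \<in> carrier (G0 A)" "\<And>g. g \<in> S \<Longrightarrow> class_char u g = class_char v g"
  shows "u = v"
proof -
  have c: "class_char w \<in> chars" if "w \<in> carrier (G0 A)" for w
    using class_char_iso that by (auto simp: ring_iso_def bij_betw_def)
  have "class_char w g = 0" if "w \<in> carrier (G0 A)" "g \<notin> S" for w g
    using c[OF that(1)] that(2) by (auto simp: chars_def char_def)
  then have "class_char u = class_char v" using assms by (metis ext)
  then show ?thesis using class_char_iso assms(1,2) by (auto simp: ring_iso_def bij_betw_def inj_on_def)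
qed

lemma G0_class_closed: "V \<in> fd_modules A \<Longrightarrow> G0_class A V \<in> carrier (G0 A)"
  by (auto simp: G0_class_def G0_simps F_closed)

lemma class_char_G0_class: "V \<in> fd_modules A \<Longrightarrow> g \<in> S \<Longrightarrow> class_char (G0_class A V) g = ch g V"
  by (simp add: G0_class_def class_char_coset F_closed) (simp add: char_def)

end

section \<open>Tensor products of modules\<close>

lemma extm_lin:
  assumes "\<And>b. b \<in> Poly_Mapping.keys f \<Longrightarrow> extm d E (\<phi> b) = E' b"
  shows "extm d E (lin \<phi> f) = extm d E' f"
proof (rule eq_matI)
  fix i j assume "i < dim_row (extm d E' f)" "j < dim_col (extm d E' f)"
  then have ij: "i < d" "j < d" by auto
  have "ev.ext (\<lambda>x. ev.ext (\<lambda>b. E b $$ (i, j)) (\<phi> x)) f = ev.ext (\<lambda>x. E' x $$ (i, j)) f"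
  proof (rule ev.ext_cong)
    fix b assume "b \<in> Poly_Mapping.keys f"
    from assms[OF this] ij show "ev.ext (\<lambda>x. E x $$ (i, j)) (\<phi> b) = E' b $$ (i, j)"
      by (auto simp: extm_def dest: arg_cong[of _ _ "\<lambda>M. M $$ (i, j)"])
  qed
  then show "extm d E (lin \<phi> f) $$ (i, j) = extm d E' f $$ (i, j)"
    using ij by (simp add: extm_def ev.ext_lin)
qed auto

definition kron_act :: "('k::field, 'b) matrix_module \<Rightarrow> ('k, 'b) matrix_module \<Rightarrow> 'b \<times> 'b \<Rightarrow> 'k mat" where
  "kron_act V W = (\<lambda>(p, q). kron (act V p) (act W q))"

text \<open>Reads the action of \<open>x\<close> as the linear extension of \<open>kron_act\<close>
  applied to \<open>\<Delta>(x)\<close>, the form to which \<open>extm_lin\<close> and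
  \<open>extm_bilin\<close> apply.\<close>

lemma tensor_module_extm:
  "tensor_module A V W = (fst V * fst W, \<lambda>x\<in>carrier A. extm (fst V * fst W) (kron_act V W) (comult A x))"
  unfolding tensor_module_def extm_def ev.ext_def kron_act_def act_def
  by (simp add: case_prod_unfold)

lemma act_extm_module:
  assumes "bas b \<in> carrier A" "E b \<in> carrier_mat d d"
  shows "act (d, \<lambda>f\<in>carrier A. extm d E f) b = E b"
  using assms by (simp add: act_def extm_single) (rule eq_matI, auto)

context monomial_algebra
begin

text \<open>Reduces separation for virtual modules to the comparison of two genuine modules in
  \<open>equal_traces_rel\<close>.\<close>

lemma difference_of_modules:
  assumes f: "f \<in> carrier F"
  shows "\<exists>V W. V \<in> fd_modules A \<and> W \<in> fd_modules A \<and> f - (bas V - bas W) \<in> rel"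
  using f
proof (induction f rule: F_induct)
  case zero
  show ?case using zero_module rel_zero by (intro exI[of _ zero_module]) simp
next
  case (bas V)
  have "bas V - (bas V - bas zero_module) \<in> rel"
    using rel_dim_zero[OF zero_module] by simp
  then show ?case using bas zero_module by blast
next
  case (diff f g)
  then obtain V W V' W' where *: "V \<in> fd_modules A" "W \<in> fd_modules A" "f - (bas V - bas W) \<in> rel"
    "V' \<in> fd_modules A" "W' \<in> fd_modules A" "g - (bas V' - bas W') \<in> rel" by blast
  have "f - g - (bas (dsum V W') - bas (dsum V' W)) =
      (f - (bas V - bas W)) - (g - (bas V' - bas W')) - (bas (dsum V W') - (bas V + bas W'))
      + (bas (dsum V' W) - (bas V' + bas W))" by (simp add: algebra_simps)
  also have "\<dots> \<in> rel"
    by (intro rel_add rel_diff rel_dsum *)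
  finally show ?case using dsum(1)[OF *(1,5)] dsum(1)[OF *(4,2)] by blast
qed

end

lemma tensor_module_group_algebra:
  fixes V W :: "('k::field, 'g) matrix_module"
  assumes G: "group G" and V: "V \<in> fd_modules (group_algebra G)" and W: "W \<in> fd_modules (group_algebra G)"
  shows "tensor_module (group_algebra G) V W \<in> fd_modules (group_algebra G)"
    and "g \<in> carrier G \<Longrightarrow> act (tensor_module (group_algebra G) V W) g = kron (act V g) (act W g)"
proof -
  interpret monomial_algebra "group_algebra G :: ('k, 'g) hopf_algebra" "carrier G" "monoid.mult G" "\<lambda>_ _. 1" "\<one>\<^bsub>G\<^esub>"
    by (rule monomial_group_algebra) fact
  let ?n = "fst V * fst W" and ?E = "\<lambda>g. kron (act V g) (act W g)"
  have c: "?E g \<in> carrier_mat ?n ?n" if "g \<in> carrier G" for g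
    by (intro kron_carrier act_carrier V W that)
  have eq: "tensor_module (group_algebra G) V W = (?n, \<lambda>f\<in>carrier (group_algebra G). extm ?n ?E f)"
    unfolding tensor_module_extm
  proof (rule arg_cong[of _ _ "Pair ?n"], rule restrict_ext)
    fix f assume "f \<in> carrier (group_algebra G :: ('k, 'g) hopf_algebra)"
    then have "extm ?n (kron_act V W) (bas (b, b)) = ?E b" if "b \<in> Poly_Mapping.keys f" for b
      using that c[of b] by (auto simp: group_algebra_simps kron_act_def extm_single one_smult_mat)
    then show "extm ?n (kron_act V W) (comult (group_algebra G) f) = extm ?n ?E f"
      unfolding group_algebra_simps by (rule extm_lin)
  qed
  show "tensor_module (group_algebra G) V W \<in> fd_modules (group_algebra G)"
    unfolding eq
  proof (rule fd_modulesI[OF c])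
    fix g h assume gh: "g \<in> carrier G" "h \<in> carrier G"
    then show "?E g * ?E h = 1 \<cdot>\<^sub>m ?E (g \<otimes>\<^bsub>G\<^esub> h)"
      by (simp add: kron_mult act_dim[OF V] act_dim[OF W] act_mult[OF V] act_mult[OF W] one_smult_mat)
  next
    show "?E \<one>\<^bsub>G\<^esub> = 1\<^sub>m ?n" by (simp add: act_one[OF V] act_one[OF W] kron_one)
  qed
  show "act (tensor_module (group_algebra G) V W) g = kron (act V g) (act W g)" if "g \<in> carrier G"
    unfolding eq by (rule act_extm_module) (use that c in auto)
qed

lemma one_dim_module:
  assumes G: "group G" and \<eta>: "\<And>g h. g \<in> carrier G \<Longrightarrow> h \<in> carrier G \<Longrightarrow> \<eta> (g \<otimes>\<^bsub>G\<^esub> h) = \<eta> g * \<eta> h"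
    "\<eta> \<one>\<^bsub>G\<^esub> = 1"
  shows "character_module G (\<eta> :: 'g \<Rightarrow> 'k::field) \<in> fd_modules (group_algebra G)"
    and "g \<in> carrier G \<Longrightarrow> mtr (act (character_module G \<eta>) g) = \<eta> g"
proof -
  interpret monomial_algebra "group_algebra G :: ('k, 'g) hopf_algebra" "carrier G" "monoid.mult G" "\<lambda>_ _. 1" "\<one>\<^bsub>G\<^esub>"
    by (rule monomial_group_algebra) fact
  let ?E = "\<lambda>g. mat 1 1 (\<lambda>_. \<eta> g)"
  have eq: "character_module G \<eta> = (1, \<lambda>f\<in>carrier (group_algebra G). extm 1 ?E f)"
    unfolding character_module_def
    by (intro arg_cong[of _ _ "Pair 1"] restrict_ext eq_matI) (auto simp: extm_def ev.ext_def)
  show "character_module G \<eta> \<in> fd_modules (group_algebra G)"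
    unfolding eq by (rule fd_modulesI) (auto intro!: eq_matI simp: \<eta> scalar_prod_def)
  show "mtr (act (character_module G \<eta>) g) = \<eta> g" if "g \<in> carrier G"
    unfolding eq using that by (subst act_extm_module) (auto simp: mtr_def)
qed

lemma trivial_module_group_algebra:
  "trivial_module (group_algebra G) = (character_module G (\<lambda>_. 1) :: ('k::field, 'g) matrix_module)"
  by (simp add: trivial_module_def character_module_def group_algebra_simps)

text \<open>If all characters of a virtual module vanish, it is congruent to a difference of two
  modules with equal traces. Those are compared by \<open>equal_traces_rel\<close> with
  \<open>P\<close> always true, the nonzero maps coming from averaging.\<close>

lemma separating_group_characters:
  assumes G: "group G" "finite (carrier G)"
  shows "separating_characters (group_algebra G :: ('k::field_char_0, 'g) hopf_algebra) (carrier G)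
    (monoid.mult G) (\<lambda>_ _. 1) \<one>\<^bsub>G\<^esub> (carrier G) (\<lambda>g V. mtr (act V g))"
proof -
  interpret monomial_algebra "group_algebra G :: ('k, 'g) hopf_algebra" "carrier G" "monoid.mult G" "\<lambda>_ _. 1" "\<one>\<^bsub>G\<^esub>"
    by (rule monomial_group_algebra) fact
  show ?thesis
  proof unfold_locales
    fix V W :: "('k, 'g) matrix_module" and g
    assume V: "V \<in> fd_modules (group_algebra G)" and W: "W \<in> fd_modules (group_algebra G)"
    show "tensor_module (group_algebra G) V W \<in> fd_modules (group_algebra G)"
      by (rule tensor_module_group_algebra[OF G(1) V W])
    show "mtr (act (tensor_module (group_algebra G) V W) g) = mtr (act V g) * mtr (act W g)"
      if "g \<in> carrier G"
      using tensor_module_group_algebra(2)[OF G(1) V W that]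
      by (simp add: mtr_kron[OF act_carrier[OF V that] act_carrier[OF W that]])
  next
    show "trivial_module (group_algebra G) \<in> fd_modules (group_algebra G :: ('k, 'g) hopf_algebra)"
      unfolding trivial_module_group_algebra by (rule one_dim_module[OF G(1)]) auto
    show "mtr (act (trivial_module (group_algebra G) :: ('k, 'g) matrix_module) g) = 1" if "g \<in> carrier G" for g
      unfolding trivial_module_group_algebra by (rule one_dim_module[OF G(1)]) (use that in auto)
    show "mtr (act zero_module g) = 0" if "g \<in> carrier G" for g
      using act_dim[OF zero_module(1) that] by (simp add: mtr_def zero_module(2))
  next
    fix U V W :: "('k, 'g) matrix_module" and g
    assume "g \<in> carrier G" "ses U V W" "U \<in> fd_modules (group_algebra G)" "V \<in> fd_modules (group_algebra G)"
      "W \<in> fd_modules (group_algebra G)"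
    then show "mtr (act V g) = mtr (act U g) + mtr (act W g)"
      unfolding act_def by (intro mtr_ses) auto
  next
    fix f :: "('k, 'g) matrix_module \<Rightarrow>\<^sub>0 int"
    assume f: "f \<in> carrier F" and zero: "\<And>g. g \<in> carrier G \<Longrightarrow> iv.ext (\<lambda>V. mtr (act V g)) f = 0"
    obtain V W where VW: "V \<in> fd_modules (group_algebra G)" "W \<in> fd_modules (group_algebra G)"
      "f - (bas V - bas W) \<in> rel"
      using difference_of_modules[OF f] by blast
    have "mtr (act V g) = mtr (act W g)" if g: "g \<in> carrier G" for g
    proof -
      have "iv.ext (\<lambda>V. mtr (act V g)) (f - (bas V - bas W)) = 0"
      proof (rule ext_rel[OF _ _ VW(3)])
        show "mtr (act zero_module g) = 0"
          using act_dim[OF zero_module(1) g] by (simp add: mtr_def zero_module(2))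
      qed (use g in \<open>auto simp: act_def intro!: mtr_ses\<close>)
      then show ?thesis using zero[OF g] by (simp add: iv.ext_diff)
    qed
    then have "bas V - bas W \<in> rel"
      using nonzero_hom_of_equal_traces[OF G]
      by (intro equal_traces_rel[OF monomial_algebra_axioms, where P = "\<lambda>_. True" and ?B0.0 = "carrier G"])
        (auto simp: VW e0)
    from rel_add[OF VW(3) this] show "f \<in> rel" by simp
  qed
qed

section \<open>Traces and exponential generating functions\<close>

lemma pow_mat_Suc_left:
  "A \<in> carrier_mat n n \<Longrightarrow> A ^\<^sub>m Suc k = A * A ^\<^sub>m k"
proof (induction k)
  case (Suc k)
  have p: "A ^\<^sub>m k \<in> carrier_mat n n" using Suc by simp
  have "A ^\<^sub>m Suc (Suc k) = (A * A ^\<^sub>m k) * A" using Suc by simp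
  also have "\<dots> = A * (A ^\<^sub>m k * A)" by (rule assoc_mult_mat[OF Suc.prems p Suc.prems])
  finally show ?case by simp
qed simp

text \<open>The traces of \<open>(A \<otimes> 1 + 1 \<otimes> B)\<^sup>j\<close> are binomial convolutions of those of the powers of
  \<open>A\<close> and \<open>B\<close>, whence the exponential generating function.\<close>

definition trace_fps :: "'k::field_char_0 mat \<Rightarrow> 'k mat \<Rightarrow> 'k fps" where
  "trace_fps P A = Abs_fps (\<lambda>j. mtr (P * A ^\<^sub>m j) / fact j)"

text \<open>The series is \<open>tr(P exp(t A))\<close>, and differentiation brings down one factor
  \<open>A\<close>.\<close>

lemma fps_deriv_trace_fps:
  assumes "P \<in> carrier_mat d d" "A \<in> carrier_mat d d"
  shows "fps_deriv (trace_fps P A) = trace_fps (P * A) A"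
proof (rule fps_ext)
  fix j
  have "P * A ^\<^sub>m Suc j = P * A * A ^\<^sub>m j"
    using assms pow_mat_Suc_left[OF assms(2), of j] assoc_mult_mat[of P d d A d "A ^\<^sub>m j" d] by simp
  then show "fps_nth (fps_deriv (trace_fps P A)) j = fps_nth (trace_fps (P * A) A) j"
    by (simp add: trace_fps_def fact_Suc field_simps del: pow_mat.simps of_nat_Suc)
qed

text \<open>Both sides obey the Leibniz rule, because multiplying \<open>P \<otimes> Q\<close> by
  \<open>A \<otimes> 1 + 1 \<otimes> B\<close> gives
  \<open>P A \<otimes> Q + P \<otimes> Q B\<close>. The induction on the coefficient index keeps
  \<open>P\<close> and \<open>Q\<close> general, since differentiation changes them.\<close>

lemma trace_fps_kron:
  assumes P: "P \<in> carrier_mat d d" and A: "A \<in> carrier_mat d d"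
    and Q: "Q \<in> carrier_mat e e" and B: "B \<in> carrier_mat e e"
  shows "trace_fps (kron P Q) (kron A (1\<^sub>m e) + kron (1\<^sub>m d) B) = trace_fps P A * trace_fps Q B"
    (is "trace_fps _ ?N = _")
proof (rule fps_ext)
  fix j
  have N: "?N \<in> carrier_mat (d * e) (d * e)"
    by (intro add_carrier_mat kron_carrier) (use A B in auto)
  show "fps_nth (trace_fps (kron P Q) ?N) j = fps_nth (trace_fps P A * trace_fps Q B) j"
    using P Q
  proof (induction j arbitrary: P Q)
    case 0
    then show ?case
      using right_mult_one_mat[OF kron_carrier[OF 0(1,2)]] A B
      by (simp add: trace_fps_def mtr_kron)
  next
    case (Suc j)
    have K: "kron P Q \<in> carrier_mat (d * e) (d * e)" using kron_carrier Suc.prems by blast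
    have PA: "P * A \<in> carrier_mat d d" and QB: "Q * B \<in> carrier_mat e e" using Suc.prems A B by auto
    have "kron P Q * ?N = kron P Q * kron A (1\<^sub>m e) + kron P Q * kron (1\<^sub>m d) B"
      by (rule mult_add_distrib_mat[OF K kron_carrier kron_carrier]) (use A B in auto)
    also have "\<dots> = kron (P * A) Q + kron P (Q * B)"
      using Suc.prems A B by (simp add: kron_mult)
    finally have KN: "kron P Q * ?N = kron (P * A) Q + kron P (Q * B)" .
    have "trace_fps (kron P Q * ?N) ?N = trace_fps (kron (P * A) Q) ?N + trace_fps (kron P (Q * B)) ?N"
    proof (rule fps_ext)
      fix l
      have Nl: "?N ^\<^sub>m l \<in> carrier_mat (d * e) (d * e)" using N by (rule pow_carrier_mat)
      have K1: "kron (P * A) Q \<in> carrier_mat (d * e) (d * e)" and K2: "kron P (Q * B) \<in> carrier_mat (d * e) (d * e)"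
        using kron_carrier PA QB Suc.prems by blast+
      have "mtr ((kron (P * A) Q + kron P (Q * B)) * ?N ^\<^sub>m l) =
          mtr (kron (P * A) Q * ?N ^\<^sub>m l) + mtr (kron P (Q * B) * ?N ^\<^sub>m l)"
        unfolding add_mult_distrib_mat[OF K1 K2 Nl]
        by (rule mtr_add[OF mult_carrier_mat[OF K1 Nl] mult_carrier_mat[OF K2 Nl]])
      then show "fps_nth (trace_fps (kron P Q * ?N) ?N) l =
          fps_nth (trace_fps (kron (P * A) Q) ?N + trace_fps (kron P (Q * B)) ?N) l"
        by (simp add: trace_fps_def KN add_divide_distrib)
    qed
    then have "fps_nth (fps_deriv (trace_fps (kron P Q) ?N)) j =
        fps_nth (trace_fps (P * A) A * trace_fps Q B + trace_fps P A * trace_fps (Q * B) B) j"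
      using Suc.IH[OF PA Suc.prems(2)] Suc.IH[OF Suc.prems(1) QB] by (simp add: fps_deriv_trace_fps[OF K N])
    also have "\<dots> = fps_nth (fps_deriv (trace_fps P A * trace_fps Q B)) j"
      using Suc.prems A B by (simp add: fps_deriv_trace_fps add.commute)
    finally show ?case by (simp del: of_nat_Suc fps_deriv_mult)
  qed
qed

text \<open>The coefficients give a vanishing sum of \<open>a \<beta> * \<beta> ^ j\<close> for all
  \<open>j\<close>, hence of \<open>a \<beta> * q(\<beta>)\<close> for every polynomial
  \<open>q\<close>. A polynomial that vanishes at all other points of \<open>S\<close> isolates one
  term.\<close>

lemma fps_exp_independent:
  fixes a :: "'k::field_char_0 \<Rightarrow> 'k"
  assumes fin: "finite S" and sum: "(\<Sum>\<beta>\<in>S. fps_const (a \<beta>) * fps_exp \<beta>) = 0" and \<beta>: "\<beta> \<in> S"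
  shows "a \<beta> = 0"
proof -
  have pow: "(\<Sum>\<beta>\<in>S. a \<beta> * \<beta> ^ j) = 0" for j
  proof -
    have "(\<Sum>\<beta>\<in>S. a \<beta> * \<beta> ^ j / fact j) = 0"
      using arg_cong[OF sum, of "\<lambda>f. fps_nth f j"] by (simp add: fps_sum_nth)
    then show ?thesis by (simp flip: sum_divide_distrib)
  qed
  have poly: "(\<Sum>\<beta>\<in>S. a \<beta> * poly q \<beta>) = 0" for q
  proof -
    have "(\<Sum>\<beta>\<in>S. a \<beta> * poly q \<beta>) = (\<Sum>\<beta>\<in>S. \<Sum>j\<le>Polynomial.degree q. Polynomial.coeff q j * (a \<beta> * \<beta> ^ j))"
      by (simp add: poly_altdef sum_distrib_left algebra_simps)
    also have "\<dots> = (\<Sum>j\<le>Polynomial.degree q. Polynomial.coeff q j * (\<Sum>\<beta>\<in>S. a \<beta> * \<beta> ^ j))"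
      by (subst sum.swap) (simp add: sum_distrib_left)
    finally show ?thesis by (simp add: pow)
  qed
  define q where "q = (\<Prod>\<gamma>\<in>S - {\<beta>}. [:- \<gamma>, 1:])"
  have q0: "poly q \<gamma> = 0" if "\<gamma> \<in> S" "\<gamma> \<noteq> \<beta>" for \<gamma>
    using that fin by (auto simp: q_def poly_prod)
  have "poly q \<beta> \<noteq> 0" using fin by (auto simp: q_def poly_prod)
  moreover have "a \<beta> * poly q \<beta> = 0"
  proof -
    have "(\<Sum>\<gamma>\<in>S. a \<gamma> * poly q \<gamma>) = a \<beta> * poly q \<beta>"
      using fin \<beta> q0 by (subst sum.remove[OF fin \<beta>]) (auto intro: sum.neutral)
    then show ?thesis using poly[of q] by simp
  qed
  ultimately show ?thesis by simp
qed

section \<open>Modules over the Hopf-Ore extension\<close>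

context monomial_algebra
begin

lemma scalar_ses:
  assumes "ses U V W" "U \<in> fd_modules A" "V \<in> fd_modules A" "W \<in> fd_modules A" "b \<in> B"
    and sc: "act V b = k \<cdot>\<^sub>m 1\<^sub>m (fst V)"
  shows "act U b = k \<cdot>\<^sub>m 1\<^sub>m (fst U)" "act W b = k \<cdot>\<^sub>m 1\<^sub>m (fst W)"
proof -
  obtain S S' T T' where S: "S \<in> module_homs A U V" and T: "T \<in> module_homs A V W"
    and se: "split_exact (fst U) (fst V) (fst W) S S' T T'" using assms(1) unfolding ses_def by blast
  note s = se[unfolded split_exact_def]
  have c: "S \<in> carrier_mat (fst V) (fst U)" "S' \<in> carrier_mat (fst U) (fst V)"
    "T \<in> carrier_mat (fst W) (fst V)" "T' \<in> carrier_mat (fst V) (fst W)" using s by auto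
  note d = c[THEN carrier_matD(1)] c[THEN carrier_matD(2)]
    act_dim[OF assms(2,5)] act_dim[OF assms(4,5)]
  have e: "S' * S = 1\<^sub>m (fst U)" "T * T' = 1\<^sub>m (fst W)" using s by auto
  have "S * act U b = act V b * S"
    using S assms(5) module_homs_iff[OF assms(2,3)] by blast
  then have "S * act U b = k \<cdot>\<^sub>m S" by (simp add: sc smult_mult_dim d one_mult_dim)
  then have "S' * (S * act U b) = k \<cdot>\<^sub>m (S' * S)" by (simp add: smult_mult_dim d)
  then show "act U b = k \<cdot>\<^sub>m 1\<^sub>m (fst U)"
    by (simp add: mult_cancel_dim[OF e(1)] d e one_mult_dim)
  have "T * act V b = act W b * T"
    using T assms(5) module_homs_iff[OF assms(3,4)] by blast
  then have "act W b * T = k \<cdot>\<^sub>m T" by (simp add: sc smult_mult_dim d one_mult_dim)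
  then have "act W b * T * T' = k \<cdot>\<^sub>m (T * T')" by (simp add: smult_mult_dim d)
  then show "act W b = k \<cdot>\<^sub>m 1\<^sub>m (fst W)"
    by (simp add: mult_assoc_dim d e one_mult_dim)
qed

lemma scalar_dsum:
  assumes V: "V \<in> fd_modules A" and W: "W \<in> fd_modules A" and b: "b \<in> B"
    and sc: "act V b = k \<cdot>\<^sub>m 1\<^sub>m (fst V)" "act W b = k \<cdot>\<^sub>m 1\<^sub>m (fst W)"
  shows "act (dsum V W) b = k \<cdot>\<^sub>m 1\<^sub>m (fst (dsum V W))"
proof -
  define d e where "d = fst V" and "e = fst W"
  define S T where "S = incl1 d e" and "T = incl2 d e"
  have c: "S \<in> carrier_mat (d + e) d" "T \<in> carrier_mat (d + e) e"
    by (auto simp: S_def T_def incl1_def incl2_def)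
  have one: "S * transpose_mat S + T * transpose_mat T = 1\<^sub>m (d + e)"
    using split_exact_incl(1)[of d e] unfolding split_exact_def S_def T_def by blast
  have "act (dsum V W) b = S * act V b * transpose_mat S + T * act W b * transpose_mat T"
    using b by (simp add: dsum_def Let_def act_def d_def e_def S_def T_def)
  also have "\<dots> = k \<cdot>\<^sub>m (S * transpose_mat S) + k \<cdot>\<^sub>m (T * transpose_mat T)"
    unfolding sc using c by (simp add: smult_mult_dim one_mult_dim d_def[symmetric] e_def[symmetric])
  also have "\<dots> = k \<cdot>\<^sub>m (S * transpose_mat S + T * transpose_mat T)"
    by (rule add_smult_distrib_left_mat[symmetric, of _ "d + e" "d + e"]) (use c in auto)
  finally show ?thesis unfolding one by (simp add: dsum_def Let_def d_def e_def)
qed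

lemma scalar_zero_module: "b \<in> B \<Longrightarrow> act zero_module b = k \<cdot>\<^sub>m 1\<^sub>m (fst zero_module)"
  using act_carrier[OF zero_module(1)] by (intro eq_matI) (auto simp: zero_module(2))

end

text \<open>The condition \<open>M * act V b = K * M\<close> makes the kernel of \<open>M\<close>
  invariant. It covers central elements, with \<open>K = act V b\<close>, and also
  \<open>\<xi>\<close>, which passes \<open>g\<close> up to the factor \<open>\<chi> g\<close>.
  \<open>M \<noteq> 0\<close> makes the kernel proper, and the columns of \<open>Q\<close> make it
  nonzero.\<close>

lemma split_by_kernel:
  fixes A :: "('k::field_char_0, 'b) hopf_algebra"
  assumes "monomial_algebra A B op s e0" and V: "V \<in> fd_modules A"
    and M: "M \<in> carrier_mat (fst V) (fst V)" "M \<noteq> 0\<^sub>m (fst V) (fst V)"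
    and Q: "Q \<in> carrier_mat (fst V) q" "Q \<noteq> 0\<^sub>m (fst V) q" "M * Q = 0\<^sub>m (fst V) q"
    and comm: "\<And>b. b \<in> B \<Longrightarrow> \<exists>K\<in>carrier_mat (fst V) (fst V). M * act V b = K * M"
  obtains U W where "U \<in> fd_modules A" "W \<in> fd_modules A" "monomial_algebra.ses A U V W"
    "fst U < fst V" "fst W < fst V"
proof -
  interpret monomial_algebra A B op s e0 by fact
  obtain r L L' T T' where f: "L \<in> carrier_mat (fst V) r" "L' \<in> carrier_mat r (fst V)"
    "T \<in> carrier_mat r (fst V)" "T' \<in> carrier_mat (fst V) r" "M = L * T" "L' * L = 1\<^sub>m r" "T * T' = 1\<^sub>m r"
    by (rule full_rank_factorization[OF M(1)])
  note d = f(1-4)[THEN carrier_matD(1)] f(1-4)[THEN carrier_matD(2)]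
    Q(1)[THEN carrier_matD(1)] Q(1)[THEN carrier_matD(2)]
  obtain e S S' where K: "split_exact e (fst V) r S S' T T'"
    by (rule kernel_split_exact[OF f(3,4,7)])
  have Sc: "S \<in> carrier_mat (fst V) e" "S' \<in> carrier_mat e (fst V)" and TS: "T * S = 0\<^sub>m r e"
    and one: "S * S' + T' * T = 1\<^sub>m (fst V)"
    using K by (auto simp: split_exact_def)
  note Sd = Sc[THEN carrier_matD(1)] Sc[THEN carrier_matD(2)]
  have LM: "L' * (M * Z) = T * Z" if "dim_row Z = fst V" for Z
    using that by (simp add: f(5) d mult_assoc_dim mult_cancel_dim[OF f(6)] one_mult_dim)
  have "r > 0"
  proof (rule ccontr)
    assume "\<not> r > 0"
    then have "M = 0\<^sub>m (fst V) (fst V)"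
      unfolding f(5) using f(1,3) by (intro eq_matI) (auto simp: scalar_prod_def)
    with M(2) show False by simp
  qed
  moreover have "e > 0"
  proof (rule ccontr)
    assume "\<not> e > 0"
    then have "S * S' = 0\<^sub>m (fst V) (fst V)"
      using Sc by (intro eq_matI) (auto simp: scalar_prod_def)
    then have "T' * T = 1\<^sub>m (fst V)"
      using one f left_add_zero_mat[of "T' * T" "fst V" "fst V"] by simp
    then have "Q = T' * (L' * (M * Q))"
      by (simp add: LM d mult_cancel_dim one_mult_dim)
    also have "\<dots> = 0\<^sub>m (fst V) q"
      unfolding Q(3) right_mult_zero_mat[OF f(2)] right_mult_zero_mat[OF f(4)] ..
    finally show False using Q(2) by simp
  qed
  moreover have dim: "fst V = e + r" by (rule split_exact_dim[OF K])
  moreover have inv: "T * act V b * S = 0\<^sub>m r e" if b: "b \<in> B" for b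
  proof -
    obtain Kb where Kb: "Kb \<in> carrier_mat (fst V) (fst V)" "M * act V b = Kb * M"
      using comm[OF b] by blast
    note bd = act_dim[OF V b] Kb(1)[THEN carrier_matD(1)] Kb(1)[THEN carrier_matD(2)]
    have "T * act V b * S = L' * ((M * act V b) * S)"
      using M(1) by (simp add: bd Sd d mult_assoc_dim LM)
    also have "(M * act V b) * S = Kb * (L * (T * S))"
      unfolding Kb(2) by (simp add: f(5) bd Sd d mult_assoc_dim)
    also have "L' * \<dots> = 0\<^sub>m r e"
      unfolding TS right_mult_zero_mat[OF f(1)] right_mult_zero_mat[OF Kb(1)] right_mult_zero_mat[OF f(2)] ..
    finally show ?thesis .
  qed
  note sub = sub_quotient_modules[OF V K inv]
  show thesis
    by (rule that[OF sub]) (use calculation in auto)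
qed

lemma pow_mat_add:
  assumes "A \<in> carrier_mat n n"
  shows "A ^\<^sub>m (i + j) = A ^\<^sub>m i * A ^\<^sub>m j"
proof (induction j)
  case 0
  show ?case using assms right_mult_one_mat[OF pow_carrier_mat[OF assms, of i]] by simp
next
  case (Suc j)
  then show ?case
    using assoc_mult_mat[OF pow_carrier_mat[OF assms, of i] pow_carrier_mat[OF assms, of j] assms] by simp
qed

lemma pow_mat_mult:
  assumes "A \<in> carrier_mat n n"
  shows "(A ^\<^sub>m i) ^\<^sub>m j = A ^\<^sub>m (i * j)"
  using assms by (induction j) (auto simp: pow_mat_add add.commute[of i])

declare One_nat_def [simp del]

text \<open>The facts on \<open>(D, \<chi>, a^m)\<close> that the argument rests on.
  \<open>chi_square\<close> makes \<open>\<xi>^2\<close> central, \<open>c_square\<close> and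
  \<open>chi_c\<close> make it primitive, and \<open>c_central\<close> makes the eigenspaces of
  \<open>c\<close> stable under the group.\<close>

locale hopf_ore_extension = group G for G :: "('g, 'z) monoid_scheme" (structure) +
  fixes \<chi> :: "'g \<Rightarrow> 'k::{alg_closed_field, field_char_0}" and c :: 'g
  assumes finite_G: "finite (carrier G)"
    and chi_mult: "g \<in> carrier G \<Longrightarrow> h \<in> carrier G \<Longrightarrow> \<chi> (g \<otimes> h) = \<chi> g * \<chi> h"
    and chi_square: "g \<in> carrier G \<Longrightarrow> \<chi> g * \<chi> g = 1"
    and c_closed: "c \<in> carrier G" and c_square: "c \<otimes> c = \<one>" and chi_c: "\<chi> c = -1"
    and c_central: "g \<in> carrier G \<Longrightarrow> c \<otimes> g = g \<otimes> c"
begin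

lemma chi_one: "\<chi> \<one> = 1"
  using chi_mult[of \<one> \<one>] chi_square[of \<one>] by simp

definition op :: "'g \<times> nat \<Rightarrow> 'g \<times> nat \<Rightarrow> 'g \<times> nat" where
  "op = (\<lambda>(g, i) (h, j). (g \<otimes> h, i + j))"

definition coef :: "'g \<times> nat \<Rightarrow> 'g \<times> nat \<Rightarrow> 'k" where
  "coef = (\<lambda>(g, i) (h, j). \<chi> h ^ i)"

lemma op_simps [simp]: "op (g, i) (h, j) = (g \<otimes> h, i + j)" "coef (g, i) (h, j) = \<chi> h ^ i"
  by (simp_all add: op_def coef_def)

abbreviation "H \<equiv> hopf_ore G \<chi> c"
abbreviation "B \<equiv> carrier G \<times> (UNIV :: nat set)"

lemma ore_mult_eq: "ore_mult G \<chi> = (\<lambda>x y. Poly_Mapping.single (op x y) (coef x y))"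
  by (auto simp: ore_mult_def op_def coef_def fun_eq_iff split: prod.splits)

lemma H_simps:
  "carrier H = {f. Poly_Mapping.keys f \<subseteq> B}"
  "monoid.mult H = bilin (\<lambda>x y. Poly_Mapping.single (op x y) (coef x y))"
  "one H = bas (\<one>, 0)" "add H = (+)" "smult H = scl"
  "counit H = (\<lambda>f. \<Sum>(g, i)\<in>Poly_Mapping.keys f. Poly_Mapping.lookup f (g, i) * 0 ^ i)"
  by (simp_all add: hopf_ore_def Let_def module.defs ore_algebra_def based_algebra_def ore_mult_eq)

sublocale H: monomial_algebra "hopf_ore G \<chi> c" "carrier G \<times> UNIV" op coef "(\<one>, 0)"
  by unfold_locales (auto simp: H_simps)

sublocale D: separating_characters "group_algebra G :: ('k, 'g) hopf_algebra" "carrier G" "monoid.mult G"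
  "\<lambda>_ _. 1" \<one> "carrier G" "\<lambda>g V. mtr (act V g)"
  by (rule separating_group_characters) (unfold_locales, rule finite_G)

text \<open>An \<open>H\<close>-module is a representation \<open>\<gamma>\<close> of the group
  together with a matrix \<open>Z\<close> for \<open>\<xi>\<close> subject to the single relation
  \<open>comm\<close>; on the basis the action is then forced.\<close>

lemma representation_module:
  assumes \<gamma>: "\<And>g. g \<in> carrier G \<Longrightarrow> \<gamma> g \<in> carrier_mat d d"
    and mult: "\<And>g h. g \<in> carrier G \<Longrightarrow> h \<in> carrier G \<Longrightarrow> \<gamma> g * \<gamma> h = \<gamma> (g \<otimes> h)"
    and one: "\<gamma> \<one> = 1\<^sub>m d"
    and Z: "Z \<in> carrier_mat d d"
    and comm: "\<And>g. g \<in> carrier G \<Longrightarrow> Z * \<gamma> g = \<chi> g \<cdot>\<^sub>m (\<gamma> g * Z)"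
  defines "V \<equiv> (d, \<lambda>f\<in>carrier H. extm d (\<lambda>(g, i). \<gamma> g * Z ^\<^sub>m i) f)"
  shows "V \<in> fd_modules H" and "g \<in> carrier G \<Longrightarrow> act V (g, i) = \<gamma> g * Z ^\<^sub>m i"
proof -
  note Zd = Z[THEN carrier_matD(1)] Z[THEN carrier_matD(2)]
  have gd: "dim_row (\<gamma> g) = d" "dim_col (\<gamma> g) = d" if "g \<in> carrier G" for g
    using \<gamma>[OF that] by auto
  have Zp: "dim_row (Z ^\<^sub>m i) = d" "dim_col (Z ^\<^sub>m i) = d" for i
    using pow_carrier_mat[OF Z, of i] by auto
  have comm_pow: "Z ^\<^sub>m i * \<gamma> g = \<chi> g ^ i \<cdot>\<^sub>m (\<gamma> g * Z ^\<^sub>m i)" if g: "g \<in> carrier G" for g i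
  proof (induction i)
    case 0
    then show ?case using Zd by (simp add: one_mult_dim gd[OF g] one_smult_mat)
  next
    case (Suc i)
    have "Z ^\<^sub>m Suc i * \<gamma> g = Z ^\<^sub>m i * (Z * \<gamma> g)"
      by (simp add: mult_assoc_dim Zp Zd gd[OF g])
    also have "\<dots> = \<chi> g \<cdot>\<^sub>m ((Z ^\<^sub>m i * \<gamma> g) * Z)"
      unfolding comm[OF g] by (simp add: smult_mult_dim mult_assoc_dim Zp Zd gd[OF g])
    also have "\<dots> = \<chi> g ^ Suc i \<cdot>\<^sub>m (\<gamma> g * Z ^\<^sub>m Suc i)"
      unfolding Suc by (simp add: smult_mult_dim mult_assoc_dim Zp Zd gd[OF g] smult_smult_mat)
    finally show ?case .
  qed
  have c: "\<And>b. b \<in> B \<Longrightarrow> (case b of (g, i) \<Rightarrow> \<gamma> g * Z ^\<^sub>m i) \<in> carrier_mat d d"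
    using mult_carrier_mat[OF \<gamma> pow_carrier_mat[OF Z]] by auto
  show "V \<in> fd_modules H"
    unfolding V_def
  proof (rule H.fd_modulesI[OF c])
    fix x y assume "x \<in> B" "y \<in> B"
    then obtain g i h j where xy: "x = (g, i)" "y = (h, j)" and gh: "g \<in> carrier G" "h \<in> carrier G" by auto
    have "(\<gamma> g * Z ^\<^sub>m i) * (\<gamma> h * Z ^\<^sub>m j) = \<gamma> g * ((Z ^\<^sub>m i * \<gamma> h) * Z ^\<^sub>m j)"
      by (simp add: mult_assoc_dim Zp Zd gd gh)
    also have "\<dots> = \<chi> h ^ i \<cdot>\<^sub>m ((\<gamma> g * \<gamma> h) * Z ^\<^sub>m (i + j))"
      unfolding comm_pow[OF gh(2)] pow_mat_add[OF Z] by (simp add: smult_mult_dim mult_assoc_dim Zp Zd gd gh)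
    finally show "(case x of (g, i) \<Rightarrow> \<gamma> g * Z ^\<^sub>m i) * (case y of (g, i) \<Rightarrow> \<gamma> g * Z ^\<^sub>m i) =
        coef x y \<cdot>\<^sub>m (case op x y of (g, i) \<Rightarrow> \<gamma> g * Z ^\<^sub>m i)"
      by (simp add: xy mult gh)
  qed (use Z in \<open>auto simp: one\<close>)
  show "act V (g, i) = \<gamma> g * Z ^\<^sub>m i" if "g \<in> carrier G"
    unfolding V_def by (subst act_extm_module) (use that c[of "(g, i)"] in auto)
qed

lemma act_xi:
  assumes V: "V \<in> fd_modules H" and g: "g \<in> carrier G"
  shows "act V (g, i) = act V (g, 0) * act V (\<one>, 1) ^\<^sub>m i"
    and "act V (\<one>, 1) * act V (g, 0) = \<chi> g \<cdot>\<^sub>m (act V (g, 0) * act V (\<one>, 1))"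
proof -
  have one: "act V (\<one>, i) = act V (\<one>, 1) ^\<^sub>m i" for i
  proof (induction i)
    case 0
    show ?case using H.act_one[OF V] H.act_dim[OF V, of "(\<one>, 1)"] by simp
  next
    case (Suc i)
    then show ?case
      using H.act_mult[OF V, of "(\<one>, i)" "(\<one>, 1)"] by (simp add: chi_one one_smult_mat flip: Suc_eq_plus1)
  qed
  have "act V (g, 0) * act V (\<one>, i) = coef (g, 0) (\<one>, i) \<cdot>\<^sub>m act V (op (g, 0) (\<one>, i))" for i
    by (rule H.act_mult[OF V]) (use g in auto)
  then have "act V (g, 0) * act V (\<one>, i) = act V (g, i)" for i
    using g by (simp only: op_simps one_smult_mat power_0 r_one add_0)
  from this[of i] show "act V (g, i) = act V (g, 0) * act V (\<one>, 1) ^\<^sub>m i" by (simp only: one[of i])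
  show "act V (\<one>, 1) * act V (g, 0) = \<chi> g \<cdot>\<^sub>m (act V (g, 0) * act V (\<one>, 1))"
    using H.act_mult[OF V, of "(g, 0)" "(\<one>, 1)"] H.act_mult[OF V, of "(\<one>, 1)" "(g, 0)"] g
    by (simp add: one_smult_mat)
qed

section \<open>Tensor products of modules over the Hopf-Ore extension\<close>

abbreviation "HH \<equiv> ore_tensor_square G \<chi>"

lemma tens_single: "tens (Poly_Mapping.single x k) (Poly_Mapping.single y l) = Poly_Mapping.single (x, y) (k * l)"
  by (simp add: tens_def bilin_single scl_simps)

lemma HH_simps:
  "monoid.mult HH = bilin (\<lambda>x y. Poly_Mapping.single (op (fst x) (fst y), op (snd x) (snd y))
     (coef (fst x) (fst y) * coef (snd x) (snd y)))"
  "one HH = bas ((\<one>, 0), (\<one>, 0))"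
  by (simp_all add: ore_tensor_square_def tensor_square_algebra_def based_algebra_def ore_mult_eq tens_single
      case_prod_unfold)

lemma comult_H: "comult H = lin (\<lambda>(g, i). bas ((g, 0), (g, 0)) \<otimes>\<^bsub>HH\<^esub>
    ((bas ((\<one>, 1), (c, 0)) + bas ((\<one>, 0), (\<one>, 1))) [^]\<^bsub>HH\<^esub> i))"
  by (simp add: hopf_ore_def Let_def module.defs tens_single)

lemma tensor_module_H:
  assumes V: "V \<in> fd_modules H" and W: "W \<in> fd_modules H"
  shows "tensor_module H V W \<in> fd_modules H"
    and "g \<in> carrier G \<Longrightarrow> act (tensor_module H V W) (g, 0) = kron (act V (g, 0)) (act W (g, 0))"
    and "act (tensor_module H V W) (\<one>, 2) =
      kron (act V (\<one>, 2)) (1\<^sub>m (fst W)) + kron (1\<^sub>m (fst V)) (act W (\<one>, 2))"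
proof -
  let ?n = "fst V * fst W" and ?K = "kron_act V W"
  define \<gamma> where "\<gamma> g = kron (act V (g, 0)) (act W (g, 0))" for g
  \<comment> \<open>\<open>P\<close> and \<open>Q\<close> are the actions of
    \<open>\<xi> \<otimes> c\<close> and \<open>1 \<otimes> \<xi>\<close>, so \<open>Z\<close> is
    that of \<open>\<Delta>(\<xi>)\<close>.\<close>
  define P Q where "P = kron (act V (\<one>, 1)) (act W (c, 0))"
    and "Q = kron (1\<^sub>m (fst V)) (act W (\<one>, 1))"
  define Z where "Z = P + Q"
  have Vd: "dim_row (act V b) = fst V" "dim_col (act V b) = fst V"
      "dim_row (act W b) = fst W" "dim_col (act W b) = fst W" if "b \<in> B" for b
    using H.act_dim[OF V that] H.act_dim[OF W that] by auto
  have PQ: "P \<in> carrier_mat ?n ?n" "Q \<in> carrier_mat ?n ?n"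
    unfolding P_def Q_def using c_closed by (auto intro!: kron_carrier H.act_carrier V W)
  note PQd = PQ[THEN carrier_matD(1)] PQ[THEN carrier_matD(2)]
  have Z: "Z \<in> carrier_mat ?n ?n" using PQ by (simp add: Z_def)
  have Kc: "?K x \<in> carrier_mat ?n ?n" if "x \<in> B \<times> B" for x
    using that by (auto simp: kron_act_def intro!: kron_carrier H.act_carrier V W)
  have \<gamma>c: "\<gamma> g \<in> carrier_mat ?n ?n" if "g \<in> carrier G" for g
    unfolding \<gamma>_def using that by (auto intro!: kron_carrier H.act_carrier V W)
  have KK: "?K x * ?K y = extm ?n ?K (Poly_Mapping.single (op (fst x) (fst y), op (snd x) (snd y))
     (coef (fst x) (fst y) * coef (snd x) (snd y)))" if xy: "x \<in> B \<times> B" "y \<in> B \<times> B" for x y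
  proof -
    have o: "(op (fst x) (fst y), op (snd x) (snd y)) \<in> B \<times> B"
      using xy by (auto simp: op_def split: prod.splits)
    have "?K x * ?K y = kron (act V (fst x) * act V (fst y)) (act W (snd x) * act W (snd y))"
      using xy by (auto simp: kron_act_def Vd kron_mult)
    also have "\<dots> = (coef (fst x) (fst y) * coef (snd x) (snd y)) \<cdot>\<^sub>m ?K (op (fst x) (fst y), op (snd x) (snd y))"
      using xy H.act_mult[OF V, of "fst x" "fst y"] H.act_mult[OF W, of "snd x" "snd y"]
      by (auto simp: kron_act_def kron_smult_left kron_smult_right smult_smult_mat mult.commute)
    finally show ?thesis using extm_single[of ?K _ ?n, OF Kc[OF o]] by simp
  qed
  have mult: "extm ?n ?K (u \<otimes>\<^bsub>HH\<^esub> v) = extm ?n ?K u * extm ?n ?K v"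
    if "Poly_Mapping.keys u \<subseteq> B \<times> B" "Poly_Mapping.keys v \<subseteq> B \<times> B" for u v
    unfolding HH_simps by (rule extm_bilin[where B = "B \<times> B"]) (use Kc KK that in auto)
  define \<Delta> :: "('g \<times> nat) \<times> ('g \<times> nat) \<Rightarrow>\<^sub>0 'k"
    where "\<Delta> = bas ((\<one>, 1), (c, 0)) + bas ((\<one>, 0), (\<one>, 1))"
  have \<Delta>k: "Poly_Mapping.keys \<Delta> \<subseteq> B \<times> B"
    unfolding \<Delta>_def by (rule order.trans[OF keys_add]) (use c_closed in \<open>auto simp: keys_single\<close>)
  have \<Delta>Z: "extm ?n ?K \<Delta> = Z"
    unfolding \<Delta>_def extm_add using c_closed Kc[of "((\<one>, 1), (c, 0))"] Kc[of "((\<one>, 0), (\<one>, 1))"]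
    by (simp add: extm_single one_smult_mat Z_def P_def Q_def kron_act_def H.act_one[OF V])
  have pow: "Poly_Mapping.keys (\<Delta> [^]\<^bsub>HH\<^esub> i) \<subseteq> B \<times> B \<and> extm ?n ?K (\<Delta> [^]\<^bsub>HH\<^esub> i) = Z ^\<^sub>m i" for i :: nat
  proof (induction i)
    case 0
    have "?K ((\<one>, 0), (\<one>, 0)) = 1\<^sub>m ?n"
      by (simp add: kron_act_def H.act_one[OF V] H.act_one[OF W] kron_one)
    then show ?case using Z by (simp add: nat_pow_def HH_simps keys_single extm_single one_smult_mat)
  next
    case (Suc i)
    have *: "\<Delta> [^]\<^bsub>HH\<^esub> Suc i = \<Delta> [^]\<^bsub>HH\<^esub> i \<otimes>\<^bsub>HH\<^esub> \<Delta>" by (simp add: nat_pow_def)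
    have "Poly_Mapping.keys (\<Delta> [^]\<^bsub>HH\<^esub> i \<otimes>\<^bsub>HH\<^esub> \<Delta>) \<subseteq> B \<times> B"
      unfolding HH_simps by (rule keys_bilin_single) (use Suc \<Delta>k in \<open>auto simp: op_def split: prod.splits\<close>)
    then show ?case using Suc mult[OF _ \<Delta>k, of "\<Delta> [^]\<^bsub>HH\<^esub> i"] by (simp add: * \<Delta>Z)
  qed
  have eq: "tensor_module H V W = (?n, \<lambda>f\<in>carrier H. extm ?n (\<lambda>(g, i). \<gamma> g * Z ^\<^sub>m i) f)"
    unfolding tensor_module_extm
  proof (rule arg_cong[of _ _ "Pair ?n"], rule restrict_ext)
    fix f assume f: "f \<in> carrier H"
    show "extm ?n ?K (comult H f) = extm ?n (\<lambda>(g, i). \<gamma> g * Z ^\<^sub>m i) f"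
      unfolding comult_H \<Delta>_def[symmetric]
    proof (rule extm_lin)
      fix b assume "b \<in> Poly_Mapping.keys f"
      then obtain g i where b: "b = (g, i)" "g \<in> carrier G" using f by (cases b) (auto simp: H_simps)
      have "extm ?n ?K (bas ((g, 0), (g, 0)) \<otimes>\<^bsub>HH\<^esub> \<Delta> [^]\<^bsub>HH\<^esub> i) = \<gamma> g * Z ^\<^sub>m i"
        using b(2) pow[of i] mult[of "bas ((g, 0), (g, 0))" "\<Delta> [^]\<^bsub>HH\<^esub> i"] Kc[of "((g, 0), (g, 0))"]
        by (simp add: keys_single extm_single one_smult_mat) (simp add: kron_act_def \<gamma>_def)
      then show "extm ?n ?K (case b of (g, i) \<Rightarrow> bas ((g, 0), (g, 0)) \<otimes>\<^bsub>HH\<^esub> \<Delta> [^]\<^bsub>HH\<^esub> i) =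
          (case b of (g, i) \<Rightarrow> \<gamma> g * Z ^\<^sub>m i)" using b by simp
    qed
  qed
  have Vm: "act V (g, 0) * act V (h, 0) = act V (g \<otimes> h, 0)" "act W (g, 0) * act W (h, 0) = act W (g \<otimes> h, 0)"
    if "g \<in> carrier G" "h \<in> carrier G" for g h
    using H.act_mult[OF V, of "(g, 0)" "(h, 0)"] H.act_mult[OF W, of "(g, 0)" "(h, 0)"] that
    by (simp_all add: one_smult_mat)
  have comm: "Z * \<gamma> g = \<chi> g \<cdot>\<^sub>m (\<gamma> g * Z)" if g: "g \<in> carrier G" for g
  proof -
    \<comment> \<open>In \<open>P\<close> the scalar \<open>\<chi> g\<close> arises in the first
      factor, while the central \<open>c\<close> passes \<open>g\<close> in the second; in
      \<open>Q\<close> it arises in the second factor.\<close>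
    have "P * \<gamma> g = \<chi> g \<cdot>\<^sub>m (\<gamma> g * P)"
      unfolding P_def \<gamma>_def using g c_closed
      by (simp add: kron_mult Vd act_xi(2)[OF V g] Vm c_central kron_smult_left)
    moreover have "Q * \<gamma> g = \<chi> g \<cdot>\<^sub>m (\<gamma> g * Q)"
      unfolding Q_def \<gamma>_def using g c_closed
      by (simp add: kron_mult Vd act_xi(2)[OF W g] kron_smult_right one_mult_dim)
    ultimately show ?thesis
      using \<gamma>c[OF g] PQ add_smult_distrib_left_mat[of "\<gamma> g * P" ?n ?n "\<gamma> g * Q" "\<chi> g"]
      by (simp add: Z_def add_mult_dim PQd carrier_matD[OF \<gamma>c[OF g]])
  qed
  have rep: "\<gamma> g * \<gamma> h = \<gamma> (g \<otimes> h)" if "g \<in> carrier G" "h \<in> carrier G" for g h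
    using that by (simp add: \<gamma>_def kron_mult Vd Vm)
  have one: "\<gamma> \<one> = 1\<^sub>m ?n"
    by (simp add: \<gamma>_def H.act_one[OF V] H.act_one[OF W] kron_one)
  have R: "tensor_module H V W \<in> fd_modules H"
    "\<And>g i. g \<in> carrier G \<Longrightarrow> act (tensor_module H V W) (g, i) = \<gamma> g * Z ^\<^sub>m i"
    unfolding eq by (rule representation_module[where \<gamma> = \<gamma> and d = ?n and Z = Z]; simp add: \<gamma>c rep one Z comm)+
  show "tensor_module H V W \<in> fd_modules H" by (rule R(1))
  show "act (tensor_module H V W) (g, 0) = kron (act V (g, 0)) (act W (g, 0))" if "g \<in> carrier G"
    using R(2)[OF that, of 0] \<gamma>c[OF that] right_mult_one_mat[OF \<gamma>c[OF that]] Z by (simp add: \<gamma>_def)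
  have sq: "act V (\<one>, 2) = act V (\<one>, 1) * act V (\<one>, 1)" "act W (\<one>, 2) = act W (\<one>, 1) * act W (\<one>, 1)"
    using H.act_mult[OF V, of "(\<one>, 1)" "(\<one>, 1)"] H.act_mult[OF W, of "(\<one>, 1)" "(\<one>, 1)"]
    by (simp_all add: chi_one one_smult_mat numeral_2_eq_2)
  have "Z ^\<^sub>m 2 = Z * Z" using Z by (simp add: numeral_2_eq_2)
  also have "\<dots> = P * P + Q * P + (P * Q + Q * Q)"
    by (simp add: Z_def add_mult_dim PQd)
  also have "P * P = kron (act V (\<one>, 2)) (1\<^sub>m (fst W))"
    unfolding P_def using c_closed by (simp add: kron_mult Vd sq Vm c_square H.act_one[OF W])
  also have "Q * Q = kron (1\<^sub>m (fst V)) (act W (\<one>, 2))"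
    unfolding Q_def by (simp add: kron_mult Vd sq one_mult_dim)
  \<comment> \<open>Moving \<open>\<xi>\<close> past \<open>c\<close> in the second tensor factor
    costs \<open>\<chi> c = -1\<close>, so the mixed terms of \<open>Z * Z\<close> cancel.\<close>
  also have "Q * P = (-1) \<cdot>\<^sub>m (P * Q)"
    unfolding P_def Q_def using c_closed
    by (simp add: kron_mult Vd act_xi(2)[OF W] one_mult_dim chi_c kron_smult_right)
  finally have "Z ^\<^sub>m 2 = kron (act V (\<one>, 2)) (1\<^sub>m (fst W)) + (-1) \<cdot>\<^sub>m (P * Q) +
      (P * Q + kron (1\<^sub>m (fst V)) (act W (\<one>, 2)))" .
  also have "\<dots> = kron (act V (\<one>, 2)) (1\<^sub>m (fst W)) + kron (1\<^sub>m (fst V)) (act W (\<one>, 2))"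
    using PQ by (intro eq_matI) (auto simp: Vd simp del: index_mult_mat(1))
  finally show "act (tensor_module H V W) (\<one>, 2) =
      kron (act V (\<one>, 2)) (1\<^sub>m (fst W)) + kron (1\<^sub>m (fst V)) (act W (\<one>, 2))"
    using R(2)[OF one_closed, of 2] left_mult_one_mat[OF pow_carrier_mat[OF Z, of 2]] by (simp add: one)
qed

definition ch :: "'g \<Rightarrow> ('k, 'g \<times> nat) matrix_module \<Rightarrow> 'k fps" where
  "ch g V = trace_fps (act V (g, 0)) (act V (\<one>, 2))"

lemma act_even:
  assumes V: "V \<in> fd_modules H" and g: "g \<in> carrier G"
  shows "act V (g, 2 * j) = act V (g, 0) * act V (\<one>, 2) ^\<^sub>m j"
proof -
  have Z: "act V (\<one>, 1) \<in> carrier_mat (fst V) (fst V)" by (rule H.act_carrier[OF V]) simp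
  have "act V (\<one>, 2) = act V (\<one>, 1) ^\<^sub>m 2"
    unfolding act_xi(1)[OF V one_closed, of 2] H.act_one[OF V] by (rule left_mult_one_mat[OF pow_carrier_mat[OF Z]])
  then show ?thesis using act_xi(1)[OF V g, of "2 * j"] by (simp add: pow_mat_mult[OF Z])
qed

text \<open>Each coefficient is, up to a factorial, the trace of one algebra element, and additivity
  on exact sequences is known for such traces.\<close>

lemma ch_nth:
  assumes "V \<in> fd_modules H" "g \<in> carrier G"
  shows "fps_nth (ch g V) j = mtr (act V (g, 2 * j)) / fact j"
  by (simp add: ch_def trace_fps_def act_even[OF assms])

lemma ch_tensor:
  assumes V: "V \<in> fd_modules H" and W: "W \<in> fd_modules H" and g: "g \<in> carrier G"
  shows "ch g (tensor_module H V W) = ch g V * ch g W"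
  unfolding ch_def tensor_module_H(2)[OF V W g] tensor_module_H(3)[OF V W]
  by (rule trace_fps_kron) (use g in \<open>auto intro!: H.act_carrier V W\<close>)

lemma ch_ses:
  assumes "H.ses U V W" "U \<in> fd_modules H" "V \<in> fd_modules H" "W \<in> fd_modules H" "g \<in> carrier G"
  shows "ch g V = ch g U + ch g W"
  by (rule fps_ext)
    (use assms H.mtr_ses[OF assms(1-4)] in \<open>simp add: ch_nth act_def add_divide_distrib\<close>)

lemma trivial_module_H:
  "trivial_module H \<in> fd_modules H" "g \<in> carrier G \<Longrightarrow> ch g (trivial_module H) = 1"
proof -
  have one: "(1\<^sub>m 1 :: 'k mat) * (0\<^sub>m 1 1) ^\<^sub>m i = mat 1 1 (\<lambda>_. 0 ^ i)" for i
    by (induction i) (auto intro!: eq_matI simp: scalar_prod_def)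
  have eq: "trivial_module H = (1, \<lambda>f\<in>carrier H. extm 1 (\<lambda>(g, i). 1\<^sub>m 1 * (0\<^sub>m 1 1) ^\<^sub>m i) f)"
    unfolding trivial_module_def H_simps(6)
    by (intro arg_cong[of _ _ "Pair 1"] restrict_ext eq_matI)
      (auto simp: extm_def ev.ext_def one case_prod_unfold simp del: One_nat_def)
  have R: "trivial_module H \<in> fd_modules H"
    "g \<in> carrier G \<Longrightarrow> act (trivial_module H) (g, i) = 1\<^sub>m 1 * (0\<^sub>m 1 1) ^\<^sub>m i" for g i
    unfolding eq by (rule representation_module; auto intro!: eq_matI)+
  show "trivial_module H \<in> fd_modules H" by (rule R(1))
  show "ch g (trivial_module H) = 1" if "g \<in> carrier G"
    by (rule fps_ext) (auto simp: ch_nth[OF R(1) that] R(2)[OF that] one mtr_def)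
qed


text \<open>\<open>\<xi>\<^sup>2\<close> is central, so it acts on a simple module by a scalar \<open>\<beta>\<close>. If \<open>\<beta> = 0\<close>, then \<open>\<xi>\<close> itself
  acts by zero.\<close>

definition homogeneous :: "'k \<Rightarrow> ('k, 'g \<times> nat) matrix_module \<Rightarrow> bool" where
  "homogeneous \<beta> V \<longleftrightarrow> V \<in> fd_modules H \<and>
     act V (\<one>, if \<beta> = 0 then 1 else 2) = \<beta> \<cdot>\<^sub>m 1\<^sub>m (fst V)"

lemma homogeneous_ses:
  assumes "homogeneous \<beta> V" "H.ses U V W" "U \<in> fd_modules H" "W \<in> fd_modules H"
  shows "homogeneous \<beta> U \<and> homogeneous \<beta> W"
  using assms H.scalar_ses[OF assms(2,3) _ assms(4)] unfolding homogeneous_def by auto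

lemma homogeneous_dsum: "homogeneous \<beta> V \<Longrightarrow> homogeneous \<beta> W \<Longrightarrow> homogeneous \<beta> (H.dsum V W)"
  unfolding homogeneous_def using H.dsum(1) H.scalar_dsum by auto

lemma homogeneous_zero: "homogeneous \<beta> H.zero_module"
  unfolding homogeneous_def using H.zero_module(1) H.scalar_zero_module by auto

lemma smult_one_pow: "(k \<cdot>\<^sub>m 1\<^sub>m d) ^\<^sub>m j = k ^ j \<cdot>\<^sub>m (1\<^sub>m d :: 'k mat)"
  by (induction j) (auto simp: one_smult_mat smult_mult_dim smult_smult_mat)

lemma homogeneous_act_square:
  assumes "homogeneous \<beta> V"
  shows "act V (\<one>, 2) = \<beta> \<cdot>\<^sub>m 1\<^sub>m (fst V)"
proof (cases "\<beta> = 0")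
  case True
  have V: "V \<in> fd_modules H" and "act V (\<one>, 1) = 0 \<cdot>\<^sub>m 1\<^sub>m (fst V)"
    using assms True by (auto simp: homogeneous_def)
  then have "act V (\<one>, 2) = 1\<^sub>m (fst V) * (0 ^ 2 \<cdot>\<^sub>m 1\<^sub>m (fst V))"
    using act_xi(1)[OF V one_closed, of 2] by (simp only: H.act_one[OF V] smult_one_pow)
  then show ?thesis using True by simp
qed (use assms in \<open>auto simp: homogeneous_def\<close>)

lemma homogeneous_ch:
  assumes "homogeneous \<beta> V" "g \<in> carrier G"
  shows "ch g V = fps_const (mtr (act V (g, 0))) * fps_exp \<beta>"
proof (rule fps_ext)
  fix j
  have V: "V \<in> fd_modules H" using assms by (simp add: homogeneous_def)
  have b: "(g, 0) \<in> B" using assms by simp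
  have "act V (g, 2 * j) = \<beta> ^ j \<cdot>\<^sub>m act V (g, 0)"
    unfolding act_even[OF V assms(2)] homogeneous_act_square[OF assms(1)] smult_one_pow
    by (simp add: smult_mult_dim H.act_dim[OF V b] one_mult_dim)
  then show "fps_nth (ch g V) j = fps_nth (fps_const (mtr (act V (g, 0))) * fps_exp \<beta>) j"
    by (simp add: ch_nth[OF V assms(2)] mtr_smult[OF H.act_carrier[OF V b]])
qed

definition res :: "('k, 'g \<times> nat) matrix_module \<Rightarrow> ('k, 'g) matrix_module" where
  "res V = (fst V, \<lambda>f\<in>carrier (group_algebra G). extm (fst V) (\<lambda>g. act V (g, 0)) f)"

lemma act_group:
  assumes V: "V \<in> fd_modules H" and "g \<in> carrier G" "h \<in> carrier G"
  shows "act V (g, 0) * act V (h, 0) = act V (g \<otimes> h, 0)"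
  using H.act_mult[OF V, of "(g, 0)" "(h, 0)"] assms by (simp add: one_smult_mat)

lemma res:
  assumes V: "V \<in> fd_modules H"
  shows "res V \<in> fd_modules (group_algebra G)" "g \<in> carrier G \<Longrightarrow> act (res V) g = act V (g, 0)"
    "fst (res V) = fst V"
proof -
  have c: "act V (g, 0) \<in> carrier_mat (fst V) (fst V)" if "g \<in> carrier G" for g
    by (rule H.act_carrier[OF V]) (use that in simp)
  show "res V \<in> fd_modules (group_algebra G)"
    unfolding res_def
    by (rule D.fd_modulesI) (auto simp: c act_group[OF V] one_smult_mat H.act_one[OF V])
  show "act (res V) g = act V (g, 0)" if "g \<in> carrier G"
    unfolding res_def by (rule act_extm_module) (use that c in auto)
qed (simp add: res_def)

text \<open>A \<open>kG\<close>-linear map \<open>T\<close> becomes \<open>H\<close>-linear by averaging over \<open>\<xi>\<close>. The average may vanish, but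
  for one of the two eigenspaces of \<open>c\<close> the average of the restriction of \<open>T\<close> does not, because
  \<open>\<xi>\<close> exchanges them.\<close>

lemma homogeneous_hom:
  assumes V: "homogeneous \<beta> V" and W: "homogeneous \<beta> W" and pos: "fst V > 0"
    and tr: "\<forall>g\<in>carrier G. mtr (act V (g, 0)) = mtr (act W (g, 0))"
  shows "\<exists>T\<in>module_homs H V W. T \<noteq> 0\<^sub>m (fst W) (fst V)"
proof -
  have Vm: "V \<in> fd_modules H" and Wm: "W \<in> fd_modules H" using V W by (auto simp: homogeneous_def)
  have "\<exists>T\<in>module_homs (group_algebra G) (res V) (res W). T \<noteq> 0\<^sub>m (fst (res W)) (fst (res V))"
    by (rule nonzero_hom_of_equal_traces) (use finite_G res Vm Wm pos tr group_axioms in auto)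
  then obtain T where T: "T \<in> carrier_mat (fst W) (fst V)" "T \<noteq> 0\<^sub>m (fst W) (fst V)"
    and Tg: "\<And>g. g \<in> carrier G \<Longrightarrow> T * act V (g, 0) = act W (g, 0) * T"
    using D.module_homs_iff[OF res(1)[OF Vm] res(1)[OF Wm]] by (auto simp: res Vm Wm)
  define Z Y where "Z = act V (\<one>, 1)" and "Y = act W (\<one>, 1)"
  have Zc: "Z \<in> carrier_mat (fst V) (fst V)" and Yc: "Y \<in> carrier_mat (fst W) (fst W)"
    unfolding Z_def Y_def using H.act_carrier Vm Wm by auto
  have Vg: "act V (g, 0) \<in> carrier_mat (fst V) (fst V)" "act W (g, 0) \<in> carrier_mat (fst W) (fst W)"
    if "g \<in> carrier G" for g using H.act_carrier Vm Wm that by auto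
  note d = T(1)[THEN carrier_matD(1)] T(1)[THEN carrier_matD(2)] Zc[THEN carrier_matD(1)] Zc[THEN carrier_matD(2)]
    Yc[THEN carrier_matD(1)] Yc[THEN carrier_matD(2)]
  have gd: "dim_row (act V (g, 0)) = fst V" "dim_col (act V (g, 0)) = fst V"
    "dim_row (act W (g, 0)) = fst W" "dim_col (act W (g, 0)) = fst W" if "g \<in> carrier G" for g
    using Vg[OF that] by auto
  have homI: "R \<in> module_homs H V W"
    if R: "R \<in> carrier_mat (fst W) (fst V)" and Rg: "\<And>g. g \<in> carrier G \<Longrightarrow> R * act V (g, 0) = act W (g, 0) * R"
      and Rz: "R * Z = Y * R" for R
    unfolding H.module_homs_iff[OF Vm Wm]
  proof (intro conjI ballI R)
    fix b :: "'g \<times> nat" assume "b \<in> B"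
    then obtain g i where b: "b = (g, i)" "g \<in> carrier G" by (cases b) auto
    have Rp: "R * Z ^\<^sub>m i = Y ^\<^sub>m i * R" for i
    proof (induction i)
      case 0
      then show ?case using R by (simp add: d one_mult_dim)
    next
      case (Suc i)
      have "R * Z ^\<^sub>m Suc i = (R * Z ^\<^sub>m i) * Z"
        using R by (simp add: mult_assoc_dim d)
      also have "\<dots> = Y ^\<^sub>m i * (R * Z)"
        using R unfolding Suc by (simp add: mult_assoc_dim d)
      also have "\<dots> = Y ^\<^sub>m Suc i * R"
        using R unfolding Rz by (simp add: mult_assoc_dim d)
      finally show ?case .
    qed
    have "R * act V b = (R * act V (g, 0)) * Z ^\<^sub>m i"
      using R unfolding b act_xi(1)[OF Vm b(2), of i] Z_def[symmetric] by (simp add: mult_assoc_dim d gd b)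
    also have "\<dots> = act W (g, 0) * (R * Z ^\<^sub>m i)"
      using R unfolding Rg[OF b(2)] by (simp add: mult_assoc_dim d gd b)
    also have "\<dots> = act W b * R"
      using R unfolding Rp b(1) act_xi(1)[OF Wm b(2), of i] Y_def[symmetric] by (simp add: mult_assoc_dim d gd b)
    finally show "R * act V b = act W b * R" .
  qed
  show ?thesis
  proof (cases "\<beta> = 0")
    case True
    then have "Z = 0 \<cdot>\<^sub>m 1\<^sub>m (fst V)" "Y = 0 \<cdot>\<^sub>m 1\<^sub>m (fst W)"
      using V W by (auto simp: homogeneous_def Z_def Y_def)
    then have "T * Z = Y * T" by (simp add: smult_mult_dim d one_mult_dim)
    then have "T \<in> module_homs H V W" by (intro homI T Tg)
    then show ?thesis using T(2) by blast
  next
    case \<beta>: False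
    have Zsq: "Z * Z = \<beta> \<cdot>\<^sub>m 1\<^sub>m (fst V)" and Ysq: "Y * Y = \<beta> \<cdot>\<^sub>m 1\<^sub>m (fst W)"
      using homogeneous_act_square[OF V] homogeneous_act_square[OF W]
        H.act_mult[OF Vm, of "(\<one>, 1)" "(\<one>, 1)"] H.act_mult[OF Wm, of "(\<one>, 1)" "(\<one>, 1)"]
      by (simp_all add: Z_def Y_def chi_one one_smult_mat flip: one_add_one)
    \<comment> \<open>\<open>e\<close> and \<open>e'\<close> stand for \<open>1 + c\<close> and
      \<open>1 - c\<close> in either order. They are twice the projections onto the eigenspaces of
      \<open>c\<close>, whence \<open>e * e = 2 e\<close>; that \<open>\<xi>\<close> exchanges the
      eigenspaces reads \<open>Z * e = e' * Z\<close>.\<close>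
    have main: "\<exists>R\<in>module_homs H V W. R \<noteq> 0\<^sub>m (fst W) (fst V)"
      if e: "e \<in> carrier_mat (fst V) (fst V)" "e' \<in> carrier_mat (fst V) (fst V)"
        and eg: "\<And>g. g \<in> carrier G \<Longrightarrow> e * act V (g, 0) = act V (g, 0) * e"
        and eZ: "Z * e = e' * Z" and ee': "e * e' = 0\<^sub>m (fst V) (fst V)" and ee: "e * e = 2 \<cdot>\<^sub>m e"
        and Te: "T * e \<noteq> 0\<^sub>m (fst W) (fst V)" for e e'
    proof -
      note ed = e[THEN carrier_matD(1)] e[THEN carrier_matD(2)]
      define Q where "Q = T * e"
      have Q: "Q \<in> carrier_mat (fst W) (fst V)" using T e by (simp add: Q_def)
      note Qd = Q[THEN carrier_matD(1)] Q[THEN carrier_matD(2)]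
      \<comment> \<open>This is \<open>Y * Q * Z^-1\<close>, because \<open>Z * Z = \<beta>\<close>.
        From \<open>P * Z = Y * Q\<close> and \<open>Y * P = Q * Z\<close> it follows that
        \<open>Q + P\<close> commutes with \<open>\<xi>\<close>.\<close>
      define P where "P = inverse \<beta> \<cdot>\<^sub>m (Y * (Q * Z))"
      have P: "P \<in> carrier_mat (fst W) (fst V)" using Q Yc Zc by (simp add: P_def)
      note Pd = P[THEN carrier_matD(1)] P[THEN carrier_matD(2)]
      have Qg: "Q * act V (g, 0) = act W (g, 0) * Q" if "g \<in> carrier G" for g
      proof -
        have "Q * act V (g, 0) = T * act V (g, 0) * e"
          using eg[OF that] by (simp add: Q_def mult_assoc_dim d ed gd that)
        then show ?thesis unfolding Tg[OF that] by (simp add: Q_def mult_assoc_dim d ed gd that)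
      qed
      have Pg: "P * act V (g, 0) = act W (g, 0) * P" if g: "g \<in> carrier G" for g
      proof -
        have "Y * (Q * Z) * act V (g, 0) = Y * (Q * (Z * act V (g, 0)))"
          by (simp add: mult_assoc_dim d Qd gd g)
        also have "\<dots> = \<chi> g \<cdot>\<^sub>m (Y * ((Q * act V (g, 0)) * Z))"
          unfolding Z_def act_xi(2)[OF Vm g] unfolding Z_def[symmetric]
          by (simp add: smult_mult_dim mult_assoc_dim d Qd gd g)
        also have "\<dots> = \<chi> g \<cdot>\<^sub>m ((Y * act W (g, 0)) * (Q * Z))"
          unfolding Qg[OF g] by (simp add: mult_assoc_dim d Qd gd g)
        also have "\<dots> = act W (g, 0) * (Y * (Q * Z))"
          unfolding Y_def act_xi(2)[OF Wm g] unfolding Y_def[symmetric]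
          by (simp add: smult_mult_dim mult_assoc_dim d Qd gd g smult_smult_mat chi_square one_smult_mat)
        finally show ?thesis by (simp add: P_def smult_mult_dim d Qd gd g)
      qed
      have PZ: "P * Z = Y * Q"
      proof -
        have "Y * (Q * Z) * Z = \<beta> \<cdot>\<^sub>m (Y * Q)"
          by (simp add: mult_assoc_dim d Qd Zsq smult_mult_dim one_mult_dim)
        then show ?thesis using \<beta> by (simp add: P_def smult_mult_dim d Qd smult_smult_mat one_smult_mat)
      qed
      have YP: "Y * P = Q * Z"
      proof -
        have "Y * (Y * (Q * Z)) = \<beta> \<cdot>\<^sub>m (Q * Z)"
          by (simp add: mult_cancel_dim[OF Ysq] d Qd smult_mult_dim one_mult_dim)
        then show ?thesis using \<beta> by (simp add: P_def smult_mult_dim d Qd smult_smult_mat one_smult_mat)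
      qed
      have "(Q + P) * Z = Y * (Q + P)"
        using comm_add_mat[of "Q * Z" "fst W" "fst V" "Y * Q"] Q Yc Zc
        by (simp add: add_mult_dim d Qd Pd PZ YP)
      moreover have "(Q + P) * act V (g, 0) = act W (g, 0) * (Q + P)" if "g \<in> carrier G" for g
        using that by (simp add: add_mult_dim gd Qd Pd Qg Pg)
      ultimately have hom: "Q + P \<in> module_homs H V W" using Q P by (intro homI) auto
      have "Q + P \<noteq> 0\<^sub>m (fst W) (fst V)"
      proof
        assume "Q + P = 0\<^sub>m (fst W) (fst V)"
        then have "(Q + P) * e = 0\<^sub>m (fst W) (fst V)" using e by simp
        moreover have "Q * e = 2 \<cdot>\<^sub>m Q"
          by (simp add: Q_def mult_assoc_dim d ed ee smult_mult_dim)
        \<comment> \<open>\<open>Q * Z * e = T * e * e' * Z = 0\<close>, whereas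
          \<open>Q * e = 2 Q\<close>. So \<open>(Q + P) * e = 2 Q\<close>, and \<open>Q + P\<close>
          cannot vanish.\<close>
        moreover have "P * e = 0\<^sub>m (fst W) (fst V)"
        proof -
          have "Y * (Q * Z) * e = Y * (T * ((e * e') * Z))"
            by (simp add: Q_def mult_assoc_dim d ed eZ)
          also have "\<dots> = Y * (T * 0\<^sub>m (fst V) (fst V))" unfolding ee' left_mult_zero_mat[OF Zc] ..
          also have "\<dots> = 0\<^sub>m (fst W) (fst V)"
            unfolding right_mult_zero_mat[OF T(1)] right_mult_zero_mat[OF Yc] ..
          finally show ?thesis by (simp add: P_def smult_mult_dim d Qd ed)
        qed
        ultimately have "2 \<cdot>\<^sub>m Q = 0\<^sub>m (fst W) (fst V)"
          using Q by (simp add: add_mult_dim Qd Pd ed)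
        then have "2 * Q $$ (i, j) = 0" if "i < fst W" "j < fst V" for i j
          using that Q by (metis carrier_matD index_smult_mat(1) index_zero_mat(1))
        then have "Q = 0\<^sub>m (fst W) (fst V)" using Q by (intro eq_matI) auto
        with Te show False by (simp add: Q_def)
      qed
      with hom show ?thesis by blast
    qed
    define C where "C = act V (c, 0)"
    have C: "C \<in> carrier_mat (fst V) (fst V)" using Vg c_closed by (simp add: C_def)
    note Cd = C[THEN carrier_matD(1)] C[THEN carrier_matD(2)]
    have CC: "C * C = 1\<^sub>m (fst V)"
      using act_group[OF Vm c_closed c_closed] by (simp add: C_def c_square H.act_one[OF Vm])
    have Cg: "C * act V (g, 0) = act V (g, 0) * C" if "g \<in> carrier G" for g
      using act_group[OF Vm] that c_closed by (simp add: C_def c_central)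
    have CZ: "Z * C = (-1) \<cdot>\<^sub>m (C * Z)"
      using act_xi(2)[OF Vm c_closed] by (simp add: C_def Z_def chi_c)
    define e e' where "e = 1\<^sub>m (fst V) + C" and "e' = 1\<^sub>m (fst V) - C"
    have ec: "e \<in> carrier_mat (fst V) (fst V)" "e' \<in> carrier_mat (fst V) (fst V)"
      using C by (auto simp: e_def e'_def minus_carrier_mat)
    have eg: "e * act V (g, 0) = act V (g, 0) * e" "e' * act V (g, 0) = act V (g, 0) * e'"
      if "g \<in> carrier G" for g
      using that by (simp_all add: e_def e'_def add_mult_dim minus_mult_dim Cd gd Cg one_mult_dim)
    have "Z * e = Z + (-1) \<cdot>\<^sub>m (C * Z)" "e' * Z = Z - C * Z" "Z * e' = Z - (-1) \<cdot>\<^sub>m (C * Z)" "e * Z = Z + C * Z"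
      by (simp_all add: e_def e'_def add_mult_dim minus_mult_dim Cd d CZ one_mult_dim)
    then have eZ: "Z * e = e' * Z" "Z * e' = e * Z"
      using C Zc by (auto intro!: eq_matI simp del: index_mult_mat(1))
    have "e * e = 1\<^sub>m (fst V) + C + (C + 1\<^sub>m (fst V))" "e' * e' = 1\<^sub>m (fst V) - C - (C - 1\<^sub>m (fst V))"
      "e * e' = 1\<^sub>m (fst V) + C - (C + 1\<^sub>m (fst V))" "e' * e = 1\<^sub>m (fst V) - C + (C - 1\<^sub>m (fst V))"
      by (simp_all add: e_def e'_def add_mult_dim minus_mult_dim Cd CC one_mult_dim)
    then have ee: "e * e = 2 \<cdot>\<^sub>m e" "e' * e' = 2 \<cdot>\<^sub>m e'" "e * e' = 0\<^sub>m (fst V) (fst V)" "e' * e = 0\<^sub>m (fst V) (fst V)"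
      using C by (auto intro!: eq_matI simp: e_def e'_def)
    show ?thesis
    proof (cases "T * e = 0\<^sub>m (fst W) (fst V)")
      case False
      show ?thesis by (rule main[OF ec eg(1) eZ(1) ee(3) ee(1) False])
    next
      case True
      \<comment> \<open>Since \<open>e + e' = 2\<close>, the map \<open>T\<close> cannot vanish on
        both eigenspaces; the roles of \<open>e\<close> and \<open>e'\<close> are interchanged in
        this case.\<close>
      have "T * e' \<noteq> 0\<^sub>m (fst W) (fst V)"
      proof
        assume "T * e' = 0\<^sub>m (fst W) (fst V)"
        moreover have "e + e' = 2 \<cdot>\<^sub>m 1\<^sub>m (fst V)" using C by (auto intro!: eq_matI simp: e_def e'_def)
        moreover have "T * (e + e') = T * e + T * e'"
          by (rule mult_add_distrib_mat[OF T(1) ec])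
        ultimately have "2 \<cdot>\<^sub>m T = 0\<^sub>m (fst W) (fst V)"
          using True by (simp add: smult_mult_dim d one_mult_dim)
        then have "2 * T $$ (i, j) = 0" if "i < fst W" "j < fst V" for i j
          using that T(1) by (metis carrier_matD index_smult_mat(1) index_zero_mat(1))
        then have "T = 0\<^sub>m (fst W) (fst V)" using T(1) by (intro eq_matI) auto
        with T(2) show False by simp
      qed
      from main[OF ec(2,1) eg(2) eZ(2) ee(4) ee(2) this] show ?thesis .
    qed
  qed
qed

text \<open>Traces of group elements suffice here: on homogeneous modules of the same
  \<open>\<beta>\<close> they determine the whole series, and \<open>homogeneous_hom\<close> turns
  their equality into a nonzero map.\<close>

lemma homogeneous_rel:
  assumes "homogeneous \<beta> V" "homogeneous \<beta> W" "\<forall>g\<in>carrier G. mtr (act V (g, 0)) = mtr (act W (g, 0))"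
  shows "bas V - bas W \<in> H.rel"
proof (rule equal_traces_rel[OF H.monomial_algebra_axioms, where P = "homogeneous \<beta>" and ?B0.0 = "(\<lambda>g. (g, 0)) ` carrier G"])
  fix V W assume "homogeneous \<beta> V" "homogeneous \<beta> W" "fst V > 0"
    "\<forall>b\<in>(\<lambda>g. (g, 0)) ` carrier G. mtr (act V b) = mtr (act W b)"
  then show "\<exists>T\<in>module_homs H V W. T \<noteq> 0\<^sub>m (fst W) (fst V)"
    by (intro homogeneous_hom) auto
next
  fix U V W assume "homogeneous \<beta> V" "H.ses U V W" "U \<in> fd_modules H" "W \<in> fd_modules H"
  then show "homogeneous \<beta> U \<and> homogeneous \<beta> W" by (rule homogeneous_ses)
next
  show "V \<in> fd_modules H" "W \<in> fd_modules H" using assms by (simp_all add: homogeneous_def)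
  show "\<forall>b\<in>(\<lambda>g. (g, 0)) ` carrier G. mtr (act V b) = mtr (act W b)" using assms(3) by simp
qed (use assms(1,2) in auto)

text \<open>The algebraically closed field supplies an eigenvalue \<open>\<beta>\<close> of
  \<open>\<xi>^2\<close>. If \<open>\<xi>^2\<close> is not this scalar, the eigenspace is a nonzero
  proper submodule. If \<open>\<xi>^2 = 0\<close> but \<open>\<xi>\<close> acts nontrivially, the
  kernel of \<open>\<xi>\<close> is one, because it contains the image of
  \<open>\<xi>\<close>.\<close>

lemma homogeneous_or_split:
  assumes V: "V \<in> fd_modules H" and pos: "fst V > 0"
  shows "(\<exists>\<beta>. homogeneous \<beta> V) \<or> (\<exists>U W. U \<in> fd_modules H \<and> W \<in> fd_modules H \<and> H.ses U V W \<and>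
    fst U < fst V \<and> fst W < fst V)"
proof -
  let ?d = "fst V"
  define Z where "Z = act V (\<one>, 2)"
  have Z: "Z \<in> carrier_mat ?d ?d" unfolding Z_def by (rule H.act_carrier[OF V]) simp
  have "Polynomial.degree (char_poly Z) > 0" using degree_monic_char_poly[OF Z] pos by simp
  then obtain \<beta> where "poly (char_poly Z) \<beta> = 0" using alg_closed_imp_poly_has_root by blast
  then have "eigenvalue Z \<beta>" using eigenvalue_root_char_poly[OF Z] by blast
  then obtain v where v: "v \<in> carrier_vec ?d" "v \<noteq> 0\<^sub>v ?d" "Z *\<^sub>v v = \<beta> \<cdot>\<^sub>v v"
    using Z by (auto simp: eigenvalue_def eigenvector_def)
  have split: ?thesis if "M \<in> carrier_mat ?d ?d" "M \<noteq> 0\<^sub>m ?d ?d" "Q \<in> carrier_mat ?d q" "Q \<noteq> 0\<^sub>m ?d q"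
    "M * Q = 0\<^sub>m ?d q" "\<And>b. b \<in> B \<Longrightarrow> \<exists>K\<in>carrier_mat ?d ?d. M * act V b = K * M" for M Q q
    by (rule split_by_kernel[OF H.monomial_algebra_axioms V that]) blast+
  show ?thesis
  proof (cases "Z = \<beta> \<cdot>\<^sub>m 1\<^sub>m ?d")
    case False
    define M Q where "M = Z - \<beta> \<cdot>\<^sub>m 1\<^sub>m ?d" and "Q = mat ?d 1 (\<lambda>(i, _). v $ i)"
    show ?thesis
    proof (rule split)
      show M: "M \<in> carrier_mat ?d ?d" using Z by (simp add: M_def minus_carrier_mat)
      show "Q \<in> carrier_mat ?d 1" by (simp add: Q_def)
      show "M \<noteq> 0\<^sub>m ?d ?d"
      proof
        assume M0: "M = 0\<^sub>m ?d ?d"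
        have "Z $$ (i, j) = (\<beta> \<cdot>\<^sub>m 1\<^sub>m ?d) $$ (i, j)" if "i < ?d" "j < ?d" for i j
          using arg_cong[OF M0, of "\<lambda>M. M $$ (i, j)"] that Z by (simp add: M_def)
        then have "Z = \<beta> \<cdot>\<^sub>m 1\<^sub>m ?d" using Z by (intro eq_matI) auto
        with False show False by simp
      qed
      show "Q \<noteq> 0\<^sub>m ?d 1"
      proof
        assume "Q = 0\<^sub>m ?d 1"
        then have "v $ i = 0" if "i < ?d" for i
        proof -
          have "Q $$ (i, 0) = v $ i" using that by (simp add: Q_def)
          then show ?thesis using \<open>Q = 0\<^sub>m ?d 1\<close> that by simp
        qed
        then have "v = 0\<^sub>v ?d" using v(1) by (intro eq_vecI) auto
        with v(2) show False by simp
      qed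
      show "M * Q = 0\<^sub>m ?d 1"
      proof (rule eq_matI)
        fix i j assume "i < dim_row (0\<^sub>m ?d 1 :: 'k mat)" "j < dim_col (0\<^sub>m ?d 1 :: 'k mat)"
        then have ij: "i < ?d" "j = 0" by auto
        have "col Q 0 = v" using v(1) by (intro eq_vecI) (auto simp: Q_def)
        then have "(M * Q) $$ (i, j) = (M *\<^sub>v v) $ i"
          using ij M by (simp add: Q_def)
        also have "M *\<^sub>v v = Z *\<^sub>v v - (\<beta> \<cdot>\<^sub>m 1\<^sub>m ?d) *\<^sub>v v"
          unfolding M_def by (rule minus_mult_distrib_mat_vec[OF Z _ v(1)]) simp
        also have "(\<beta> \<cdot>\<^sub>m 1\<^sub>m ?d) *\<^sub>v v = \<beta> \<cdot>\<^sub>v v"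
          using v(1) by (intro eq_vecI) (auto simp: scalar_prod_def if_distrib[of "\<lambda>z. \<beta> * z"]
              if_distrib[of "\<lambda>z. z * _"] cong: if_cong)
        finally show "(M * Q) $$ (i, j) = 0\<^sub>m ?d 1 $$ (i, j)" using ij v by simp
      qed (simp_all add: Q_def M_def)
      fix b :: "'g \<times> nat" assume b: "b \<in> B"
      have "Z * act V b = act V b * Z"
        unfolding Z_def using b H.act_mult[OF V, of "(\<one>, 2)" b] H.act_mult[OF V, of b "(\<one>, 2)"]
        by (auto simp: chi_one one_smult_mat chi_square power2_eq_square add.commute)
      then have "M * act V b = act V b * M"
        using Z H.act_dim[OF V b] by (simp add: M_def minus_mult_dim smult_mult_dim one_mult_dim)
      then show "\<exists>K\<in>carrier_mat ?d ?d. M * act V b = K * M" using H.act_carrier[OF V b] by blast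
    qed
  next
    case True
    show ?thesis
    proof (cases "\<beta> = 0 \<and> act V (\<one>, 1) \<noteq> 0\<^sub>m ?d ?d")
      case False
      have z: "0\<^sub>m ?d ?d = (0 :: 'k) \<cdot>\<^sub>m 1\<^sub>m ?d" by (rule eq_matI) auto
      have "homogeneous \<beta> V"
        unfolding homogeneous_def using V True False z by (auto simp: Z_def)
      then show ?thesis by blast
    next
      case *: True
      let ?N = "act V (\<one>, 1)"
      have N: "?N \<in> carrier_mat ?d ?d" by (rule H.act_carrier[OF V]) simp
      have "?N * ?N = Z"
        using H.act_mult[OF V, of "(\<one>, 1)" "(\<one>, 1)"] by (simp add: Z_def chi_one one_smult_mat)
      then have "?N * ?N = 0\<^sub>m ?d ?d" using True * by (auto intro!: eq_matI)
      then show ?thesis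
      proof (rule split[OF N conjunct2[OF *] N conjunct2[OF *]])
        fix b :: "'g \<times> nat" assume "b \<in> B"
        then obtain g i where b: "b = (g, i)" "g \<in> carrier G" by (cases b) auto
        have "?N * act V b = \<chi> g \<cdot>\<^sub>m (act V b * ?N)"
          using b H.act_mult[OF V, of "(\<one>, 1)" b] H.act_mult[OF V, of b "(\<one>, 1)"]
          by (simp add: chi_one one_smult_mat add.commute)
        then have "?N * act V b = (\<chi> g \<cdot>\<^sub>m act V b) * ?N"
          using b N by (simp add: smult_mult_dim H.act_dim[OF V])
        then show "\<exists>K\<in>carrier_mat ?d ?d. ?N * act V b = K * ?N"
          using H.act_carrier[OF V, of b] b by (intro bexI[of _ "\<chi> g \<cdot>\<^sub>m act V b"]) auto
      qed
    qed
  qed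
qed

end

lemma iv_ext_fps_const: "iv.ext (\<lambda>V. fps_const (a V)) f = fps_const (iv.ext a f :: 'k::field_char_0)"
proof -
  have "fps_const (\<Sum>V\<in>S. b V) = (\<Sum>V\<in>S. fps_const (b V))" for S and b :: "'a \<Rightarrow> 'k"
    by (induction S rule: infinite_finite_induct) (simp_all flip: fps_const_add)
  then show ?thesis by (simp add: iv.ext_def fps_of_int[symmetric])
qed

section \<open>Decomposition of classes into homogeneous parts, and separation by characters\<close>

context hopf_ore_extension
begin

text \<open>The families \<open>V\<close> and \<open>W\<close> are homogeneous at every
  \<open>\<beta>\<close>, with the zero module available as filler; this allows the finite set
  \<open>S\<close> to be enlarged at will.\<close>

definition decomposable :: "(('k, 'g \<times> nat) matrix_module \<Rightarrow>\<^sub>0 int) \<Rightarrow> bool" where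
  "decomposable f \<longleftrightarrow> (\<exists>S V W. finite S \<and> (\<forall>\<beta>. homogeneous \<beta> (V \<beta>) \<and> homogeneous \<beta> (W \<beta>)) \<and>
     f - (\<Sum>\<beta>\<in>S. bas (V \<beta>) - bas (W \<beta>)) \<in> H.rel)"

lemma decomposable_zero: "decomposable 0"
  unfolding decomposable_def
  by (intro exI[of _ "{}"] exI[of _ "\<lambda>_. H.zero_module"]) (simp add: homogeneous_zero H.rel_zero)

lemma decomposable_cong: "f - g \<in> H.rel \<Longrightarrow> decomposable g \<Longrightarrow> decomposable f"
  unfolding decomposable_def using H.rel_trans by blast

lemma decomposable_homogeneous:
  assumes "homogeneous \<beta> V"
  shows "decomposable (bas V)"
  unfolding decomposable_def
proof (intro exI conjI allI)
  let ?V = "\<lambda>\<gamma>. if \<gamma> = \<beta> then V else H.zero_module"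
  show "finite {\<beta>}" by simp
  show "homogeneous \<gamma> (?V \<gamma>)" "homogeneous \<gamma> H.zero_module" for \<gamma>
    using assms homogeneous_zero by auto
  show "bas V - (\<Sum>\<gamma>\<in>{\<beta>}. bas (?V \<gamma>) - bas H.zero_module) \<in> H.rel"
    using H.rel_dim_zero[OF H.zero_module] by simp
qed

lemma decomposable_extend:
  assumes "decomposable f"
  obtains S where "finite S" "\<And>S'. finite S' \<Longrightarrow> S \<subseteq> S' \<Longrightarrow>
    \<exists>V W. (\<forall>\<beta>. homogeneous \<beta> (V \<beta>) \<and> homogeneous \<beta> (W \<beta>)) \<and>
      f - (\<Sum>\<beta>\<in>S'. bas (V \<beta>) - bas (W \<beta>)) \<in> H.rel"
proof -
  obtain S V W where *: "finite S" "\<forall>\<beta>. homogeneous \<beta> (V \<beta>) \<and> homogeneous \<beta> (W \<beta>)"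
    "f - (\<Sum>\<beta>\<in>S. bas (V \<beta>) - bas (W \<beta>)) \<in> H.rel"
    using assms unfolding decomposable_def by blast
  show thesis
  proof (rule that[OF *(1)])
    fix S' assume S': "finite S'" "S \<subseteq> S'"
    let ?V = "\<lambda>\<beta>. if \<beta> \<in> S then V \<beta> else H.zero_module"
    let ?W = "\<lambda>\<beta>. if \<beta> \<in> S then W \<beta> else H.zero_module"
    have "(\<Sum>\<beta>\<in>S'. bas (?V \<beta>) - bas (?W \<beta>)) = (\<Sum>\<beta>\<in>S. bas (V \<beta>) - bas (W \<beta>) :: _ \<Rightarrow>\<^sub>0 int)"
      using S' by (intro sum.mono_neutral_cong_right) auto
    moreover have "\<forall>\<beta>. homogeneous \<beta> (?V \<beta>) \<and> homogeneous \<beta> (?W \<beta>)"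
      using *(2) homogeneous_zero by simp
    ultimately show "\<exists>V W. (\<forall>\<beta>. homogeneous \<beta> (V \<beta>) \<and> homogeneous \<beta> (W \<beta>)) \<and>
        f - (\<Sum>\<beta>\<in>S'. bas (V \<beta>) - bas (W \<beta>)) \<in> H.rel"
      using *(3) by (intro exI[of _ ?V] exI[of _ ?W]) simp
  qed
qed

text \<open>Over a common finite set of scalars, the terms of both elements are merged by direct
  sums within each \<open>\<beta>\<close>, since only one difference of modules is allowed per
  scalar.\<close>

lemma decomposable_diff:
  assumes "decomposable f" "decomposable g"
  shows "decomposable (f - g)"
proof -
  obtain S where S: "finite S" "\<And>S'. finite S' \<Longrightarrow> S \<subseteq> S' \<Longrightarrow>
    \<exists>V W. (\<forall>\<beta>. homogeneous \<beta> (V \<beta>) \<and> homogeneous \<beta> (W \<beta>)) \<and>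
      f - (\<Sum>\<beta>\<in>S'. bas (V \<beta>) - bas (W \<beta>)) \<in> H.rel"
    using decomposable_extend[OF assms(1)] by blast
  obtain S1 where S1: "finite S1" "\<And>S'. finite S' \<Longrightarrow> S1 \<subseteq> S' \<Longrightarrow>
    \<exists>V W. (\<forall>\<beta>. homogeneous \<beta> (V \<beta>) \<and> homogeneous \<beta> (W \<beta>)) \<and>
      g - (\<Sum>\<beta>\<in>S'. bas (V \<beta>) - bas (W \<beta>)) \<in> H.rel"
    using decomposable_extend[OF assms(2)] by blast
  obtain V W where V: "\<forall>\<beta>. homogeneous \<beta> (V \<beta>) \<and> homogeneous \<beta> (W \<beta>)"
      "f - (\<Sum>\<beta>\<in>S \<union> S1. bas (V \<beta>) - bas (W \<beta>)) \<in> H.rel"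
    using S(2)[of "S \<union> S1"] S(1) S1(1) by auto
  obtain V' W' where V': "\<forall>\<beta>. homogeneous \<beta> (V' \<beta>) \<and> homogeneous \<beta> (W' \<beta>)"
      "g - (\<Sum>\<beta>\<in>S \<union> S1. bas (V' \<beta>) - bas (W' \<beta>)) \<in> H.rel"
    using S1(2)[of "S \<union> S1"] S(1) S1(1) by auto
  let ?A = "\<lambda>\<beta>. H.dsum (V \<beta>) (W' \<beta>)" and ?B = "\<lambda>\<beta>. H.dsum (V' \<beta>) (W \<beta>)"
  have fd: "V \<beta> \<in> fd_modules H" "W \<beta> \<in> fd_modules H" "V' \<beta> \<in> fd_modules H" "W' \<beta> \<in> fd_modules H" for \<beta>
    using V(1) V'(1) by (auto simp: homogeneous_def)
  have "(\<Sum>\<beta>\<in>S \<union> S1. (bas (?B \<beta>) - (bas (V' \<beta>) + bas (W \<beta>))) - (bas (?A \<beta>) - (bas (V \<beta>) + bas (W' \<beta>)))) \<in> H.rel"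
    by (intro H.rel_sum H.rel_diff H.rel_dsum fd)
  from H.rel_add[OF H.rel_diff[OF V(2) V'(2)] this]
  have "f - g - (\<Sum>\<beta>\<in>S \<union> S1. bas (?A \<beta>) - bas (?B \<beta>)) \<in> H.rel"
    by (simp add: sum_subtractf sum.distrib algebra_simps)
  moreover have "\<forall>\<beta>. homogeneous \<beta> (?A \<beta>) \<and> homogeneous \<beta> (?B \<beta>)"
    using V(1) V'(1) homogeneous_dsum by blast
  ultimately show ?thesis
    unfolding decomposable_def using S(1) S1(1)
    by (intro exI[of _ "S \<union> S1"] exI[of _ ?A] exI[of _ ?B]) simp
qed

lemma decomposable_module: "V \<in> fd_modules H \<Longrightarrow> decomposable (bas V)"
proof (induction "fst V" arbitrary: V rule: less_induct)
  case less
  show ?case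
  proof (cases "fst V = 0")
    case True
    then have "bas V - 0 \<in> H.rel" using H.rel_dim_zero less.prems by simp
    then show ?thesis by (rule decomposable_cong[OF _ decomposable_zero])
  next
    case False
    then consider \<beta> where "homogeneous \<beta> V" | U W where "U \<in> fd_modules H" "W \<in> fd_modules H"
      "H.ses U V W" "fst U < fst V" "fst W < fst V"
      using homogeneous_or_split[OF less.prems] by blast
    then show ?thesis
    proof cases
      case 1
      then show ?thesis by (rule decomposable_homogeneous)
    next
      case 2
      have "decomposable (bas U - (0 - bas W))"
        by (intro decomposable_diff decomposable_zero less.hyps 2)
      then show ?thesis
        using H.rel_ses[OF 2(3,1) less.prems 2(2)] by (intro decomposable_cong[of "bas V" "bas U - (0 - bas W)"]) simp_all
    qed
  qed
qed

lemma decomposable: "f \<in> carrier H.F \<Longrightarrow> decomposable f"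
  by (induction f rule: H.F_induct) (auto intro: decomposable_zero decomposable_module decomposable_diff)

lemma ch_zero_module:
  assumes "g \<in> carrier G"
  shows "ch g H.zero_module = 0"
proof -
  have b: "(g, 0) \<in> B" using assms by simp
  have "mtr (act H.zero_module (g, 0)) = 0"
    using H.act_dim[OF H.zero_module(1) b] by (simp add: mtr_def H.zero_module(2))
  then show ?thesis using homogeneous_ch[OF homogeneous_zero assms, of 0] by simp
qed

lemma ch_separating:
  assumes f: "f \<in> carrier H.F" and zero: "\<And>g. g \<in> carrier G \<Longrightarrow> iv.ext (ch g) f = 0"
  shows "f \<in> H.rel"
proof -
  obtain S V W where *: "finite S" "\<And>\<beta>. homogeneous \<beta> (V \<beta>)" "\<And>\<beta>. homogeneous \<beta> (W \<beta>)"
    "f - (\<Sum>\<beta>\<in>S. bas (V \<beta>) - bas (W \<beta>)) \<in> H.rel"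
    using decomposable[OF f] unfolding decomposable_def by blast
  have "mtr (act (V \<beta>) (g, 0)) = mtr (act (W \<beta>) (g, 0))" if g: "g \<in> carrier G" and "\<beta> \<in> S" for g \<beta>
  proof -
    have "iv.ext (ch g) (f - (\<Sum>\<beta>\<in>S. bas (V \<beta>) - bas (W \<beta>))) = 0"
      by (rule H.ext_rel[OF _ _ *(4)]) (use g ch_ses ch_zero_module in auto)
    then have "(\<Sum>\<beta>\<in>S. ch g (V \<beta>) - ch g (W \<beta>)) = 0"
      using zero[OF g] by (simp add: iv.ext_diff iv.ext_sum)
    then have "(\<Sum>\<beta>\<in>S. fps_const (mtr (act (V \<beta>) (g, 0)) - mtr (act (W \<beta>) (g, 0))) * fps_exp \<beta>) = 0"
      by (simp add: homogeneous_ch[OF *(2) g] homogeneous_ch[OF *(3) g] left_diff_distrib flip: fps_const_sub)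
    from fps_exp_independent[OF *(1) this that(2)] show ?thesis by simp
  qed
  then have "(\<Sum>\<beta>\<in>S. bas (V \<beta>) - bas (W \<beta>)) \<in> H.rel"
    using *(2,3) by (intro H.rel_sum homogeneous_rel) auto
  from H.rel_add[OF *(4) this] show ?thesis by simp
qed

sublocale H: separating_characters "hopf_ore G \<chi> c" "carrier G \<times> UNIV" op coef "(\<one>, 0)" "carrier G" ch
proof unfold_locales
  fix V W :: "('k, 'g \<times> nat) matrix_module"
  assume "V \<in> fd_modules H" "W \<in> fd_modules H"
  then show "tensor_module H V W \<in> fd_modules H" by (rule tensor_module_H)
next
  show "ch g (trivial_module H) = 1" if "g \<in> carrier G" for g
    by (rule trivial_module_H(2)[OF that])
qed (auto intro: trivial_module_H(1) ch_tensor ch_zero_module ch_ses ch_separating)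

text \<open>The module \<open>N'\<close> is the eigenspace of \<open>c\<close> for the eigenvalue \<open>1\<close>, the image of the
  idempotent \<open>(1 + c) / 2\<close>.\<close>

lemma fixed_submodule:
  assumes N: "N \<in> fd_modules (group_algebra G :: ('k, 'g) hopf_algebra)"
  shows "\<exists>N'\<in>fd_modules (group_algebra G). \<forall>g\<in>carrier G.
    mtr (act N' g) = (mtr (act N g) + mtr (act N (g \<otimes> c))) / 2"
proof -
  define d where "d = fst N"
  define Q where "Q = 1\<^sub>m d + act N c"
  define E where "E = (1 / 2) \<cdot>\<^sub>m Q"
  have Nc: "act N g \<in> carrier_mat d d" if "g \<in> carrier G" for g
    using D.act_carrier[OF N that] by (simp add: d_def)
  have Nm: "act N g * act N h = act N (g \<otimes> h)" if "g \<in> carrier G" "h \<in> carrier G" for g h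
    using D.act_mult[OF N that] by (simp add: one_smult_mat)
  have N1: "act N \<one> = 1\<^sub>m d" using D.act_one[OF N] by (simp add: d_def)
  have Q: "Q \<in> carrier_mat d d" using Nc[OF c_closed] by (simp add: Q_def)
  then have E: "E \<in> carrier_mat d d" by (simp add: E_def)
  note Qd = Q[THEN carrier_matD(1)] Q[THEN carrier_matD(2)]
  have gd: "dim_row (act N g) = d" "dim_col (act N g) = d" if "g \<in> carrier G" for g using Nc[OF that] by auto
  have "Q * Q = 1\<^sub>m d + act N c + (act N c + 1\<^sub>m d)"
    by (simp add: Q_def add_mult_dim gd c_closed Nm c_square N1 one_mult_dim)
  also have "\<dots> = 2 \<cdot>\<^sub>m Q" using Nc[OF c_closed] by (intro eq_matI) (auto simp: Q_def)
  finally have EE: "E * E = E" by (simp add: E_def smult_mult_dim Qd smult_smult_mat)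
  have Eg: "E * act N g = act N g * E" if g: "g \<in> carrier G" for g
    using g by (simp add: E_def Q_def smult_mult_dim add_mult_dim gd c_closed Nm c_central one_mult_dim)
  obtain r L L' T T' where f: "L \<in> carrier_mat d r" "L' \<in> carrier_mat r d"
    "T \<in> carrier_mat r d" "T' \<in> carrier_mat d r" "E = L * T" "L' * L = 1\<^sub>m r" "T * T' = 1\<^sub>m r"
    by (rule full_rank_factorization[OF E])
  note dd = f(1-4)[THEN carrier_matD(1)] f(1-4)[THEN carrier_matD(2)]
  \<comment> \<open>Idempotency of \<open>E = L * T\<close> gives \<open>T * L = 1\<close>. As
    \<open>E\<close> commutes with the group, the compression \<open>g \<mapsto> T g L\<close> is
    then a representation, with trace \<open>tr(g E)\<close>.\<close>
  have "T * L = L' * (E * E) * T'"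
    by (simp add: f(5) dd mult_assoc_dim mult_cancel_dim[OF f(6)] f(7) one_mult_dim)
  also have "\<dots> = 1\<^sub>m r"
    unfolding EE by (simp add: f(5) dd mult_assoc_dim mult_cancel_dim[OF f(6)] f(7) one_mult_dim)
  finally have TL: "T * L = 1\<^sub>m r" .
  define \<gamma> where "\<gamma> g = T * act N g * L" for g
  have \<gamma>c: "\<gamma> g \<in> carrier_mat r r" if "g \<in> carrier G" for g
    using f Nc[OF that] by (simp add: \<gamma>_def)
  define N' where "N' = (r, \<lambda>u\<in>carrier (group_algebra G :: ('k, 'g) hopf_algebra). extm r \<gamma> u)"
  have mod: "N' \<in> fd_modules (group_algebra G)"
    unfolding N'_def
  proof (rule D.fd_modulesI[OF \<gamma>c])
    fix g h assume gh: "g \<in> carrier G" "h \<in> carrier G"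
    have "\<gamma> g * \<gamma> h = T * ((act N g * E) * (act N h * L))"
      by (simp add: \<gamma>_def f(5) dd gd gh mult_assoc_dim)
    also have "\<dots> = (T * E) * ((act N g * act N h) * L)"
      unfolding Eg[OF gh(1), symmetric] using E by (simp add: dd gd gh mult_assoc_dim)
    also have "T * E = T" by (simp add: f(5) dd mult_cancel_dim[OF TL] one_mult_dim)
    finally show "\<gamma> g * \<gamma> h = 1 \<cdot>\<^sub>m \<gamma> (g \<otimes> h)"
      by (simp add: Nm gh \<gamma>_def one_smult_mat dd gd mult_assoc_dim)
  next
    show "\<gamma> \<one> = 1\<^sub>m r" by (simp add: \<gamma>_def N1 right_mult_one_mat[OF f(3)] TL)
  qed
  have tr: "mtr (act N' g) = (mtr (act N g) + mtr (act N (g \<otimes> c))) / 2" if g: "g \<in> carrier G" for g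
  proof -
    have "act N' g = T * (act N g * L)"
      unfolding N'_def using g \<gamma>c[OF g] by (subst act_extm_module) (auto simp: \<gamma>_def dd gd mult_assoc_dim)
    then have "mtr (act N' g) = mtr (act N g * L * T)"
      using mtr_mult_comm[of T r d "act N g * L"] f Nc[OF g] by simp
    also have "act N g * L * T = act N g * E" by (simp add: f(5) dd gd g mult_assoc_dim)
    also have "\<dots> = (1 / 2) \<cdot>\<^sub>m (act N g + act N (g \<otimes> c))"
      using g by (simp add: E_def Q_def smult_mult_dim add_mult_dim gd c_closed Nm one_mult_dim)
    finally show ?thesis
      using mtr_smult[of "act N g + act N (g \<otimes> c)" d "1 / 2"] mtr_add[OF Nc[OF g] Nc, of "g \<otimes> c"] g c_closed Nc
      by simp
  qed
  show ?thesis using mod tr by blast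
qed

text \<open>A choice for every module, so that the construction extends linearly to virtual modules.
  It realises half of a sum of two traces by an integral class.\<close>

definition fixed :: "('k, 'g) matrix_module \<Rightarrow> ('k, 'g) matrix_module" where
  "fixed N = (SOME N'. N' \<in> fd_modules (group_algebra G) \<and> (\<forall>g\<in>carrier G.
    mtr (act N' g) = (mtr (act N g) + mtr (act N (g \<otimes> c))) / 2))"

lemma fixed:
  assumes "N \<in> fd_modules (group_algebra G)"
  shows "fixed N \<in> fd_modules (group_algebra G)"
    and "g \<in> carrier G \<Longrightarrow> mtr (act (fixed N) g) = (mtr (act N g) + mtr (act N (g \<otimes> c))) / 2"
  using someI_ex[OF fixed_submodule[OF assms, unfolded Bex_def]] unfolding fixed_def by auto

text \<open>\<open>\<xi>\<close> anticommutes with \<open>g\<close>, so rotating under the trace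
  gives \<open>tr(g \<xi>^2) = tr(\<xi> g \<xi>) = - tr(g \<xi>^2)\<close>, while
  \<open>\<xi>^2\<close> is the nonzero scalar \<open>\<beta>\<close>.\<close>

lemma homogeneous_trace_zero:
  assumes V: "homogeneous \<beta> V" and \<beta>: "\<beta> \<noteq> 0" and g: "g \<in> carrier G" "\<chi> g = -1"
  shows "mtr (act V (g, 0)) = 0"
proof -
  have Vm: "V \<in> fd_modules H" using V by (simp add: homogeneous_def)
  define Z where "Z = act V (\<one>, 1)"
  have Z: "Z \<in> carrier_mat (fst V) (fst V)" unfolding Z_def by (rule H.act_carrier[OF Vm]) simp
  have g0: "act V (g, 0) \<in> carrier_mat (fst V) (fst V)" by (rule H.act_carrier[OF Vm]) (use g in simp)
  note d = Z[THEN carrier_matD(1)] Z[THEN carrier_matD(2)] g0[THEN carrier_matD(1)] g0[THEN carrier_matD(2)]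
  have ZZ: "Z * Z = \<beta> \<cdot>\<^sub>m 1\<^sub>m (fst V)"
    using homogeneous_act_square[OF V] H.act_mult[OF Vm, of "(\<one>, 1)" "(\<one>, 1)"]
    by (simp add: Z_def chi_one one_smult_mat)
  have "\<beta> * mtr (act V (g, 0)) = mtr (act V (g, 0) * (Z * Z))"
    unfolding ZZ using mtr_smult[OF g0, of \<beta>] by (simp add: smult_mult_dim d one_mult_dim)
  also have "act V (g, 0) * (Z * Z) = (act V (g, 0) * Z) * Z" by (simp add: d mult_assoc_dim)
  also have "mtr \<dots> = mtr (Z * (act V (g, 0) * Z))"
    by (rule mtr_mult_comm[OF mult_carrier_mat[OF g0 Z] Z])
  also have "Z * (act V (g, 0) * Z) = (-1) \<cdot>\<^sub>m (act V (g, 0) * (Z * Z))"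
    using mult_cancel_dim[OF act_xi(2)[OF Vm g(1), folded Z_def], of Z] g(2)
    by (simp add: d mult_assoc_dim smult_mult_dim)
  also have "mtr \<dots> = - (\<beta> * mtr (act V (g, 0)))"
    unfolding ZZ using mtr_smult[OF smult_carrier_mat[OF g0], of "-1" \<beta>] mtr_smult[OF g0, of \<beta>]
    by (simp add: smult_mult_dim d one_mult_dim)
  finally have "2 * (\<beta> * mtr (act V (g, 0))) = 0" by (simp only: mult_2 eq_neg_iff_add_eq_0)
  then show ?thesis using \<beta> by simp
qed

lemma chi_cases: "g \<in> carrier G \<Longrightarrow> \<chi> g = 1 \<or> \<chi> g = -1"
  using chi_square[of g] by (metis square_eq_1_iff)

text \<open>Exactly one of \<open>g\<close> and \<open>g c\<close> has value -1 under
  \<open>\<chi>\<close>, and there the trace vanishes. The half in the trace of the fixed space is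
  made up for by the factor \<open>1 + \<chi> g\<close>, which is 2 or 0. Thus \<open>V\<close> has
  the character of the class of \<open>fixed (res V)\<close> times \<open>y \<beta>\<close>.\<close>

lemma homogeneous_fixed_trace:
  assumes V: "homogeneous \<beta> V" and \<beta>: "\<beta> \<noteq> 0" and g: "g \<in> carrier G"
  shows "mtr (act V (g, 0)) = mtr (act (fixed (res V)) g) * (1 + \<chi> g)"
proof -
  have Vm: "V \<in> fd_modules H" using V by (simp add: homogeneous_def)
  have gc: "g \<otimes> c \<in> carrier G" "\<chi> (g \<otimes> c) = - \<chi> g" using g c_closed by (simp_all add: chi_mult chi_c)
  have eq: "mtr (act (fixed (res V)) g) = (mtr (act V (g, 0)) + mtr (act V (g \<otimes> c, 0))) / 2"
    using fixed(2)[OF res(1)[OF Vm] g] by (simp add: res(2)[OF Vm] g gc)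
  show ?thesis
    using chi_cases[OF g]
  proof
    assume "\<chi> g = 1"
    then show ?thesis using homogeneous_trace_zero[OF V \<beta> gc(1)] gc(2) eq by simp
  qed (use homogeneous_trace_zero[OF V \<beta> g] in simp)
qed

section \<open>Modules that realise the constants and the variables\<close>

definition inflation :: "('k, 'g) matrix_module \<Rightarrow> ('k, 'g \<times> nat) matrix_module" where
  "inflation N = (fst N, \<lambda>f\<in>carrier H. extm (fst N) (\<lambda>(g, i). act N g * 0\<^sub>m (fst N) (fst N) ^\<^sub>m i) f)"

lemma inflation:
  assumes N: "N \<in> fd_modules (group_algebra G)"
  shows "inflation N \<in> fd_modules H" "g \<in> carrier G \<Longrightarrow> ch g (inflation N) = fps_const (mtr (act N g))"
proof -
  have Nc: "act N g \<in> carrier_mat (fst N) (fst N)" if "g \<in> carrier G" for g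
    by (rule D.act_carrier[OF N that])
  have comm: "0\<^sub>m (fst N) (fst N) * act N g = \<chi> g \<cdot>\<^sub>m (act N g * 0\<^sub>m (fst N) (fst N))" if "g \<in> carrier G" for g
    using left_mult_zero_mat[OF Nc[OF that]] right_mult_zero_mat[OF Nc[OF that]] by (auto intro!: eq_matI)
  have Nm: "act N g * act N h = act N (g \<otimes> h)" if "g \<in> carrier G" "h \<in> carrier G" for g h
    using D.act_mult[OF N that] by (simp add: one_smult_mat)
  have R: "inflation N \<in> fd_modules H" "\<And>g i. g \<in> carrier G \<Longrightarrow>
      act (inflation N) (g, i) = act N g * 0\<^sub>m (fst N) (fst N) ^\<^sub>m i"
    unfolding inflation_def
    by (rule representation_module[where \<gamma> = "act N" and d = "fst N" and Z = "0\<^sub>m (fst N) (fst N)"];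
        (simp add: Nc comm Nm D.act_one[OF N])?)+
  show "inflation N \<in> fd_modules H" by (rule R(1))
  have f: "fst (inflation N) = fst N" by (simp add: inflation_def)
  have "act (inflation N) (\<one>, 1) = 0 \<cdot>\<^sub>m 1\<^sub>m (fst N)"
    unfolding R(2)[OF one_closed] D.act_one[OF N] by (rule eq_matI) (auto simp: One_nat_def)
  then have h: "homogeneous 0 (inflation N)" using R(1) by (simp add: homogeneous_def f)
  show "ch g (inflation N) = fps_const (mtr (act N g))" if g: "g \<in> carrier G"
    unfolding homogeneous_ch[OF h g] R(2)[OF g] using right_mult_one_mat[OF Nc[OF g]] by simp
qed

text \<open>The basis is \<open>v\<close>, \<open>\<xi> v\<close> with \<open>v\<close> fixed by the
  group and \<open>\<xi>^2 v = \<beta> v\<close>; the relation between \<open>\<xi>\<close> and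
  \<open>g\<close> forces the group to act on \<open>\<xi> v\<close> through \<open>\<chi>\<close>.
  It is the trivial representation induced to \<open>H\<close>, modulo
  \<open>\<xi>^2 - \<beta>\<close>.\<close>

definition y_module :: "'k \<Rightarrow> ('k, 'g \<times> nat) matrix_module" where
  "y_module \<beta> = (2, \<lambda>f\<in>carrier H. extm 2 (\<lambda>(g, i).
     mat 2 2 (\<lambda>(p, q). if p = q then (if p = 0 then 1 else \<chi> g) else 0) *
     mat 2 2 (\<lambda>(p, q). if p = q then 0 else (if p = 0 then \<beta> else 1)) ^\<^sub>m i) f)"

lemma y_module:
  assumes \<beta>: "\<beta> \<noteq> 0"
  shows "y_module \<beta> \<in> fd_modules H"
    "g \<in> carrier G \<Longrightarrow> ch g (y_module \<beta>) = fps_const (1 + \<chi> g) * fps_exp \<beta>"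
proof -
  let ?\<gamma> = "\<lambda>g. mat 2 2 (\<lambda>(p, q). if p = q then (if p = 0 then 1 else \<chi> g) else 0)"
  let ?Z = "mat 2 2 (\<lambda>(p, q). if p = q then 0 else (if p = 0 then \<beta> else 1))"
  have two: "{0..<2} = {0, 1::nat}" by auto
  have less: "i < 2 \<longleftrightarrow> i = 0 \<or> i = 1" for i :: nat by auto
  have R: "y_module \<beta> \<in> fd_modules H" "\<And>g i. g \<in> carrier G \<Longrightarrow>
      act (y_module \<beta>) (g, i) = ?\<gamma> g * ?Z ^\<^sub>m i"
    unfolding y_module_def
    by (rule representation_module[where \<gamma> = ?\<gamma> and d = 2 and Z = ?Z];
        (auto intro!: eq_matI simp: scalar_prod_def two less chi_mult chi_one chi_square)?)+
  show "y_module \<beta> \<in> fd_modules H" by (rule R(1))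
  have "act (y_module \<beta>) (\<one>, 2) = ?\<gamma> \<one> * (?Z * ?Z)"
    unfolding R(2)[OF one_closed] by (simp add: numeral_2_eq_2)
  also have "\<dots> = \<beta> \<cdot>\<^sub>m 1\<^sub>m 2"
    by (rule eq_matI) (auto simp: scalar_prod_def two less chi_one)
  finally have h: "homogeneous \<beta> (y_module \<beta>)"
    using R(1) \<beta> by (simp add: homogeneous_def) (simp add: y_module_def)
  have "act (y_module \<beta>) (g, 0) = ?\<gamma> g" if "g \<in> carrier G" for g
    unfolding R(2)[OF that] by (auto intro!: eq_matI simp: scalar_prod_def two less)
  then show "ch g (y_module \<beta>) = fps_const (1 + \<chi> g) * fps_exp \<beta>" if "g \<in> carrier G"
    using homogeneous_ch[OF h that] that by (simp add: mtr_def numeral_2_eq_2)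
qed


section \<open>Evaluation of polynomials as functions on the group\<close>

abbreviation "R \<equiv> G0 (group_algebra G :: ('k, 'g) hopf_algebra)"
abbreviation "P \<equiv> indexed_poly_ring R {\<beta>::'k. \<beta> \<noteq> 0}"

sublocale R: cring "G0 (group_algebra G :: ('k, 'g) hopf_algebra)"
  by (rule D.cring_G0)

sublocale P: cring "indexed_poly_ring (G0 (group_algebra G :: ('k, 'g) hopf_algebra)) {\<beta>::'k. \<beta> \<noteq> 0}"
  by (rule R.cring_indexed_poly_ring)

abbreviation const :: "(('k, 'g) matrix_module \<Rightarrow>\<^sub>0 int) set \<Rightarrow> 'k multiset \<Rightarrow> (('k, 'g) matrix_module \<Rightarrow>\<^sub>0 int) set"
  where "const \<equiv> R.indexed_const"

abbreviation y :: "'k \<Rightarrow> 'k multiset \<Rightarrow> (('k, 'g) matrix_module \<Rightarrow>\<^sub>0 int) set"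
  where "y \<equiv> R.indexed_var"

lemma const_closed: "k \<in> carrier R \<Longrightarrow> const k \<in> carrier P"
  by (simp add: R.indexed_poly_ring_simps R.indexed_pset.indexed_const)

lemma y_closed: "\<beta> \<noteq> 0 \<Longrightarrow> y \<beta> \<in> carrier P"
  unfolding R.indexed_var_def R.indexed_poly_ring_simps
  by (rule R.indexed_pset.indexed_pmult) (auto intro: R.indexed_pset.indexed_const)

lemma const_add: "const (k \<oplus>\<^bsub>R\<^esub> l) = const k \<oplus>\<^bsub>P\<^esub> const l"
  by (simp add: R.indexed_poly_ring_simps R.indexed_padd_const)

lemma const_mult:
  assumes "k \<in> carrier R" "l \<in> carrier R"
  shows "const (k \<otimes>\<^bsub>R\<^esub> l) = const k \<otimes>\<^bsub>P\<^esub> const l"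
proof -
  have eq: "const k \<otimes>\<^bsub>P\<^esub> const l = (\<lambda>w. k \<otimes>\<^bsub>R\<^esub> const l w)"
    by (simp add: R.indexed_poly_ring_simps R.indexed_mult_const[OF assms(1) R.carrier_coeff_const[OF assms(2)]])
  show ?thesis unfolding eq by (rule ext) (use assms in \<open>simp add: R.indexed_const_def\<close>)
qed

lemma const_one: "const \<one>\<^bsub>R\<^esub> = \<one>\<^bsub>P\<^esub>" and const_zero: "const \<zero>\<^bsub>R\<^esub> = \<zero>\<^bsub>P\<^esub>"
  by (simp_all add: R.indexed_poly_ring_simps)

text \<open>Translates the generation of polynomials by adjoining variables into ring
  multiplication, so that inductions can use ideals and homomorphisms.\<close>

lemma pmult_eq:
  assumes "p \<in> carrier P"
  shows "R.indexed_pmult p \<beta> = y \<beta> \<otimes>\<^bsub>P\<^esub> p"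
proof -
  have p: "R.carrier_coeff p"
    using assms by (simp add: R.indexed_poly_ring_simps R.carrier_coeffI)
  have "R.indexed_mult (const \<one>\<^bsub>R\<^esub>) p = p"
    using P.l_one[OF assms] by (simp add: R.indexed_poly_ring_simps)
  then show ?thesis
    unfolding R.indexed_var_def R.indexed_poly_ring_simps
    by (simp add: R.indexed_mult_pmult[OF R.carrier_coeff_const[OF R.one_closed] p])
qed

text \<open>Evaluation takes place at one group element at a time, with values in the type of power
  series; \<open>\<Psi>\<close> collects all of them into a function on the group.\<close>

definition E :: "'g \<Rightarrow> ('k multiset \<Rightarrow> (('k, 'g) matrix_module \<Rightarrow>\<^sub>0 int) set) \<Rightarrow> 'k fps" where
  "E g = poly_evaluation.evalp R (\<lambda>r. fps_const (D.class_char r g)) (\<lambda>\<beta>. fps_const (1 + \<chi> g) * fps_exp \<beta>)"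

lemma poly_evaluation:
  assumes "g \<in> carrier G"
  shows "poly_evaluation R (\<lambda>r. fps_const (D.class_char r g))"
  by unfold_locales (use assms in \<open>simp_all add: D.class_char_hom\<close>)

context
  fixes g assumes g: "g \<in> carrier G"
begin

interpretation ev: poly_evaluation R "\<lambda>r. fps_const (D.class_char r g)" "\<lambda>\<beta>. fps_const (1 + \<chi> g) * fps_exp \<beta>"
  by (rule poly_evaluation[OF g])

lemma E_const: "k \<in> carrier R \<Longrightarrow> E g (const k) = fps_const (D.class_char k g)"
  unfolding E_def by (rule ev.evalp_const)

lemma E_add: "p \<in> carrier P \<Longrightarrow> q \<in> carrier P \<Longrightarrow> E g (p \<oplus>\<^bsub>P\<^esub> q) = E g p + E g q"
  unfolding E_def R.indexed_poly_ring_simps by (rule ev.evalp_padd)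

lemma E_mult: "p \<in> carrier P \<Longrightarrow> q \<in> carrier P \<Longrightarrow> E g (p \<otimes>\<^bsub>P\<^esub> q) = E g p * E g q"
  unfolding E_def R.indexed_poly_ring_simps by (rule ev.evalp_mult)

lemma E_one: "E g \<one>\<^bsub>P\<^esub> = 1"
  using E_const[OF R.one_closed] by (simp add: const_one D.class_char_hom g)

lemma E_y: "E g (y \<beta>) = fps_const (1 + \<chi> g) * fps_exp \<beta>"
proof -
  have "const \<one>\<^bsub>R\<^esub> \<in> R.indexed_pset {\<beta>::'k. \<beta> \<noteq> 0} (carrier R)"
    by (rule R.indexed_pset.indexed_const) simp
  from ev.evalp_pmult[OF this, of \<beta>] show ?thesis
    using E_one by (simp add: E_def R.indexed_var_def const_one)
qed

lemma E_zero: "E g \<zero>\<^bsub>P\<^esub> = 0"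
  using E_add[OF P.zero_closed P.zero_closed] by simp

lemma E_uminus: "p \<in> carrier P \<Longrightarrow> E g (\<ominus>\<^bsub>P\<^esub> p) = - E g p"
  using E_add[of "\<ominus>\<^bsub>P\<^esub> p" p] by (simp add: P.l_neg E_zero eq_neg_iff_add_eq_0)

lemma E_minus: "p \<in> carrier P \<Longrightarrow> q \<in> carrier P \<Longrightarrow> E g (p \<ominus>\<^bsub>P\<^esub> q) = E g p - E g q"
  by (simp add: a_minus_def E_add E_uminus)

lemma E_finsum:
  "finite S \<Longrightarrow> (\<And>i. i \<in> S \<Longrightarrow> f i \<in> carrier P) \<Longrightarrow> E g (finsum P f S) = (\<Sum>i\<in>S. E g (f i))"
proof (induction S rule: finite_induct)
  case (insert i S)
  then have "finsum P f S \<in> carrier P" by (intro P.finsum_closed) auto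
  then show ?case using insert by (simp add: P.finsum_insert Pi_iff E_add)
qed (simp add: E_zero)

end

abbreviation "T \<equiv> function_ring (carrier G) :: ('g \<Rightarrow> 'k fps) ring"

definition \<Psi> :: "('k multiset \<Rightarrow> (('k, 'g) matrix_module \<Rightarrow>\<^sub>0 int) set) \<Rightarrow> 'g \<Rightarrow> 'k fps" where
  "\<Psi> p = (\<lambda>g. if g \<in> carrier G then E g p else 0)"

lemma ring_hom_\<Psi>: "ring_hom_ring P T \<Psi>"
proof (rule ring_hom_ringI2)
  show "ring T" by (rule cring.axioms(1)[OF cring_function_ring])
  show "\<Psi> \<in> Ring.ring_hom P T"
    by (rule ring_hom_memI) (auto simp: \<Psi>_def function_ring_def E_add E_mult E_one fun_eq_iff)
qed (rule P.ring_axioms)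

lemma kernel_\<Psi>: "p \<in> a_kernel P T \<Psi> \<longleftrightarrow> p \<in> carrier P \<and> (\<forall>g\<in>carrier G. E g p = 0)"
  by (auto simp: a_kernel_def' \<Psi>_def function_ring_def fun_eq_iff)

lemma image_\<Psi>: "\<Psi> ` carrier P = H.chars"
proof
  have C: "subcring H.chars T" by (rule H.subcring_chars)
  have "\<Psi> p \<in> H.chars" if "p \<in> R.indexed_pset {\<beta>::'k. \<beta> \<noteq> 0} (carrier R)" for p
    using that
  proof induction
    case (indexed_const k)
    then obtain f where f: "f \<in> carrier D.F" "k = D.rel +>\<^bsub>D.F\<^esub> f" by (auto simp: D.G0_simps)
    have fd: "Poly_Mapping.keys f \<subseteq> fd_modules (group_algebra G)" using f(1) by (simp add: D.F_simps)
    \<comment> \<open>A constant is realised by letting \<open>\<xi>\<close> act by zero on group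
      representations, extended linearly to virtual modules.\<close>
    define f' where "f' = lin (\<lambda>N. bas (inflation N)) f"
    have "f' \<in> carrier H.F"
      unfolding f'_def H.F_simps mem_Collect_eq
      by (rule order.trans[OF keys_lin]) (use fd inflation(1) in \<open>auto simp: keys_single\<close>)
    moreover have "H.char f' = \<Psi> (const k)"
    proof
      fix g
      show "H.char f' g = \<Psi> (const k) g"
      proof (cases "g \<in> carrier G")
        case True
        have "iv.ext (ch g) f' = iv.ext (\<lambda>N. fps_const (mtr (act N g))) f"
          unfolding f'_def iv.ext_lin by (rule iv.ext_cong) (use fd inflation(2)[OF _ True] in auto)
        then show ?thesis
          using True indexed_const D.class_char_coset[OF f(1)]
          by (simp add: H.char_def \<Psi>_def E_const iv_ext_fps_const f(2)) (simp add: D.char_def)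
      qed (simp add: H.char_def \<Psi>_def)
    qed
    ultimately show ?case unfolding H.chars_def by (metis image_eqI)
  next
    case (indexed_padd p q)
    have "\<Psi> (p \<oplus>\<^bsub>P\<^esub> q) = \<Psi> p \<oplus>\<^bsub>T\<^esub> \<Psi> q"
      using indexed_padd by (auto simp: \<Psi>_def function_ring_def R.indexed_poly_ring_simps(1) E_add)
    then show ?case
      using subcringE(7)[OF C indexed_padd.IH] by (simp add: R.indexed_poly_ring_simps)
  next
    case (indexed_pmult p \<beta>)
    have p: "p \<in> carrier P" and \<beta>: "\<beta> \<noteq> 0"
      using indexed_pmult by (auto simp: R.indexed_poly_ring_simps)
    have "H.char (bas (y_module \<beta>)) = \<Psi> (y \<beta>)"
      using y_module[OF \<beta>] by (auto simp: H.char_def \<Psi>_def E_y)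
    then have "\<Psi> (y \<beta>) \<in> H.chars"
      using H.F_closed(5)[OF y_module(1)[OF \<beta>]] unfolding H.chars_def by (metis image_eqI)
    moreover have "\<Psi> (y \<beta> \<otimes>\<^bsub>P\<^esub> p) = \<Psi> (y \<beta>) \<otimes>\<^bsub>T\<^esub> \<Psi> p"
      using y_closed[OF \<beta>] p by (auto simp: \<Psi>_def function_ring_def E_mult)
    ultimately show ?case
      using subcringE(6)[OF C _ indexed_pmult.IH] by (simp add: pmult_eq[OF p])
  qed
  then show "\<Psi> ` carrier P \<subseteq> H.chars" by (auto simp: R.indexed_poly_ring_simps)
  \<comment> \<open>The polynomial is the constant \<open>res V\<close> for
    \<open>\<beta> = 0\<close>, and the class of \<open>fixed (res V)\<close> times
    \<open>y \<beta>\<close> otherwise.\<close>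
  have hom: "\<exists>p\<in>carrier P. \<forall>g\<in>carrier G. E g p = ch g V" if V: "homogeneous \<beta> V" for \<beta> V
  proof -
    have Vm: "V \<in> fd_modules H" using V by (simp add: homogeneous_def)
    show ?thesis
    proof (cases "\<beta> = 0")
      case True
      show ?thesis
      proof (intro bexI[of _ "const (G0_class (group_algebra G) (res V))"] ballI const_closed D.G0_class_closed res Vm)
        fix g assume g: "g \<in> carrier G"
        show "E g (const (G0_class (group_algebra G) (res V))) = ch g V"
          using homogeneous_ch[OF V g] True
          by (simp add: E_const g D.G0_class_closed D.class_char_G0_class res Vm)
      qed
    next
      case False
      let ?k = "G0_class (group_algebra G) (fixed (res V))"
      have k: "?k \<in> carrier R" by (intro D.G0_class_closed fixed res Vm)
      show ?thesis
      proof (intro bexI[of _ "const ?k \<otimes>\<^bsub>P\<^esub> y \<beta>"] ballI P.m_closed const_closed k y_closed False)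
        fix g assume g: "g \<in> carrier G"
        have "D.class_char ?k g = mtr (act (fixed (res V)) g)"
          by (intro D.class_char_G0_class fixed res Vm g)
        then show "E g (const ?k \<otimes>\<^bsub>P\<^esub> y \<beta>) = ch g V"
          using homogeneous_ch[OF V g] homogeneous_fixed_trace[OF V False g]
          by (simp add: E_mult E_const E_y g k const_closed y_closed False mult.assoc[symmetric])
      qed
    qed
  qed
  show "H.chars \<subseteq> \<Psi> ` carrier P"
  proof
    fix u assume "u \<in> H.chars"
    then obtain f where f: "f \<in> carrier H.F" "u = H.char f" by (auto simp: H.chars_def)
    obtain S V W where *: "finite S" "\<And>\<beta>. homogeneous \<beta> (V \<beta>)" "\<And>\<beta>. homogeneous \<beta> (W \<beta>)"
      "f - (\<Sum>\<beta>\<in>S. bas (V \<beta>) - bas (W \<beta>)) \<in> H.rel"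
      using decomposable[OF f(1)] unfolding decomposable_def by blast
    have "\<exists>p\<in>carrier P. \<forall>g\<in>carrier G. E g p = (\<Sum>\<beta>\<in>S. ch g (V \<beta>) - ch g (W \<beta>))"
      using *(1)
    proof (induction S rule: finite_induct)
      case empty
      show ?case by (intro bexI[of _ "\<zero>\<^bsub>P\<^esub>"]) (auto simp: E_zero)
    next
      case (insert \<beta> S)
      obtain p where p: "p \<in> carrier P" "\<forall>g\<in>carrier G. E g p = (\<Sum>\<beta>\<in>S. ch g (V \<beta>) - ch g (W \<beta>))"
        using insert.IH by blast
      obtain q where q: "q \<in> carrier P" "\<forall>g\<in>carrier G. E g q = ch g (V \<beta>)" using hom[OF *(2)] by blast
      obtain q' where q': "q' \<in> carrier P" "\<forall>g\<in>carrier G. E g q' = ch g (W \<beta>)" using hom[OF *(3)] by blast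
      show ?case
        by (rule bexI[of _ "(q \<ominus>\<^bsub>P\<^esub> q') \<oplus>\<^bsub>P\<^esub> p"]) (use insert p q q' in \<open>auto simp: E_add E_minus\<close>)
    qed
    then obtain p where p: "p \<in> carrier P" "\<forall>g\<in>carrier G. E g p = (\<Sum>\<beta>\<in>S. ch g (V \<beta>) - ch g (W \<beta>))" by blast
    have "iv.ext (ch g) f = E g p" if g: "g \<in> carrier G" for g
    proof -
      have "iv.ext (ch g) (f - (\<Sum>\<beta>\<in>S. bas (V \<beta>) - bas (W \<beta>))) = 0"
        by (rule H.ext_rel[OF _ _ *(4)]) (use g ch_ses ch_zero_module in auto)
      then show ?thesis using p(2) g by (simp add: iv.ext_diff iv.ext_sum)
    qed
    then have "u = \<Psi> p" by (auto simp: f(2) H.char_def \<Psi>_def)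
    then show "u \<in> \<Psi> ` carrier P" using p(1) by blast
  qed
qed

subsection \<open>The kernel of the evaluation\<close>

definition x :: "(('k, 'g) matrix_module \<Rightarrow>\<^sub>0 int) set" where
  "x = G0_class (group_algebra G) (character_module G \<chi>)"

lemma x: "x \<in> carrier R" "g \<in> carrier G \<Longrightarrow> D.class_char x g = \<chi> g"
proof -
  note C = one_dim_module[OF group_axioms chi_mult chi_one]
  show "x \<in> carrier R" unfolding x_def by (intro D.G0_class_closed C)
  show "D.class_char x g = \<chi> g" if "g \<in> carrier G"
    unfolding x_def using C that by (simp add: D.class_char_G0_class)
qed

lemma two_times: "p \<in> carrier P \<Longrightarrow> [(2::nat)] \<cdot>\<^bsub>P\<^esub> p = p \<oplus>\<^bsub>P\<^esub> p"
  by (simp add: numeral_2_eq_2)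

text \<open>No variable has index 0, so this index is used for the constant term. The choice fits
  \<open>exp(0 t) = 1\<close>: normal forms become sums over elements of \<open>k\<close>, matched
  with exponentials.\<close>

definition z :: "'k \<Rightarrow> 'k multiset \<Rightarrow> (('k, 'g) matrix_module \<Rightarrow>\<^sub>0 int) set" where
  "z \<beta> = (if \<beta> = 0 then \<one>\<^bsub>P\<^esub> else y \<beta>)"

lemma z_closed: "z \<beta> \<in> carrier P"
  by (simp add: z_def y_closed)

lemma U_relations_eq: "U_relations G \<chi> =
   {const x \<otimes>\<^bsub>P\<^esub> y \<beta> \<ominus>\<^bsub>P\<^esub> y \<beta> |\<beta>. \<beta> \<noteq> 0} \<union>
   {y \<alpha> \<otimes>\<^bsub>P\<^esub> y \<beta> \<ominus>\<^bsub>P\<^esub> (y (\<alpha> + \<beta>) \<oplus>\<^bsub>P\<^esub> y (\<alpha> + \<beta>)) |\<alpha> \<beta>. \<alpha> \<noteq> 0 \<and> \<beta> \<noteq> 0 \<and> \<alpha> \<noteq> - \<beta>} \<union>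
   {y \<beta> \<otimes>\<^bsub>P\<^esub> y (- \<beta>) \<ominus>\<^bsub>P\<^esub> ((\<one>\<^bsub>P\<^esub> \<oplus>\<^bsub>P\<^esub> const x) \<oplus>\<^bsub>P\<^esub> (\<one>\<^bsub>P\<^esub> \<oplus>\<^bsub>P\<^esub> const x)) |\<beta>. \<beta> \<noteq> 0}"
proof -
  have "[(2::nat)] \<cdot>\<^bsub>P\<^esub> y (\<alpha> + \<beta>) = y (\<alpha> + \<beta>) \<oplus>\<^bsub>P\<^esub> y (\<alpha> + \<beta>)" if "\<alpha> \<noteq> - \<beta>" for \<alpha> \<beta>
    using that by (intro two_times y_closed) (simp add: add_eq_0_iff2)
  moreover have "[(2::nat)] \<cdot>\<^bsub>P\<^esub> (\<one>\<^bsub>P\<^esub> \<oplus>\<^bsub>P\<^esub> const x) = (\<one>\<^bsub>P\<^esub> \<oplus>\<^bsub>P\<^esub> const x) \<oplus>\<^bsub>P\<^esub> (\<one>\<^bsub>P\<^esub> \<oplus>\<^bsub>P\<^esub> const x)"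
    by (intro two_times P.a_closed P.one_closed const_closed x)
  ultimately show ?thesis
    unfolding U_relations_def Let_def x_def[symmetric] by (intro arg_cong2[of _ _ _ _ "(\<union>)"] Collect_cong) (auto, metis+)
qed

text \<open>From \<open>\<chi>^2 = 1\<close> follow \<open>\<chi> (1 + \<chi>) = 1 + \<chi>\<close>
  and \<open>(1 + \<chi>)^2 = 2 (1 + \<chi>)\<close>. The exponentials multiply by adding exponents,
  and for opposite exponents they leave the constant \<open>2 (1 + \<chi>)\<close>.\<close>

lemma U_subset_kernel: "U_relations G \<chi> \<subseteq> a_kernel P T \<Psi>"
proof
  fix u assume u: "u \<in> U_relations G \<chi>"
  note cl = y_closed const_closed[OF x(1)]
  show "u \<in> a_kernel P T \<Psi>"
    using u unfolding U_relations_eq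
  proof (elim UnE CollectE exE conjE)
    fix \<beta> :: 'k assume \<beta>: "\<beta> \<noteq> 0" and u: "u = const x \<otimes>\<^bsub>P\<^esub> y \<beta> \<ominus>\<^bsub>P\<^esub> y \<beta>"
    have "fps_const (\<chi> g) * (fps_const (1 + \<chi> g) * fps_exp \<beta>) = fps_const (1 + \<chi> g) * fps_exp \<beta>"
      if "g \<in> carrier G" for g
      using chi_square[OF that] by (simp add: mult.assoc[symmetric] distrib_left add.commute)
    then show ?thesis
      using \<beta> by (simp add: u kernel_\<Psi> cl E_minus E_mult E_const E_y x)
  next
    fix \<alpha> \<beta> :: 'k assume ab: "\<alpha> \<noteq> 0" "\<beta> \<noteq> 0" "\<alpha> \<noteq> - \<beta>"
      and u: "u = y \<alpha> \<otimes>\<^bsub>P\<^esub> y \<beta> \<ominus>\<^bsub>P\<^esub> (y (\<alpha> + \<beta>) \<oplus>\<^bsub>P\<^esub> y (\<alpha> + \<beta>))"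
    have "\<alpha> + \<beta> \<noteq> 0" using ab by (simp add: add_eq_0_iff2)
    moreover have "(fps_const (1 + \<chi> g) * fps_exp \<alpha>) * (fps_const (1 + \<chi> g) * fps_exp \<beta>) =
        fps_const (1 + \<chi> g) * fps_exp (\<alpha> + \<beta>) + fps_const (1 + \<chi> g) * fps_exp (\<alpha> + \<beta>)"
      if "g \<in> carrier G" for g
    proof -
      have "(fps_const (1 + \<chi> g) * fps_exp \<alpha>) * (fps_const (1 + \<chi> g) * fps_exp \<beta>) =
          fps_const ((1 + \<chi> g) * (1 + \<chi> g)) * fps_exp (\<alpha> + \<beta>)"
        by (simp only: fps_exp_add_mult fps_const_mult[symmetric] mult_ac)
      also have "(1 + \<chi> g) * (1 + \<chi> g) = (1 + \<chi> g) + (1 + \<chi> g)"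
        using chi_square[OF that] by (simp add: algebra_simps)
      finally show ?thesis by (simp only: fps_const_add[symmetric] distrib_right)
    qed
    ultimately show ?thesis
      using ab by (simp add: u kernel_\<Psi> cl E_minus E_add E_mult E_y)
  next
    fix \<beta> :: 'k assume \<beta>: "\<beta> \<noteq> 0"
      and u: "u = y \<beta> \<otimes>\<^bsub>P\<^esub> y (- \<beta>) \<ominus>\<^bsub>P\<^esub> ((\<one>\<^bsub>P\<^esub> \<oplus>\<^bsub>P\<^esub> const x) \<oplus>\<^bsub>P\<^esub> (\<one>\<^bsub>P\<^esub> \<oplus>\<^bsub>P\<^esub> const x))"
    have "(fps_const (1 + \<chi> g) * fps_exp \<beta>) * (fps_const (1 + \<chi> g) * fps_exp (- \<beta>)) =
        (1 + fps_const (\<chi> g)) + (1 + fps_const (\<chi> g))" if "g \<in> carrier G" for g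
    proof -
      have "(fps_const (1 + \<chi> g) * fps_exp \<beta>) * (fps_const (1 + \<chi> g) * fps_exp (- \<beta>)) =
          fps_const ((1 + \<chi> g) * (1 + \<chi> g)) * fps_exp (\<beta> + - \<beta>)"
        by (simp only: fps_exp_add_mult fps_const_mult[symmetric] mult_ac)
      also have "(1 + \<chi> g) * (1 + \<chi> g) = (1 + \<chi> g) + (1 + \<chi> g)"
        using chi_square[OF that] by (simp add: algebra_simps)
      also have "fps_exp (\<beta> + - \<beta>) = 1" by simp
      finally show ?thesis by (simp only: mult_1_right fps_const_add[symmetric] fps_const_1_eq_1)
    qed
    then show ?thesis
      using \<beta> by (simp add: u kernel_\<Psi> cl E_minus E_add E_mult E_y E_one E_const x)
  qed
qed

abbreviation "I \<equiv> Idl\<^bsub>P\<^esub> (U_relations G \<chi>)"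

lemma U_closed: "U_relations G \<chi> \<subseteq> carrier P"
  using U_subset_kernel by (auto simp: kernel_\<Psi>)

lemma ideal_I: "ideal I P"
  by (rule P.genideal_ideal[OF U_closed])

lemma I_facts:
  "u \<in> U_relations G \<chi> \<Longrightarrow> u \<in> I" "i \<in> I \<Longrightarrow> i \<in> carrier P" "i \<in> I \<Longrightarrow> j \<in> I \<Longrightarrow> i \<oplus>\<^bsub>P\<^esub> j \<in> I"
  "i \<in> I \<Longrightarrow> p \<in> carrier P \<Longrightarrow> p \<otimes>\<^bsub>P\<^esub> i \<in> I" "\<zero>\<^bsub>P\<^esub> \<in> I"
proof -
  interpret I: ideal I P by (rule ideal_I)
  show "u \<in> U_relations G \<chi> \<Longrightarrow> u \<in> I" using P.genideal_self[OF U_closed] by blast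
  show "i \<in> I \<Longrightarrow> i \<in> carrier P" by (rule I.Icarr)
  show "i \<in> I \<Longrightarrow> j \<in> I \<Longrightarrow> i \<oplus>\<^bsub>P\<^esub> j \<in> I" by (rule I.a_closed)
  show "i \<in> I \<Longrightarrow> p \<in> carrier P \<Longrightarrow> p \<otimes>\<^bsub>P\<^esub> i \<in> I" by (rule I.I_l_closed)
  show "\<zero>\<^bsub>P\<^esub> \<in> I" by (rule I.zero_closed)
qed

text \<open>Modulo the relations every polynomial is linear.\<close>

definition nf :: "('k multiset \<Rightarrow> (('k, 'g) matrix_module \<Rightarrow>\<^sub>0 int) set) \<Rightarrow> bool" where
  "nf p \<longleftrightarrow> (\<exists>S r i. finite S \<and> (\<forall>\<beta>. r \<beta> \<in> carrier R) \<and> i \<in> I \<and>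
     p = i \<oplus>\<^bsub>P\<^esub> (\<Oplus>\<^bsub>P\<^esub>\<beta>\<in>S. const (r \<beta>) \<otimes>\<^bsub>P\<^esub> z \<beta>))"

lemma nf_add:
  assumes "nf p" "nf q"
  shows "nf (p \<oplus>\<^bsub>P\<^esub> q)"
proof -
  obtain S r i where p: "finite S" "\<And>\<beta>. r \<beta> \<in> carrier R" "i \<in> I"
    "p = i \<oplus>\<^bsub>P\<^esub> (\<Oplus>\<^bsub>P\<^esub>\<beta>\<in>S. const (r \<beta>) \<otimes>\<^bsub>P\<^esub> z \<beta>)" using assms(1) unfolding nf_def by blast
  obtain S' r' i' where q: "finite S'" "\<And>\<beta>. r' \<beta> \<in> carrier R" "i' \<in> I"
    "q = i' \<oplus>\<^bsub>P\<^esub> (\<Oplus>\<^bsub>P\<^esub>\<beta>\<in>S'. const (r' \<beta>) \<otimes>\<^bsub>P\<^esub> z \<beta>)" using assms(2) unfolding nf_def by blast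
  define u where "u \<beta> = (if \<beta> \<in> S then r \<beta> else \<zero>\<^bsub>R\<^esub>)" for \<beta>
  define u' where "u' \<beta> = (if \<beta> \<in> S' then r' \<beta> else \<zero>\<^bsub>R\<^esub>)" for \<beta>
  have uc: "u \<beta> \<in> carrier R" "u' \<beta> \<in> carrier R" for \<beta> using p(2) q(2) by (auto simp: u_def u'_def)
  have tc: "const k \<otimes>\<^bsub>P\<^esub> z \<beta> \<in> carrier P" if "k \<in> carrier R" for k \<beta>
    using const_closed[OF that] z_closed by simp
  have e: "(\<Oplus>\<^bsub>P\<^esub>\<beta>\<in>S. const (r \<beta>) \<otimes>\<^bsub>P\<^esub> z \<beta>) = (\<Oplus>\<^bsub>P\<^esub>\<beta>\<in>S \<union> S'. const (u \<beta>) \<otimes>\<^bsub>P\<^esub> z \<beta>)"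
    "(\<Oplus>\<^bsub>P\<^esub>\<beta>\<in>S'. const (r' \<beta>) \<otimes>\<^bsub>P\<^esub> z \<beta>) = (\<Oplus>\<^bsub>P\<^esub>\<beta>\<in>S \<union> S'. const (u' \<beta>) \<otimes>\<^bsub>P\<^esub> z \<beta>)"
    using p(1) q(1) uc tc by (intro P.add.finprod_mono_neutral_cong_left; auto simp: u_def u'_def const_zero z_closed)+
  have "(\<Oplus>\<^bsub>P\<^esub>\<beta>\<in>S \<union> S'. const (u \<beta> \<oplus>\<^bsub>R\<^esub> u' \<beta>) \<otimes>\<^bsub>P\<^esub> z \<beta>) =
      (\<Oplus>\<^bsub>P\<^esub>\<beta>\<in>S \<union> S'. const (u \<beta>) \<otimes>\<^bsub>P\<^esub> z \<beta> \<oplus>\<^bsub>P\<^esub> const (u' \<beta>) \<otimes>\<^bsub>P\<^esub> z \<beta>)"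
    by (intro P.finsum_cong') (auto simp: const_add P.l_distr const_closed uc z_closed tc)
  also have "\<dots> = (\<Oplus>\<^bsub>P\<^esub>\<beta>\<in>S \<union> S'. const (u \<beta>) \<otimes>\<^bsub>P\<^esub> z \<beta>) \<oplus>\<^bsub>P\<^esub> (\<Oplus>\<^bsub>P\<^esub>\<beta>\<in>S \<union> S'. const (u' \<beta>) \<otimes>\<^bsub>P\<^esub> z \<beta>)"
    using uc tc by (intro P.finsum_addf) auto
  finally have s: "(\<Oplus>\<^bsub>P\<^esub>\<beta>\<in>S \<union> S'. const (u \<beta> \<oplus>\<^bsub>R\<^esub> u' \<beta>) \<otimes>\<^bsub>P\<^esub> z \<beta>) = \<dots>" .
  have c: "(\<Oplus>\<^bsub>P\<^esub>\<beta>\<in>S \<union> S'. const (u \<beta>) \<otimes>\<^bsub>P\<^esub> z \<beta>) \<in> carrier P" "(\<Oplus>\<^bsub>P\<^esub>\<beta>\<in>S \<union> S'. const (u' \<beta>) \<otimes>\<^bsub>P\<^esub> z \<beta>) \<in> carrier P"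
    using uc tc by (auto intro!: P.finsum_closed)
  have "p \<oplus>\<^bsub>P\<^esub> q = (i \<oplus>\<^bsub>P\<^esub> i') \<oplus>\<^bsub>P\<^esub> (\<Oplus>\<^bsub>P\<^esub>\<beta>\<in>S \<union> S'. const (u \<beta> \<oplus>\<^bsub>R\<^esub> u' \<beta>) \<otimes>\<^bsub>P\<^esub> z \<beta>)"
    unfolding p(4) q(4) e s using c I_facts(2)[OF p(3)] I_facts(2)[OF q(3)]
    by (simp add: P.a_ac)
  then show ?thesis
    unfolding nf_def using p q uc I_facts(3)
    by (intro exI[of _ "S \<union> S'"] exI[of _ "\<lambda>\<beta>. u \<beta> \<oplus>\<^bsub>R\<^esub> u' \<beta>"] exI[of _ "i \<oplus>\<^bsub>P\<^esub> i'"]) auto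
qed

lemma nf_I: "i \<in> I \<Longrightarrow> nf i"
  unfolding nf_def using I_facts(2)
  by (intro exI[of _ "{}"] exI[of _ "\<lambda>_. \<zero>\<^bsub>R\<^esub>"] exI[of _ i]) simp

lemma nf_term:
  assumes "k \<in> carrier R"
  shows "nf (const k \<otimes>\<^bsub>P\<^esub> z \<beta>)"
  unfolding nf_def using assms I_facts(5) const_closed[OF assms] z_closed
  by (intro exI[of _ "{\<beta>}"] exI[of _ "\<lambda>_. k"] exI[of _ "\<zero>\<^bsub>P\<^esub>"]) (simp add: P.finsum_insert)

lemma nf_finsum: "finite S \<Longrightarrow> (\<And>\<beta>. \<beta> \<in> S \<Longrightarrow> f \<beta> \<in> carrier P \<and> nf (f \<beta>)) \<Longrightarrow> nf (finsum P f S)"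
proof (induction S rule: finite_induct)
  case empty
  show ?case using nf_I[OF I_facts(5)] by simp
next
  case (insert \<beta> S)
  then show ?case by (simp add: P.finsum_insert Pi_iff nf_add)
qed

text \<open>A relation is needed when two variables meet. Opposite indices produce a constant, other
  indices the variable of the sum, so in either case the result is again a combination of the
  \<open>z\<close>.\<close>

lemma nf_y_term:
  assumes \<gamma>: "\<gamma> \<noteq> 0" and k: "k \<in> carrier R"
  shows "nf (y \<gamma> \<otimes>\<^bsub>P\<^esub> (const k \<otimes>\<^bsub>P\<^esub> z \<beta>))"
proof (cases "\<beta> = 0")
  case True
  have "y \<gamma> \<otimes>\<^bsub>P\<^esub> (const k \<otimes>\<^bsub>P\<^esub> z \<beta>) = const k \<otimes>\<^bsub>P\<^esub> z \<gamma>"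
    using \<gamma> True y_closed[OF \<gamma>] const_closed[OF k] by (simp add: z_def P.m_comm)
  then show ?thesis using nf_term[OF k] by simp
next
  case False
  have cl: "y \<gamma> \<in> carrier P" "y \<beta> \<in> carrier P" "const k \<in> carrier P" "const x \<in> carrier P"
    using y_closed \<gamma> False const_closed k x(1) by auto
  have reduce: "nf (y \<gamma> \<otimes>\<^bsub>P\<^esub> (const k \<otimes>\<^bsub>P\<^esub> z \<beta>))"
    if q: "q \<in> carrier P" and u: "y \<gamma> \<otimes>\<^bsub>P\<^esub> y \<beta> \<ominus>\<^bsub>P\<^esub> q \<in> U_relations G \<chi>" and n: "nf (const k \<otimes>\<^bsub>P\<^esub> q)" for q
  proof -
    have "y \<gamma> \<otimes>\<^bsub>P\<^esub> (const k \<otimes>\<^bsub>P\<^esub> z \<beta>) = const k \<otimes>\<^bsub>P\<^esub> (y \<gamma> \<otimes>\<^bsub>P\<^esub> y \<beta>)"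
      using cl False by (simp add: z_def P.m_ac)
    also have "y \<gamma> \<otimes>\<^bsub>P\<^esub> y \<beta> = (y \<gamma> \<otimes>\<^bsub>P\<^esub> y \<beta> \<ominus>\<^bsub>P\<^esub> q) \<oplus>\<^bsub>P\<^esub> q"
      using cl q by (simp add: a_minus_def P.a_assoc P.l_neg)
    also have "const k \<otimes>\<^bsub>P\<^esub> \<dots> = const k \<otimes>\<^bsub>P\<^esub> (y \<gamma> \<otimes>\<^bsub>P\<^esub> y \<beta> \<ominus>\<^bsub>P\<^esub> q) \<oplus>\<^bsub>P\<^esub> const k \<otimes>\<^bsub>P\<^esub> q"
      using cl q by (simp add: P.r_distr)
    finally show ?thesis
      using nf_add[OF nf_I[OF I_facts(4)[OF I_facts(1)[OF u] cl(3)]] n] by simp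
  qed
  show ?thesis
  proof (cases "\<gamma> = - \<beta>")
    case True
    define q where "q = (\<one>\<^bsub>P\<^esub> \<oplus>\<^bsub>P\<^esub> const x) \<oplus>\<^bsub>P\<^esub> (\<one>\<^bsub>P\<^esub> \<oplus>\<^bsub>P\<^esub> const x)"
    define l where "l = k \<otimes>\<^bsub>R\<^esub> ((\<one>\<^bsub>R\<^esub> \<oplus>\<^bsub>R\<^esub> x) \<oplus>\<^bsub>R\<^esub> (\<one>\<^bsub>R\<^esub> \<oplus>\<^bsub>R\<^esub> x))"
    have l: "l \<in> carrier R" using k x(1) by (simp add: l_def)
    have "const k \<otimes>\<^bsub>P\<^esub> q = const l \<otimes>\<^bsub>P\<^esub> z 0"
      using k x(1) const_closed[OF l] by (simp add: q_def l_def const_mult const_add const_one z_def)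
    then have "nf (const k \<otimes>\<^bsub>P\<^esub> q)" using nf_term[OF l] by simp
    moreover have "\<beta> = - \<gamma>" using True by simp
    then have "y \<gamma> \<otimes>\<^bsub>P\<^esub> y \<beta> \<ominus>\<^bsub>P\<^esub> q \<in> U_relations G \<chi>"
      unfolding U_relations_eq q_def using \<gamma> by blast
    moreover have "q \<in> carrier P" using cl by (simp add: q_def)
    ultimately show ?thesis by (intro reduce)
  next
    case ne: False
    then have s: "\<gamma> + \<beta> \<noteq> 0" by (simp add: add_eq_0_iff2)
    define q where "q = y (\<gamma> + \<beta>) \<oplus>\<^bsub>P\<^esub> y (\<gamma> + \<beta>)"
    have "const k \<otimes>\<^bsub>P\<^esub> q = const k \<otimes>\<^bsub>P\<^esub> z (\<gamma> + \<beta>) \<oplus>\<^bsub>P\<^esub> const k \<otimes>\<^bsub>P\<^esub> z (\<gamma> + \<beta>)"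
      using s cl y_closed[OF s] by (simp add: q_def z_def P.r_distr)
    then have "nf (const k \<otimes>\<^bsub>P\<^esub> q)" using nf_add[OF nf_term[OF k] nf_term[OF k]] by simp
    moreover have "y \<gamma> \<otimes>\<^bsub>P\<^esub> y \<beta> \<ominus>\<^bsub>P\<^esub> q \<in> U_relations G \<chi>"
      unfolding U_relations_eq q_def using \<gamma> False ne by blast
    moreover have "q \<in> carrier P" using y_closed[OF s] by (simp add: q_def)
    ultimately show ?thesis by (intro reduce)
  qed
qed

lemma nf_y_mult:
  assumes \<gamma>: "\<gamma> \<noteq> 0" and "nf p"
  shows "nf (y \<gamma> \<otimes>\<^bsub>P\<^esub> p)"
proof -
  obtain S r i where p: "finite S" "\<And>\<beta>. r \<beta> \<in> carrier R" "i \<in> I"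
    "p = i \<oplus>\<^bsub>P\<^esub> (\<Oplus>\<^bsub>P\<^esub>\<beta>\<in>S. const (r \<beta>) \<otimes>\<^bsub>P\<^esub> z \<beta>)" using assms(2) unfolding nf_def by blast
  have tc: "const (r \<beta>) \<otimes>\<^bsub>P\<^esub> z \<beta> \<in> carrier P" for \<beta>
    using const_closed[OF p(2)] z_closed by simp
  then have c: "(\<Oplus>\<^bsub>P\<^esub>\<beta>\<in>S. const (r \<beta>) \<otimes>\<^bsub>P\<^esub> z \<beta>) \<in> carrier P" by (intro P.finsum_closed) auto
  have "y \<gamma> \<otimes>\<^bsub>P\<^esub> p = y \<gamma> \<otimes>\<^bsub>P\<^esub> i \<oplus>\<^bsub>P\<^esub> (\<Oplus>\<^bsub>P\<^esub>\<beta>\<in>S. y \<gamma> \<otimes>\<^bsub>P\<^esub> (const (r \<beta>) \<otimes>\<^bsub>P\<^esub> z \<beta>))"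
    unfolding p(4) using c I_facts(2)[OF p(3)] y_closed[OF \<gamma>] p(1) tc
    by (simp add: P.r_distr P.finsum_rdistr Pi_iff)
  moreover have "nf (\<Oplus>\<^bsub>P\<^esub>\<beta>\<in>S. y \<gamma> \<otimes>\<^bsub>P\<^esub> (const (r \<beta>) \<otimes>\<^bsub>P\<^esub> z \<beta>))"
    using nf_y_term[OF \<gamma> p(2)] tc y_closed[OF \<gamma>] by (intro nf_finsum p) auto
  ultimately show ?thesis
    using nf_add[OF nf_I[OF I_facts(4)[OF p(3) y_closed[OF \<gamma>]]]] by simp
qed

lemma nf: "p \<in> carrier P \<Longrightarrow> nf p"
  unfolding R.indexed_poly_ring_simps
proof (induction p rule: R.indexed_pset.induct)
  case (indexed_const k)
  then show ?case using nf_term[of k 0] const_closed[of k] by (simp add: z_def)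
next
  case (indexed_padd p q)
  then show ?case using nf_add[of p q] by (simp add: R.indexed_poly_ring_simps)
next
  case (indexed_pmult p \<beta>)
  then show ?case
    using nf_y_mult[of \<beta> p] pmult_eq[of p \<beta>] by (simp add: R.indexed_poly_ring_simps(1))
qed

text \<open>The annihilator of \<open>1 + \<chi>\<close> is generated by \<open>1 - \<chi>\<close>: if \<open>(1 + \<chi>) r = 0\<close>, then \<open>r\<close> vanishes
  where \<open>\<chi> = 1\<close>, and \<open>r = (1 - \<chi>) r'\<close> where \<open>r'\<close> is the part of \<open>r\<close> on which \<open>c\<close> acts trivially.\<close>

lemma annihilator:
  assumes k: "k \<in> carrier R" and zero: "\<And>g. g \<in> carrier G \<Longrightarrow> D.class_char k g * (1 + \<chi> g) = 0"
  obtains l where "l \<in> carrier R" "k = l \<otimes>\<^bsub>R\<^esub> (x \<ominus>\<^bsub>R\<^esub> \<one>\<^bsub>R\<^esub>)"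
proof -
  obtain f where f: "f \<in> carrier D.F" "k = D.rel +>\<^bsub>D.F\<^esub> f" using k by (auto simp: D.G0_simps)
  have fd: "Poly_Mapping.keys f \<subseteq> fd_modules (group_algebra G)" using f(1) by (simp add: D.F_simps)
  \<comment> \<open>The sign is due to the form \<open>\<chi> y - y\<close> of the generators, which
    asks for a multiple of \<open>x - 1\<close> rather than \<open>1 - x\<close>.\<close>
  define f' where "f' = - lin (\<lambda>N. bas (fixed N)) f"
  have "lin (\<lambda>N. bas (fixed N)) f \<in> carrier D.F"
    unfolding D.F_simps mem_Collect_eq
    by (rule order.trans[OF keys_lin]) (use fd fixed(1) in \<open>auto simp: keys_single\<close>)
  then have f': "f' \<in> carrier D.F" using D.F_closed(3) by (simp add: f'_def)
  define l where "l = D.rel +>\<^bsub>D.F\<^esub> f'"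
  have l: "l \<in> carrier R" using f' by (auto simp: l_def D.G0_simps)
  have kg: "D.class_char k g = iv.ext (\<lambda>N. mtr (act N g)) f" if "g \<in> carrier G" for g
    using that D.class_char_coset[OF f(1)] by (simp add: f(2)) (simp add: D.char_def)
  have lg: "D.class_char l g = - (1 / 2 * (D.class_char k g + D.class_char k (g \<otimes> c)))" if g: "g \<in> carrier G" for g
  proof -
    have gc: "g \<otimes> c \<in> carrier G" using g c_closed by simp
    have "D.class_char l g = iv.ext (\<lambda>N. mtr (act N g)) f'"
      using g D.class_char_coset[OF f'] by (simp add: l_def) (simp add: D.char_def)
    also have "\<dots> = - iv.ext (\<lambda>N. (1 / 2) * (mtr (act N g) + mtr (act N (g \<otimes> c)))) f"
      unfolding f'_def iv.ext_uminus iv.ext_lin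
      by (intro arg_cong[of _ _ uminus] iv.ext_cong) (use fd fixed(2)[OF _ g] in auto)
    also have "\<dots> = - ((1 / 2) * (D.class_char k g + D.class_char k (g \<otimes> c)))"
      unfolding iv.ext_mult_fun iv.ext_add_fun kg[OF g] kg[OF gc] ..
    finally show ?thesis .
  qed
  have xm: "D.class_char (x \<ominus>\<^bsub>R\<^esub> \<one>\<^bsub>R\<^esub>) g = \<chi> g - 1" if g: "g \<in> carrier G" for g
  proof -
    have "D.class_char (\<ominus>\<^bsub>R\<^esub> \<one>\<^bsub>R\<^esub>) g + 1 = 0"
      using D.class_char_hom(2)[of "\<ominus>\<^bsub>R\<^esub> \<one>\<^bsub>R\<^esub>" "\<one>\<^bsub>R\<^esub>" g] g by (simp add: R.l_neg D.class_char_hom)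
    then show ?thesis
      using g x by (simp add: a_minus_def D.class_char_hom eq_neg_iff_add_eq_0[symmetric])
  qed
  have "k = l \<otimes>\<^bsub>R\<^esub> (x \<ominus>\<^bsub>R\<^esub> \<one>\<^bsub>R\<^esub>)"
  proof (rule D.class_char_eqI[OF k])
    fix g assume g: "g \<in> carrier G"
    have gc: "g \<otimes> c \<in> carrier G" "\<chi> (g \<otimes> c) = - \<chi> g" using g c_closed by (simp_all add: chi_mult chi_c)
    \<comment> \<open>If \<open>\<chi> g = 1\<close>, both sides vanish. If
      \<open>\<chi> g = -1\<close>, then \<open>\<chi> (g c) = 1\<close>, so \<open>k\<close>
      vanishes at \<open>g c\<close>, and the factor \<open>-1/2\<close> cancels against
      \<open>\<chi> g - 1 = -2\<close>.\<close>
    have "D.class_char k g = - (1 / 2 * (D.class_char k g + D.class_char k (g \<otimes> c))) * (\<chi> g - 1)"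
      using chi_cases[OF g] zero[OF g] zero[OF gc(1)] gc(2) by auto
    then show "D.class_char k g = D.class_char (l \<otimes>\<^bsub>R\<^esub> (x \<ominus>\<^bsub>R\<^esub> \<one>\<^bsub>R\<^esub>)) g"
      using l x(1) g by (simp add: D.class_char_hom lg xm)
  qed (use l x(1) in simp)
  with l show thesis by (rule that)
qed

lemma kernel_subset: "a_kernel P T \<Psi> \<subseteq> I"
proof
  fix p assume "p \<in> a_kernel P T \<Psi>"
  then have p: "p \<in> carrier P" "\<And>g. g \<in> carrier G \<Longrightarrow> E g p = 0" by (auto simp: kernel_\<Psi>)
  obtain S r i where *: "finite S" "\<And>\<beta>. r \<beta> \<in> carrier R" "i \<in> I"
    "p = i \<oplus>\<^bsub>P\<^esub> (\<Oplus>\<^bsub>P\<^esub>\<beta>\<in>S. const (r \<beta>) \<otimes>\<^bsub>P\<^esub> z \<beta>)" using nf[OF p(1)] unfolding nf_def by blast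
  have tc: "const (r \<beta>) \<otimes>\<^bsub>P\<^esub> z \<beta> \<in> carrier P" for \<beta>
    using const_closed[OF *(2)] z_closed by simp
  then have c: "(\<Oplus>\<^bsub>P\<^esub>\<beta>\<in>S. const (r \<beta>) \<otimes>\<^bsub>P\<^esub> z \<beta>) \<in> carrier P" by (intro P.finsum_closed) auto
  have "I \<subseteq> a_kernel P T \<Psi>"
    by (rule P.genideal_minimal[OF ring_hom_ring.kernel_is_ideal[OF ring_hom_\<Psi>] U_subset_kernel])
  then have i0: "E g i = 0" if "g \<in> carrier G" for g using *(3) that by (auto simp: kernel_\<Psi>)
  \<comment> \<open>The coefficient of \<open>exp(\<beta> t)\<close> in the value of
    \<open>z \<beta>\<close>. It is 1 for the constant term, so that \<open>r 0\<close> must be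
    zero, and \<open>1 + \<chi>\<close> otherwise, so that \<open>r \<beta>\<close> is only known to
    be annihilated by \<open>1 + \<chi>\<close>.\<close>
  define m where "m g \<beta> = (if \<beta> = 0 then 1 else 1 + \<chi> g)" for g and \<beta> :: 'k
  have Ez: "E g (z \<beta>) = fps_const (m g \<beta>) * fps_exp \<beta>" if "g \<in> carrier G" for g \<beta>
    using that by (simp add: z_def m_def E_one E_y)
  have m: "D.class_char (r \<beta>) g * m g \<beta> = 0" if g: "g \<in> carrier G" and \<beta>: "\<beta> \<in> S" for g \<beta>
  proof (rule fps_exp_independent[OF *(1) _ \<beta>])
    have "(\<Sum>\<beta>\<in>S. E g (const (r \<beta>) \<otimes>\<^bsub>P\<^esub> z \<beta>)) = 0"
      using p(2)[OF g] c tc I_facts(2)[OF *(3)] by (simp add: *(4) E_add g i0 E_finsum *(1))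
    then show "(\<Sum>\<beta>\<in>S. fps_const (D.class_char (r \<beta>) g * m g \<beta>) * fps_exp \<beta>) = 0"
      by (simp add: E_mult g const_closed *(2) z_closed E_const Ez mult.assoc[symmetric])
  qed
  have summand: "const (r \<beta>) \<otimes>\<^bsub>P\<^esub> z \<beta> \<in> I" if \<beta>: "\<beta> \<in> S" for \<beta>
  proof (cases "\<beta> = 0")
    case True
    have "r \<beta> = \<zero>\<^bsub>R\<^esub>"
      by (rule D.class_char_eqI[OF *(2)]) (use m[OF _ \<beta>] True in \<open>auto simp: m_def D.class_char_hom\<close>)
    then show ?thesis using I_facts(5) z_closed by (simp add: const_zero)
  next
    case False
    obtain l where l: "l \<in> carrier R" "r \<beta> = l \<otimes>\<^bsub>R\<^esub> (x \<ominus>\<^bsub>R\<^esub> \<one>\<^bsub>R\<^esub>)"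
      by (rule annihilator[OF *(2)[of \<beta>]]) (use m[OF _ \<beta>] False in \<open>auto simp: m_def\<close>)
    have xm: "const (x \<ominus>\<^bsub>R\<^esub> \<one>\<^bsub>R\<^esub>) = const x \<ominus>\<^bsub>P\<^esub> \<one>\<^bsub>P\<^esub>"
    proof -
      have "const (\<ominus>\<^bsub>R\<^esub> \<one>\<^bsub>R\<^esub>) = \<ominus>\<^bsub>P\<^esub> \<one>\<^bsub>P\<^esub>"
        by (rule P.minus_equality[symmetric])
          (simp_all add: const_closed const_add[symmetric] const_one[symmetric] const_zero[symmetric] R.l_neg)
      then show ?thesis by (simp add: a_minus_def const_add)
    qed
    have "const (r \<beta>) = const l \<otimes>\<^bsub>P\<^esub> (const x \<ominus>\<^bsub>P\<^esub> \<one>\<^bsub>P\<^esub>)"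
      unfolding l(2) xm[symmetric] using l(1) x(1) by (intro const_mult) simp_all
    \<comment> \<open>With \<open>r \<beta>\<close> a multiple of \<open>x - 1\<close>, the term is
      a multiple of the generator \<open>\<chi> y - y\<close> at \<open>\<beta>\<close>.\<close>
    then have "const (r \<beta>) \<otimes>\<^bsub>P\<^esub> z \<beta> = const l \<otimes>\<^bsub>P\<^esub> (const x \<otimes>\<^bsub>P\<^esub> y \<beta> \<ominus>\<^bsub>P\<^esub> y \<beta>)"
      using False l(1) x(1) y_closed[OF False] const_closed[OF l(1)] const_closed[OF x(1)]
      by (simp add: z_def P.m_assoc a_minus_def P.l_distr P.l_minus)
    moreover have "const x \<otimes>\<^bsub>P\<^esub> y \<beta> \<ominus>\<^bsub>P\<^esub> y \<beta> \<in> U_relations G \<chi>"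
      unfolding U_relations_eq using False by blast
    ultimately show ?thesis using I_facts(1,4) const_closed[OF l(1)] by simp
  qed
  have "(\<Oplus>\<^bsub>P\<^esub>\<beta>\<in>S. const (r \<beta>) \<otimes>\<^bsub>P\<^esub> z \<beta>) \<in> I"
    using *(1) summand
  proof (induction S rule: finite_induct)
    case empty
    show ?case using I_facts(5) by simp
  next
    case (insert \<beta> S)
    then show ?case using tc I_facts(3) by (simp add: P.finsum_insert Pi_iff)
  qed
  then show "p \<in> I" using I_facts(3) *(3,4) by simp
qed

lemma kernel_eq: "a_kernel P T \<Psi> = I"
  using kernel_subset P.genideal_minimal[OF ring_hom_ring.kernel_is_ideal[OF ring_hom_\<Psi>] U_subset_kernel]
  by blast

text \<open>Both sides are isomorphic to the ring \<open>H.chars\<close>: the left through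
  characters of classes, the right through the first isomorphism theorem for \<open>\<Psi>\<close>,
  whose kernel is \<open>I\<close>.\<close>

theorem G0_hopf_ore: "G0 H \<simeq> P Quot I"
proof -
  interpret h: ring_hom_ring P T \<Psi> by (rule ring_hom_\<Psi>)
  have ring: "ring (P Quot I)"
    using ideal.quotient_is_ring[OF ideal_I] .
  have "(\<lambda>Y. the_elem (\<Psi> ` Y)) \<in> ring_iso (P Quot I) (T\<lparr>carrier := H.chars\<rparr>)"
    using h.FactRing_iso_set_aux unfolding kernel_eq image_\<Psi> .
  from ring_iso_set_trans[OF H.class_char_iso ring_iso_set_sym[OF ring this]]
  show ?thesis unfolding is_ring_iso_def by blast
qed

end

text \<open>The laws for all elements are checked on \<open>a\<close> and \<open>b\<close> and
  carried along \<open>generate\<close>. \<open>a^m\<close> is central because \<open>b\<close>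
  inverts powers of \<open>a\<close> and \<open>a^m\<close> is its own inverse; its value under
  \<open>\<chi>\<close> is \<open>(-1)^m = -1\<close>.\<close>

lemma dihedral_hopf_ore_extension:
  fixes D :: "('g, 'z) monoid_scheme" and \<chi> :: "'g \<Rightarrow> 'k::{alg_closed_field, field_char_0}"
  assumes "n = 2 * m" and "odd m" and D: "dihedral D n a b"
    and \<chi>: "\<chi> \<in> linear_characters D" "\<chi> a = -1" "\<chi> b = 1"
  shows "hopf_ore_extension D \<chi> (a [^]\<^bsub>D\<^esub> m)"
proof -
  have "group D" using D by (simp add: dihedral_def)
  then interpret group D .
  have ab: "a \<in> carrier D" "b \<in> carrier D" and gen: "generate D {a, b} = carrier D"
    and an: "a [^]\<^bsub>D\<^esub> n = \<one>\<^bsub>D\<^esub>" and b2: "b \<otimes>\<^bsub>D\<^esub> b = \<one>\<^bsub>D\<^esub>"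
    and ba: "(b \<otimes>\<^bsub>D\<^esub> a) \<otimes>\<^bsub>D\<^esub> (b \<otimes>\<^bsub>D\<^esub> a) = \<one>\<^bsub>D\<^esub>" and ord: "order D = 2 * n"
    using D by (auto simp: dihedral_def numeral_2_eq_2)
  have m: "m > 0" using \<open>odd m\<close> by (cases m) auto
  have mult: "\<chi> (g \<otimes>\<^bsub>D\<^esub> h) = \<chi> g * \<chi> h" if "g \<in> carrier D" "h \<in> carrier D" for g h
    using \<chi>(1) that by (simp add: linear_characters_def hom_def)
  have one: "\<chi> \<one>\<^bsub>D\<^esub> = 1" using character_one[OF group_axioms \<chi>(1)] .
  have inv: "\<chi> (inv\<^bsub>D\<^esub> g) = \<chi> g" if "g \<in> carrier D" "\<chi> g * \<chi> g = 1" for g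
  proof -
    have "\<chi> (inv\<^bsub>D\<^esub> g) * \<chi> g = 1" using mult[of "inv\<^bsub>D\<^esub> g" g] that(1) one by simp
    then show ?thesis using that(2) by (metis mult_cancel_right mult_zero_right zero_neq_one)
  qed
  have "\<chi> g * \<chi> g = 1" if "g \<in> generate D {a, b}" for g
    using that
  proof induction
    case (eng g h)
    then have "\<chi> (g \<otimes>\<^bsub>D\<^esub> h) = \<chi> g * \<chi> h" using mult gen by simp
    then have "\<chi> (g \<otimes>\<^bsub>D\<^esub> h) * \<chi> (g \<otimes>\<^bsub>D\<^esub> h) = (\<chi> g * \<chi> g) * (\<chi> h * \<chi> h)" by (simp add: mult_ac)
    then show ?case using eng by simp
  qed (use ab \<chi> one inv in auto)
  then have square: "\<chi> g * \<chi> g = 1" if "g \<in> carrier D" for g using that gen by simp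
  define c where "c = a [^]\<^bsub>D\<^esub> m"
  have c: "c \<in> carrier D" using ab by (simp add: c_def)
  have cc: "c \<otimes>\<^bsub>D\<^esub> c = \<one>\<^bsub>D\<^esub>"
    using an ab unfolding c_def by (simp add: nat_pow_mult \<open>n = 2 * m\<close> mult_2)
  have pow: "\<chi> (a [^]\<^bsub>D\<^esub> k) = (-1) ^ k" for k :: nat
    by (induction k) (use ab \<chi> one mult in auto)
  have chi_c: "\<chi> c = -1" using pow[of m] \<open>odd m\<close> by (simp add: c_def)
  have bab: "b \<otimes>\<^bsub>D\<^esub> a = inv\<^bsub>D\<^esub> a \<otimes>\<^bsub>D\<^esub> b"
  proof -
    have "inv\<^bsub>D\<^esub> (b \<otimes>\<^bsub>D\<^esub> a) = b \<otimes>\<^bsub>D\<^esub> a" using ba ab by (intro inv_equality) auto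
    moreover have "inv\<^bsub>D\<^esub> b = b" using b2 ab by (intro inv_equality) auto
    ultimately show ?thesis using ab by (simp add: inv_mult_group)
  qed
  have bpow: "b \<otimes>\<^bsub>D\<^esub> a [^]\<^bsub>D\<^esub> k = inv\<^bsub>D\<^esub> (a [^]\<^bsub>D\<^esub> k) \<otimes>\<^bsub>D\<^esub> b" for k :: nat
  proof (induction k)
    case (Suc k)
    have "b \<otimes>\<^bsub>D\<^esub> a [^]\<^bsub>D\<^esub> Suc k = (b \<otimes>\<^bsub>D\<^esub> a [^]\<^bsub>D\<^esub> k) \<otimes>\<^bsub>D\<^esub> a" using ab by (simp add: m_assoc)
    also have "\<dots> = inv\<^bsub>D\<^esub> (a [^]\<^bsub>D\<^esub> k) \<otimes>\<^bsub>D\<^esub> (b \<otimes>\<^bsub>D\<^esub> a)" unfolding Suc using ab by (simp add: m_assoc)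
    also have "\<dots> = (inv\<^bsub>D\<^esub> (a [^]\<^bsub>D\<^esub> k) \<otimes>\<^bsub>D\<^esub> inv\<^bsub>D\<^esub> a) \<otimes>\<^bsub>D\<^esub> b" unfolding bab using ab by (simp add: m_assoc)
    also have "inv\<^bsub>D\<^esub> (a [^]\<^bsub>D\<^esub> k) \<otimes>\<^bsub>D\<^esub> inv\<^bsub>D\<^esub> a = inv\<^bsub>D\<^esub> (a [^]\<^bsub>D\<^esub> Suc k)"
      using ab nat_pow_Suc2[of a k] by (simp add: inv_mult_group del: nat_pow_Suc)
    finally show ?case .
  qed (use ab in simp)
  have "inv\<^bsub>D\<^esub> c = c" using cc c by (intro inv_equality) auto
  then have cb: "c \<otimes>\<^bsub>D\<^esub> b = b \<otimes>\<^bsub>D\<^esub> c" using bpow[of m] by (simp add: c_def)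
  have ca: "c \<otimes>\<^bsub>D\<^esub> a = a \<otimes>\<^bsub>D\<^esub> c" using ab nat_pow_Suc2[of a m] by (simp add: c_def)
  have inv_comm: "c \<otimes>\<^bsub>D\<^esub> inv\<^bsub>D\<^esub> g = inv\<^bsub>D\<^esub> g \<otimes>\<^bsub>D\<^esub> c" if "g \<in> carrier D" "c \<otimes>\<^bsub>D\<^esub> g = g \<otimes>\<^bsub>D\<^esub> c" for g
    using that c by (metis inv_closed inv_solve_left inv_solve_right m_assoc m_closed)
  have "c \<otimes>\<^bsub>D\<^esub> g = g \<otimes>\<^bsub>D\<^esub> c" if "g \<in> generate D {a, b}" for g
    using that
  proof induction
    case (eng g h)
    then have gh: "g \<in> carrier D" "h \<in> carrier D" using gen by auto
    have "c \<otimes>\<^bsub>D\<^esub> (g \<otimes>\<^bsub>D\<^esub> h) = (g \<otimes>\<^bsub>D\<^esub> c) \<otimes>\<^bsub>D\<^esub> h" using gh c eng by (simp add: m_assoc[symmetric])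
    also have "\<dots> = g \<otimes>\<^bsub>D\<^esub> (h \<otimes>\<^bsub>D\<^esub> c)" using gh c eng by (simp add: m_assoc)
    finally show ?case using gh c by (simp add: m_assoc)
  qed (use ab c ca cb inv_comm in auto)
  then have central: "c \<otimes>\<^bsub>D\<^esub> g = g \<otimes>\<^bsub>D\<^esub> c" if "g \<in> carrier D" for g using that gen by simp
  \<comment> \<open>An infinite set has cardinality 0, so the nonzero order forces
    finiteness.\<close>
  have fin: "finite (carrier D)"
    using ord m \<open>n = 2 * m\<close> by (metis card.infinite mult_eq_0_iff nat_neq_iff order_def zero_neq_numeral)
  show ?thesis
    unfolding c_def[symmetric]
    by unfold_locales (rule fin, erule (1) mult, erule square, rule c, rule cc, rule chi_c, erule central)
qed

theorem theorem6p14: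
  fixes D :: "('g, 'z) monoid_scheme"
    and a b :: 'g
    and \<chi> :: "'g \<Rightarrow> 'k::{alg_closed_field, field_char_0}"
    and m n :: nat
  assumes "n = 2 * m" and "m > 1" and "odd m"
    and "dihedral D n a b"
    and "\<chi> \<in> linear_characters D" and "\<chi> a = -1" and "\<chi> b = 1"
  shows "G0 (hopf_ore D \<chi> (a [^]\<^bsub>D\<^esub> m)) \<simeq>
    indexed_poly_ring (G0 (group_algebra D :: ('k, 'g) hopf_algebra)) {\<beta>::'k. \<beta> \<noteq> 0} Quot
      Idl\<^bsub>indexed_poly_ring (G0 (group_algebra D :: ('k, 'g) hopf_algebra)) {\<beta>::'k. \<beta> \<noteq> 0}\<^esub>
        (U_relations D \<chi>)"
  by (rule hopf_ore_extension.G0_hopf_ore[OF dihedral_hopf_ore_extension[OF assms(1,3-7)]])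

end
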